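(* Let $a_{r,s},\dot a_{r,s}>0$ and $b_{r+1,s},\dot b_{r,s+1}>0$ for $(r,s)\in\Omega$, and let $Q_{r,s}>0$ for $(r,s)\in\Omega$ with $Q_{1,0}=Q_{0,1}=1$. Assume: (i) there are $\alpha\in[0,1]$ and $0<c_\alpha,C_\alpha<\infty$ with $c_\alpha(r+s)^\alpha\le a_{r,s},\dot a_{r,s}\le C_\alpha(r+s)^\alpha$ for all $r+s\ge1$; (ii) $b_{r+1,s}=a_{r,s}\frac{Q_{r,s}}{Q_{r+1,s}}$ and $\dot b_{r,s+1}=\dot a_{r,s}\frac{Q_{r,s}}{Q_{r,s+1}}$ for all $r+s\ge1$; (iii) there is $\Phi\in C^2((0,1))\cap C^0([0,1])$ such that $\lim_{\xi\to1}(1-\xi)\Phi'(\xi)$ and $\lim_{\xi\to0}\xi\Phi'(\xi)$ exist in $\mathbb R$ and, with $\varphi(\xi)=e^{\Phi(\xi)+(1-\xi)\Phi'(\xi)}$ and $\psi(\xi)=e^{\Phi(\xi)-\xi\Phi'(\xi)}$, $$\frac{Q_{r+1,s}}{Q_{r,s}}=\varphi\Big(\frac{r+1}{r+s+1}\Big)f_{r,s},\qquad \frac{Q_{r,s+1}}{Q_{r,s}}=\psi\Big(\frac{r}{r+s+1}\Big)g_{r,s}\qquad\text{for all }(r,s)\in\Omega,$$ where for every $\varepsilon>0$ there is $N_0\in\mathbb N$ with $|1-f_{r,s}|<\varepsilon$ and $|1-g_{r,s}|<\varepsilon$ for all $r+s\ge N_0$; (iv) there is $\gamma>0$ with $(1-\xi)\Phi''(\xi)\le-\gamma$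 and $\xi\Phi''(\xi)\le-\gamma$ for all $\xi\in(0,1)$; (v) the limits $\lim_{\xi\to0}\xi\varphi(\xi)$ and $\lim_{\xi\to1}(1-\xi)\psi(\xi)$ exist in $\mathbb R$; (vi) $\displaystyle\limsup_{n\to\infty}\max_{0<r\le n}\Big(\frac{f_{r,n-r}}{f_{r-1,n-r+1}}\Big)^{n+1}\le1$ and $\displaystyle\liminf_{n\to\infty}\min_{0\le r<n}\Big(\frac{g_{r+1,n-r-1}}{g_{r,n-r}}\Big)^{n+1}\ge1$. Fix $\rho,\sigma>0$ and $\delta>0$, and let $(z,w)\in\mathcal E$ be the pair determined by $(\rho,\sigma)$ (see context). Then there exist constants $K<\infty$, $\delta_2>0$ and $M<\infty$ such that for all $c\in X^+_{\rho,\sigma}$ and all $N\in\mathbb N$ with $N\ge M$, $$\sum_{r+s\ge N+1}(r+s)c_{r,s}\le\delta_2\quad\text{and}\quad H[c\,|\,\bar c^{z,w}]>\delta\qquad\Longrightarrow\qquad D(c)\ge\frac{N^{\alpha-1}}{K}.$$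
   Context: $\Omega=\{(r,s)\in\mathbb N_0^2: r+s\ge1\}$; all sums over $r+s$ range over subsets of $\Omega$. $X^+$ is the set of $c=(c_{r,s})_{(r,s)\in\Omega}$ with $c_{r,s}\ge0$, $\rho(c):=\sum_{\Omega} r c_{r,s}<\infty$, $\sigma(c):=\sum_\Omega s c_{r,s}<\infty$; $X^+_{\rho,\sigma}=\{c\in X^+:\rho(c)=\rho,\ \sigma(c)=\sigma\}$. Dissipation: $D(c)=\sum_{\Omega}\Big[(a_{r,s}c_{1,0}c_{r,s}-b_{r+1,s}c_{r+1,s})\ln\frac{a_{r,s}c_{1,0}c_{r,s}}{b_{r+1,s}c_{r+1,s}}+(\dot a_{r,s}c_{0,1}c_{r,s}-\dot b_{r,s+1}c_{r,s+1})\ln\frac{\dot a_{r,s}c_{0,1}c_{r,s}}{\dot b_{r,s+1}c_{r,s+1}}\Big]\in[0,\infty]$, where $(x-y)\ln(x/y)$ is read as $0$ if $x=y=0$ and $+\infty$ if exactly one of $x,y$ is $0$. Equilibria: $\bar c^{z,w}_{r,s}=z^rw^sQ_{r,s}$ and $\mathcal E=\{(z,w): z,w\ge0,\ \rho(\bar c^{z,w})+\sigma(\bar c^{z,w})<\infty\}$. For $\rho,\sigma>0$, the pair $(z,w)\in\mathcal E$ (with $z,w>0$) determined by $(\rho,\sigma)$ is the unique one satisfying $\ln\frac zu\,(\rho-\rho(\bar c^{z,w}))+\ln\frac wv\,(\sigma-\sigma(\bar c^{z,w}))\ge0$ for all $u,v>0$ with $(u,v)\in\mathcal E$ (existence and uniqueness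 is a known result under these hypotheses). Relative entropy: $H[c|\bar c^{z,w}]=\sum_\Omega\bar c^{z,w}_{r,s}\Psi(c_{r,s}/\bar c^{z,w}_{r,s})$, $\Psi(x)=x\ln x+1-x$, $\Psi(0)=1$. $\varphi$ is extended continuously to $\xi=1$ and $\psi$ to $\xi=0$ (possible by (iii)). *)

theory Defs
  imports "HOL-Analysis.Analysis"
begin

text \<open>
  A family indexed by \<open>Omega\<close> is a curried function on pairs of naturals; its value at \<open>(0, 0)\<close>
  is never used.
\<close>

definition Omega :: "(nat \<times> nat) set" where
  "Omega = {(r, s). r + s \<ge> 1}"

definition finite_mass :: "(nat \<Rightarrow> nat \<Rightarrow> real) \<Rightarrow> bool" where
  "finite_mass c \<longleftrightarrow>
     (\<lambda>(r, s). real r * c r s) summable_on Omega \<and>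
     (\<lambda>(r, s). real s * c r s) summable_on Omega"

text \<open>The masses are meaningful only for families of finite mass.\<close>

definition rho_mass :: "(nat \<Rightarrow> nat \<Rightarrow> real) \<Rightarrow> real" where
  "rho_mass c = (\<Sum>\<^sub>\<infinity>(r, s)\<in>Omega. real r * c r s)"

definition sigma_mass :: "(nat \<Rightarrow> nat \<Rightarrow> real) \<Rightarrow> real" where
  "sigma_mass c = (\<Sum>\<^sub>\<infinity>(r, s)\<in>Omega. real s * c r s)"

definition X_plus :: "(nat \<Rightarrow> nat \<Rightarrow> real) set" where
  "X_plus = {c. (\<forall>(r, s)\<in>Omega. 0 \<le> c r s) \<and> finite_mass c}"

definition X_plus_mass :: "real \<Rightarrow> real \<Rightarrow> (nat \<Rightarrow> nat \<Rightarrow> real) set" where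
  "X_plus_mass \<rho> \<sigma> = {c \<in> X_plus. rho_mass c = \<rho> \<and> sigma_mass c = \<sigma>}"

text \<open>
  For \<open>x, y \<ge> 0\<close>, the number \<open>(x - y) ln (x / y)\<close> in the extended half-line: 0 if both arguments
  vanish, infinite if exactly one does.  The product is nonnegative, so \<open>ennreal\<close> does not truncate.
\<close>

definition log_gap :: "real \<Rightarrow> real \<Rightarrow> ennreal" where
  "log_gap x y =
     (if x = 0 \<and> y = 0 then 0
      else if x = 0 \<or> y = 0 then \<infinity>
      else ennreal ((x - y) * ln (x / y)))"

definition dissipation ::
  "(nat \<Rightarrow> nat \<Rightarrow> real) \<Rightarrow> (nat \<Rightarrow> nat \<Rightarrow> real) \<Rightarrow>
   (nat \<Rightarrow> nat \<Rightarrow> real) \<Rightarrow> (nat \<Rightarrow> nat \<Rightarrow> real) \<Rightarrow> (nat \<Rightarrow> nat \<Rightarrow> real) \<Rightarrow> ennreal" where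
  "dissipation a adot b bdot c =
     (\<Sum>\<^sub>\<infinity>(r, s)\<in>Omega.
        log_gap (a r s * c 1 0 * c r s) (b (r + 1) s * c (r + 1) s)
      + log_gap (adot r s * c 0 1 * c r s) (bdot r (s + 1) * c r (s + 1)))"

definition equilibrium :: "(nat \<Rightarrow> nat \<Rightarrow> real) \<Rightarrow> real \<Rightarrow> real \<Rightarrow> nat \<Rightarrow> nat \<Rightarrow> real" where
  "equilibrium Q z w r s = z ^ r * w ^ s * Q r s"

definition equilibrium_set :: "(nat \<Rightarrow> nat \<Rightarrow> real) \<Rightarrow> (real \<times> real) set" where
  "equilibrium_set Q = {(z, w). 0 \<le> z \<and> 0 \<le> w \<and> finite_mass (equilibrium Q z w)}"

definition determined_pair :: "(nat \<Rightarrow> nat \<Rightarrow> real) \<Rightarrow> real \<Rightarrow> real \<Rightarrow> real \<Rightarrow> real \<Rightarrow> bool" where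
  "determined_pair Q \<rho> \<sigma> z w \<longleftrightarrow>
     (z, w) \<in> equilibrium_set Q \<and> 0 < z \<and> 0 < w \<and>
     (\<forall>u v. 0 < u \<longrightarrow> 0 < v \<longrightarrow> (u, v) \<in> equilibrium_set Q \<longrightarrow>
        ln (z / u) * (\<rho> - rho_mass (equilibrium Q z w))
      + ln (w / v) * (\<sigma> - sigma_mass (equilibrium Q z w)) \<ge> 0)"

text \<open>Since \<open>0 * ln 0 = 0\<close> in HOL, this formula also gives the value 1 at 0.\<close>

definition entropy_fun :: "real \<Rightarrow> real" where
  "entropy_fun x = x * ln x + 1 - x"

text \<open>
  All terms are nonnegative, as \<open>entropy_fun \<ge> 0\<close> on the half-line; summing in \<open>ennreal\<close> makes a
  divergent sum infinite rather than 0.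
\<close>

definition rel_entropy :: "(nat \<Rightarrow> nat \<Rightarrow> real) \<Rightarrow> (nat \<Rightarrow> nat \<Rightarrow> real) \<Rightarrow> ennreal" where
  "rel_entropy c e = (\<Sum>\<^sub>\<infinity>(r, s)\<in>Omega. ennreal (e r s * entropy_fun (c r s / e r s)))"

end

theory Submission
  imports Defs "HOL-Library.Diagonal_Subsequence"
begin

text \<open>
  Suppose the claim fails.  Then there are states \<open>c\<^sub>k\<close> and sizes \<open>N\<^sub>k\<close> tending to infinity such that the mass
  beyond \<open>N\<^sub>k\<close> and \<open>N\<^sub>k\<^bsup>1-\<alpha>\<^esup> D(c\<^sub>k)\<close> tend to 0.  By the Cauchy--Schwarz inequality the fluxes up to
  size \<open>N\<^sub>k\<close>, weighted with the size and divided by the rates, tend to 0 in \<open>l\<^sup>1\<close>.  Along a subsequence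
  \<open>c\<^sub>k\<close> converges pointwise, and the limit is an equilibrium with some parameters \<open>(z, w)\<close>.

  The quotients \<open>Q\<^bsub>r,s\<^esub> / Q\<^bsub>r+1,s\<^esub>\<close> and \<open>Q\<^bsub>r,s\<^esub> / Q\<^bsub>r,s+1\<^esub>\<close> are uniformly close to \<open>P(\<xi>)\<close> and \<open>R(1 - \<xi>)\<close>,
  where \<open>\<xi> = r / (r + s)\<close> and \<open>P\<close>, \<open>R\<close> are continuous, strictly increasing and 0 at 0.  Testing the first
  flux with \<open>z - P(\<xi>)\<close> shows that the mass of large clusters sits where \<open>z = P(\<xi>)\<close>, and similarly
  \<open>w = R(1 - \<xi>)\<close>, hence at a single composition.  So the mass missing in the limit has this
  composition, the limit satisfies the variational inequality, and \<open>(z, w)\<close> is the determined pair.  At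
  that composition the logarithm of the equilibrium is \<open>o(r + s)\<close>, and therefore the relative entropy
  tends to 0, a contradiction.
\<close>

text \<open>The constants are not explicit: the negated claim is used with \<open>K\<close> and
  \<open>M\<close> equal to k + 1 and \<open>\<delta>\<^sub>2\<close> equal to 1/(k + 1), so that
  one sequence makes all three degenerate. The obstacle is that mass may escape to infinity along
  it. The masses of the pointwise limit can then be smaller than \<rho> and \<sigma>, so they do not
  identify its parameters, and pointwise convergence does not carry the relative entropy along,
  because -ln of the equilibrium can grow like the size. Both difficulties yield to one principle:
  sums with weight (r + s) u(\<xi>) pass to the limit when u vanishes at every composition where
  both drifts vanish. If \<xi>0 is such a composition, u = \<xi> - \<xi>0 gives a linear relation
  between the two missing masses, and a multiple of |\<xi> - \<xi>0| controls the entropy. The power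
  of N arises as follows. Weighting a flux with the size n costs n^2 / n^\<alpha> in the
  Cauchy-Schwarz inequality; one factor n is paid for by the mass, and n^(1-\<alpha>) \<le>
  N^(1-\<alpha>) remains.\<close>

section \<open>Drift profiles\<close>

text \<open>Let h = ln \<phi> in the interior. In h' the two terms with \<Phi>' cancel and (1 -
  \<xi>) \<Phi>'' \<le> -\<gamma> is left, so exp(-h) is strictly increasing. The other half of the
  concavity condition makes h diverge at 0, so the reciprocal extends by 0 there even though \<phi>
  is unbounded. With \<phi> abstract, the lemma also serves \<psi> after the reflection \<xi> -> 1 -
  \<xi>.\<close>

lemma profile_inverse:
  fixes \<Phi> \<Phi>' \<Phi>'' \<phi> :: "real \<Rightarrow> real"
  assumes cont: "continuous_on {0..1} \<Phi>"
    and d1: "\<And>\<xi>. \<xi> \<in> {0<..<1} \<Longrightarrow> (\<Phi> has_real_derivative \<Phi>' \<xi>) (at \<xi>)"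
    and d2: "\<And>\<xi>. \<xi> \<in> {0<..<1} \<Longrightarrow> (\<Phi>' has_real_derivative \<Phi>'' \<xi>) (at \<xi>)"
    and lim: "((\<lambda>\<xi>. (1 - \<xi>) * \<Phi>' \<xi>) \<longlongrightarrow> l) (at_left 1)"
    and phi: "\<And>\<xi>. \<xi> \<in> {0<..<1} \<Longrightarrow> \<phi> \<xi> = exp (\<Phi> \<xi> + (1 - \<xi>) * \<Phi>' \<xi>)"
    and phi_cont: "continuous_on {0<..1} \<phi>"
    and gamma: "0 < \<gamma>"
    and conc: "\<And>\<xi>. \<xi> \<in> {0<..<1} \<Longrightarrow> (1 - \<xi>) * \<Phi>'' \<xi> \<le> - \<gamma>"
      "\<And>\<xi>. \<xi> \<in> {0<..<1} \<Longrightarrow> \<xi> * \<Phi>'' \<xi> \<le> - \<gamma>"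
  obtains P where "continuous_on {0..1} P" "P 0 = 0" "strict_mono_on {0..1} P"
    "\<And>\<xi>. \<xi> \<in> {0<..1} \<Longrightarrow> P \<xi> = 1 / \<phi> \<xi>"
proof -
  define h where "h \<xi> = \<Phi> \<xi> + (1 - \<xi>) * \<Phi>' \<xi>" for \<xi>
  define P where "P \<xi> = (if \<xi> = 0 then 0 else 1 / \<phi> \<xi>)" for \<xi>
  have dh: "(h has_real_derivative (1 - \<xi>) * \<Phi>'' \<xi>) (at \<xi>)" if "\<xi> \<in> {0<..<1}" for \<xi>
    unfolding h_def
    by (rule derivative_eq_intros d1[OF that] d2[OF that] refl)+ (simp add: algebra_simps)
  have P_exp: "P \<xi> = exp (- h \<xi>)" if "\<xi> \<in> {0<..<1}" for \<xi>
    using that phi[OF that] unfolding P_def h_def exp_minus by (simp add: divide_inverse)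
  \<comment> \<open>The exponential formula is given only in the open interval. Continuity
    identifies the value at 1 with exp (\<Phi> 1 + l), which is positive because the limit l is
    finite.\<close>
  have phi1: "\<phi> 1 > 0"
  proof -
    have at1: "at (1::real) within {0<..<1} = at_left 1"
      by (rule at_within_nhd[of _ "{0<..}"]) auto
    have "(\<phi> \<longlongrightarrow> \<phi> 1) (at 1 within {0<..1})"
      using phi_cont by (auto simp: continuous_on_def)
    then have "(\<phi> \<longlongrightarrow> \<phi> 1) (at 1 within {0<..<1})"
      by (rule tendsto_within_subset) auto
    then have A: "(\<phi> \<longlongrightarrow> \<phi> 1) (at_left 1)"
      by (simp add: at1)
    have "(\<Phi> \<longlongrightarrow> \<Phi> 1) (at 1 within {0..1})"
      using cont by (auto simp: continuous_on_def)
    then have "(\<Phi> \<longlongrightarrow> \<Phi> 1) (at 1 within {0<..<1})"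
      by (rule tendsto_within_subset) auto
    then have "(\<Phi> \<longlongrightarrow> \<Phi> 1) (at_left 1)"
      by (simp add: at1)
    then have B: "((\<lambda>\<xi>. exp (\<Phi> \<xi> + (1 - \<xi>) * \<Phi>' \<xi>)) \<longlongrightarrow> exp (\<Phi> 1 + l)) (at_left 1)"
      by (intro tendsto_intros lim)
    have "\<forall>\<^sub>F \<xi> in at_left 1. \<xi> \<in> {0<..<1::real}"
      by (rule eventually_at_leftI[of 0]) auto
    then have "\<forall>\<^sub>F \<xi> in at_left 1. \<phi> \<xi> = exp (\<Phi> \<xi> + (1 - \<xi>) * \<Phi>' \<xi>)"
      by eventually_elim (rule phi)
    with A have "((\<lambda>\<xi>. exp (\<Phi> \<xi> + (1 - \<xi>) * \<Phi>' \<xi>)) \<longlongrightarrow> \<phi> 1) (at_left 1)"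
      by (blast intro: Lim_transform_eventually)
    with B have "\<phi> 1 = exp (\<Phi> 1 + l)"
      by (meson tendsto_unique trivial_limit_at_left_real)
    then show ?thesis by simp
  qed
  have phi_pos: "\<phi> \<xi> > 0" if "\<xi> \<in> {0<..1}" for \<xi>
    using that phi1 phi[of \<xi>] by (cases "\<xi> = 1") auto
  have cont_pos: "continuous_on {0<..1} P"
  proof -
    have "continuous_on {0<..1} (\<lambda>\<xi>. 1 / \<phi> \<xi>)"
      by (intro continuous_intros phi_cont) (use phi_pos in force)
    then show ?thesis
      by (rule continuous_on_eq) (auto simp: P_def)
  qed
  have cont0: "(P \<longlongrightarrow> P 0) (at 0 within {0..1})"
  proof -
    \<comment> \<open>As \<open>\<xi> \<Phi>'' \<le> - \<gamma>\<close>, the function \<open>h\<close> grows at least like \<open>- (\<gamma> / 2) ln \<xi>\<close> at 0.\<close>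
    define m where "m = h (1/2) + \<gamma> / 2 * ln (1/2)"
    have low: "m \<le> h \<xi> + \<gamma> / 2 * ln \<xi>" if "0 < \<xi>" "\<xi> \<le> 1/2" for \<xi>
      unfolding m_def
    proof (rule DERIV_nonpos_imp_nonincreasing[where f = "\<lambda>\<xi>. h \<xi> + \<gamma> / 2 * ln \<xi>", OF that(2)])
      fix x :: real assume x: "\<xi> \<le> x" "x \<le> 1/2"
      with that have x01: "x \<in> {0<..<1}" by auto
      have "((\<lambda>\<xi>. h \<xi> + \<gamma> / 2 * ln \<xi>) has_real_derivative
          (1 - x) * \<Phi>'' x + \<gamma> / 2 * (1 / x)) (at x)"
        by (rule derivative_eq_intros dh[OF x01] refl)+ (use x01 in auto)
      moreover have "(1 - x) * \<Phi>'' x + \<gamma> / 2 * (1 / x) \<le> 0"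
      proof -
        have "\<Phi>'' x \<le> - \<gamma> / x"
          using conc(2)[OF x01] x01 by (simp add: field_simps)
        then have "(1 - x) * \<Phi>'' x \<le> (1 - x) * (- \<gamma> / x)"
          by (rule mult_left_mono) (use x01 in auto)
        also have "\<dots> \<le> (1/2) * (- \<gamma> / x)"
          by (rule mult_right_mono_neg) (use x x01 gamma in auto)
        finally show ?thesis by simp
      qed
      ultimately show "\<exists>y. ((\<lambda>\<xi>. h \<xi> + \<gamma> / 2 * ln \<xi>) has_real_derivative y) (at x) \<and> y \<le> 0"
        by blast
    qed
    have "((\<lambda>\<xi>::real. \<xi> powr (\<gamma> / 2)) \<longlongrightarrow> 0) (at_right 0)"
      by (rule tendsto_zero_powrI[OF _ tendsto_const])
        (use gamma in \<open>auto intro: tendsto_ident_at eventually_at_right_less eventually_mono\<close>)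
    then have "((\<lambda>\<xi>::real. exp (- m) * \<xi> powr (\<gamma> / 2)) \<longlongrightarrow> 0) (at_right 0)"
      by (rule tendsto_mult_right_zero)
    moreover have "\<forall>\<^sub>F \<xi> in at_right 0. norm (P \<xi>) \<le> exp (- m) * \<xi> powr (\<gamma> / 2)"
    proof (rule eventually_at_rightI[of 0 "1/2"])
      fix x :: real assume x: "x \<in> {0<..<1/2}"
      have "- h x \<le> - m + \<gamma> / 2 * ln x"
        using low[of x] x by auto
      then have "exp (- h x) \<le> exp (- m) * x powr (\<gamma> / 2)"
        using x by (simp add: powr_def flip: exp_add)
      then show "norm (P x) \<le> exp (- m) * x powr (\<gamma> / 2)"
        using x by (simp add: P_exp)
    qed simp
    ultimately have "(P \<longlongrightarrow> 0) (at_right 0)"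
      by (rule Lim_null_comparison[rotated])
    moreover have "at (0::real) within {0..1} = at_right 0"
      by (rule at_within_Icc_at_right) simp
    ultimately show ?thesis
      by (simp add: P_def)
  qed
  have contP: "continuous_on {0..1} P"
    unfolding continuous_on_def
  proof
    fix x :: real assume x: "x \<in> {0..1}"
    show "(P \<longlongrightarrow> P x) (at x within {0..1})"
    proof (cases "x = 0")
      case True then show ?thesis using cont0 by simp
    next
      case False
      have "at x within {0..1} = at x within {0<..1}"
        by (rule at_within_nhd[of _ "{0<..}"]) (use x False in auto)
      then show ?thesis
        using cont_pos x False by (auto simp: continuous_on_def)
    qed
  qed
  have "strict_mono_on {0..1} P"
  proof (rule strict_mono_onI)
    fix a b :: real assume ab: "a \<in> {0..1}" "b \<in> {0..1}" "a < b"
    show "P a < P b"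
    proof (rule DERIV_pos_imp_increasing_open[OF ab(3)])
      show "continuous_on {a..b} P"
        by (rule continuous_on_subset[OF contP]) (use ab in auto)
      fix x assume "a < x" "x < b"
      with ab have x01: "x \<in> {0<..<1}" by auto
      have "((\<lambda>\<xi>. exp (- h \<xi>)) has_real_derivative exp (- h x) * - ((1 - x) * \<Phi>'' x)) (at x)"
        by (rule derivative_eq_intros dh[OF x01] refl)+
      then have "(P has_real_derivative exp (- h x) * - ((1 - x) * \<Phi>'' x)) (at x)"
        by (rule has_field_derivative_transform_within_open[of _ _ _ "{0<..<1}"])
          (use x01 P_exp in auto)
      moreover have "exp (- h x) * - ((1 - x) * \<Phi>'' x) > 0"
        using conc(1)[OF x01] gamma by (intro mult_pos_pos) auto
      ultimately show "\<exists>y. (P has_real_derivative y) (at x) \<and> y > 0" by blast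
    qed
  qed
  with contP show thesis
    by (intro that[of P]) (auto simp: P_def)
qed

lemma continuous_bounded:
  assumes "continuous_on {0..1} (u :: real \<Rightarrow> real)"
  obtains U where "0 \<le> U" "\<And>\<xi>. \<xi> \<in> {0..1} \<Longrightarrow> \<bar>u \<xi>\<bar> \<le> U"
proof -
  have "bounded (u ` {0..1})"
    by (intro compact_imp_bounded compact_continuous_image assms) simp
  then obtain U where "\<And>x. x \<in> u ` {0..1} \<Longrightarrow> norm x \<le> U" unfolding bounded_iff by blast
  then have U: "\<bar>u \<xi>\<bar> \<le> U" if "\<xi> \<in> {0..1}" for \<xi> using that by auto
  moreover have "0 \<le> U" using U[of 0] by simp
  ultimately show thesis using that by blast
qed

text \<open>For large clusters of composition \<xi>, growth by one unit of the first component is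
  balanced at monomer density \<open>P \<xi>\<close>, so z - P(\<xi>) acts as a drift. The error is
  uniform over all clusters of a given size, up to the axes. For a family with exchanged indices the
  argument is the fraction of the second component, 1 - \<xi>. The bound \<open>n0\<ge>1\<close>
  keeps (0, 0) out.\<close>

definition drift_profile :: "(nat \<Rightarrow> nat \<Rightarrow> real) \<Rightarrow> (real \<Rightarrow> real) \<Rightarrow> bool" where
  "drift_profile p P \<longleftrightarrow>
     continuous_on {0..1} P \<and> P 0 = 0 \<and> strict_mono_on {0..1} P \<and>
     (\<forall>\<epsilon>>0. \<exists>n0\<ge>1. \<forall>r s. n0 \<le> r + s \<longrightarrow> \<bar>p r s - P (real r / real (r + s))\<bar> < \<epsilon>)"

lemma drift_profileD:
  assumes "drift_profile p P"
  shows "continuous_on {0..1} P" "P 0 = 0" "strict_mono_on {0..1} P"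
    "\<And>\<epsilon>. 0 < \<epsilon> \<Longrightarrow> \<exists>n0\<ge>1. \<forall>r s. n0 \<le> r + s \<longrightarrow> \<bar>p r s - P (real r / real (r + s))\<bar> < \<epsilon>"
  using assms by (auto simp: drift_profile_def)

lemma drift_profile_bounds:
  assumes "drift_profile p P" "\<xi> \<in> {0..1}"
  shows "0 \<le> P \<xi>" "P \<xi> \<le> P 1"
proof -
  have "mono_on {0..1} P"
    using drift_profileD(3)[OF assms(1)] by (rule strict_mono_on_imp_mono_on)
  with assms(2) have "P 0 \<le> P \<xi>" "P \<xi> \<le> P 1"
    by (auto simp: mono_on_def)
  then show "0 \<le> P \<xi>" "P \<xi> \<le> P 1"
    using drift_profileD(2)[OF assms(1)] by auto
qed

lemma composition_bounds: "real r / real (r + s) \<in> {0..1}"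
  by (cases "r + s = 0") (auto simp: field_simps)

lemma composition_shift:
  assumes "r + s \<ge> 1"
  shows "\<bar>real (r + 1) / real (r + s + 1) - real r / real (r + s)\<bar> \<le> 1 / real (r + s)"
proof -
  define a b where "a = real r" and "b = real s"
  have ab: "a \<ge> 0" "b \<ge> 0" "a + b \<ge> 1" using assms by (auto simp: a_def b_def)
  have "(a + 1) / (a + b + 1) - a / (a + b) = b / ((a + b) * (a + b + 1))"
    using ab by (simp add: field_simps)
  also have "\<dots> = (b / (a + b + 1)) / (a + b)" by (simp add: mult.commute)
  also have "\<bar>\<dots>\<bar> \<le> 1 / (a + b)"
  proof -
    have "b / (a + b + 1) \<le> 1" "0 \<le> b / (a + b + 1)" using ab by auto
    then have "(b / (a + b + 1)) / (a + b) \<le> 1 / (a + b)" "0 \<le> (b / (a + b + 1)) / (a + b)"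
      using ab divide_right_mono[of "b / (a + b + 1)" 1 "a + b"] by auto
    then show ?thesis by (simp only: abs_of_nonneg)
  qed
  finally show ?thesis by (simp add: a_def b_def add_ac)
qed

lemma uniform_shift:
  fixes G :: "real \<Rightarrow> real"
  assumes "continuous_on {0..1} G" "0 < \<epsilon>"
  obtains n0 where "1 \<le> n0"
    "\<And>r s. n0 \<le> r + s \<Longrightarrow>
       \<bar>G (real (r + 1) / real (r + s + 1)) - G (real r / real (r + s))\<bar> < \<epsilon>"
proof -
  have "uniformly_continuous_on {0..1} G"
    by (intro compact_uniformly_continuous assms) simp
  then obtain d where d: "d > 0"
    "\<And>x y. x \<in> {0..1} \<Longrightarrow> y \<in> {0..1} \<Longrightarrow> \<bar>y - x\<bar> < d \<Longrightarrow> \<bar>G y - G x\<bar> < \<epsilon>"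
    using assms(2) unfolding uniformly_continuous_on_def dist_real_def by metis
  obtain n :: nat where n: "1 / d < real n" using reals_Archimedean2 by blast
  show thesis
  proof (rule that[of "max 1 n"])
    fix r s assume rs: "max 1 n \<le> r + s"
    have "1 / real (r + s) < d"
    proof -
      have "1 / d < real (r + s)" using n rs by linarith
      then show ?thesis using d(1) rs by (simp add: field_simps)
    qed
    then have "\<bar>real (r + 1) / real (r + s + 1) - real r / real (r + s)\<bar> < d"
      using composition_shift[of r s] rs by linarith
    moreover have "real (r + 1) / real (r + s + 1) \<in> {0..1}"
      using composition_bounds[of "r + 1" s] by simp
    ultimately show "\<bar>G (real (r + 1) / real (r + s + 1)) - G (real r / real (r + s))\<bar> < \<epsilon>"
      using composition_bounds by (intro d(2))
  qed simp
qed

text \<open>The ratio is given in terms of the composition after the step, the profile in terms of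
  the one before it. Uniform continuity of \<open>P\<close> bridges the two, and the correction
  factor \<open>f\<close> enters only through |1/f - 1| times the bounded \<open>P\<close>.\<close>

lemma drift_profile_ratio:
  assumes P: "continuous_on {0..1} P" "P 0 = 0" "strict_mono_on {0..1} P"
    and P_inv: "\<And>\<xi>. \<xi> \<in> {0<..1} \<Longrightarrow> P \<xi> = 1 / \<phi> \<xi>"
    and ratio: "\<And>r s. 1 \<le> r + s \<Longrightarrow>
      Q (r + 1) s / Q r s = \<phi> (real (r + 1) / real (r + s + 1)) * f r s"
    and f: "\<And>\<epsilon>. 0 < \<epsilon> \<Longrightarrow> \<exists>n0. \<forall>r s. 1 \<le> r + s \<longrightarrow> n0 \<le> r + s \<longrightarrow> \<bar>1 - f r s\<bar> < (\<epsilon>::real)"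
  shows "drift_profile (\<lambda>r s. Q r s / Q (r + 1) s) P"
  unfolding drift_profile_def
proof (intro conjI P allI impI)
  fix \<epsilon> :: real assume e: "0 < \<epsilon>"
  define B where "B = P 1 + 1"
  have mono: "mono_on {0..1} P"
    using P(3) by (rule strict_mono_on_imp_mono_on)
  have PB: "0 \<le> P \<xi>" "P \<xi> \<le> B" if "\<xi> \<in> {0..1}" for \<xi>
    using that monotone_onD[OF mono, of 0 \<xi>] monotone_onD[OF mono, of \<xi> 1] P(2)
    by (auto simp: B_def)
  have B: "B > 0" using PB[of 1] by (simp add: B_def)
  obtain n1 where n1: "1 \<le> n1" "\<And>r s. n1 \<le> r + s \<Longrightarrow>
       \<bar>P (real (r + 1) / real (r + s + 1)) - P (real r / real (r + s))\<bar> < \<epsilon> / 2"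
    using uniform_shift[OF P(1), of "\<epsilon> / 2"] e by auto
  \<comment> \<open>The bound 1/2 gives f \<ge> 1/2, hence |1/f - 1| \<le> 2d; the other bound makes
    2dB at most half of \<epsilon>. The remaining half is for the shift of composition.\<close>
  define d where "d = min (1/2) (\<epsilon> / (4 * B))"
  have d: "d > 0" "d \<le> 1/2" "2 * d * B \<le> \<epsilon> / 2"
  proof -
    show "d > 0" "d \<le> 1/2" using e B by (auto simp: d_def)
    have "d \<le> \<epsilon> / (4 * B)" by (simp add: d_def)
    then show "2 * d * B \<le> \<epsilon> / 2" using B by (simp add: field_simps)
  qed
  obtain n2 where n2: "\<And>r s. 1 \<le> r + s \<Longrightarrow> n2 \<le> r + s \<Longrightarrow> \<bar>1 - f r s\<bar> < d"
    using f[OF d(1)] by blast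
  show "\<exists>n0\<ge>1. \<forall>r s. n0 \<le> r + s \<longrightarrow>
      \<bar>Q r s / Q (r + 1) s - P (real r / real (r + s))\<bar> < \<epsilon>"
  proof (intro exI[of _ "max n1 n2"] conjI allI impI)
    show "1 \<le> max n1 n2" using n1(1) by simp
    fix r s assume rs: "max n1 n2 \<le> r + s"
    have rs1: "1 \<le> r + s" using rs n1(1) by simp
    define \<xi> where "\<xi> = real (r + 1) / real (r + s + 1)"
    have xi: "\<xi> \<in> {0<..1}" by (simp add: \<xi>_def field_simps)
    have fd: "\<bar>1 - f r s\<bar> < d" using n2 rs rs1 by simp
    then have f2: "f r s \<ge> 1/2" using d(2) by linarith
    have "Q r s / Q (r + 1) s = 1 / (\<phi> \<xi> * f r s)"
      using ratio[OF rs1] unfolding \<xi>_def by (metis inverse_divide inverse_eq_divide)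
    also have "\<dots> = P \<xi> * (1 / f r s)" by (simp add: P_inv[OF xi])
    finally have "\<bar>Q r s / Q (r + 1) s - P \<xi>\<bar> = P \<xi> * \<bar>1 / f r s - 1\<bar>"
      using PB(1)[of \<xi>] xi abs_mult[of "P \<xi>" "1 / f r s - 1"] by (simp add: right_diff_distrib)
    also have "\<bar>1 / f r s - 1\<bar> = \<bar>1 - f r s\<bar> / f r s"
    proof -
      have "1 / f r s - 1 = (1 - f r s) / f r s" using f2 by (simp add: diff_divide_distrib)
      then show ?thesis using f2 by (simp add: abs_divide)
    qed
    also have "\<dots> \<le> \<bar>1 - f r s\<bar> / (1/2)"
      by (rule divide_left_mono) (use f2 in auto)
    also have "\<dots> \<le> 2 * d" using fd by simp
    finally have "\<bar>Q r s / Q (r + 1) s - P \<xi>\<bar> \<le> P \<xi> * (2 * d)"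
      using PB(1)[of \<xi>] xi by (simp add: mult_left_mono)
    also have "\<dots> \<le> B * (2 * d)"
      using PB(2)[of \<xi>] xi d(1) by (intro mult_right_mono) auto
    also have "\<dots> \<le> \<epsilon> / 2" using d(3) by (simp add: mult_ac)
    finally show "\<bar>Q r s / Q (r + 1) s - P (real r / real (r + s))\<bar> < \<epsilon>"
      using n1(2)[of r s] rs unfolding \<xi>_def by linarith
  qed
qed

text \<open>Large sizes are bounded by \<open>P 1 + 1\<close>, and the others form a finite set,
  which may as well include (0, 0). The choice \<open>C\<ge>1\<close> makes ln C nonnegative in
  later logarithmic bounds.\<close>

lemma drift_profile_imp_bounded:
  assumes "drift_profile p P"
  shows "\<exists>C\<ge>1. \<forall>r s. p r s \<le> C"
proof -
  obtain n0 where n0: "\<And>r s. n0 \<le> r + s \<Longrightarrow> \<bar>p r s - P (real r / real (r + s))\<bar> < 1"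
    using drift_profileD(4)[OF assms, of 1] by auto
  define S where "S = (\<lambda>(r, s). p r s) ` ({..n0} \<times> {..n0})"
  have fin: "finite S" by (simp add: S_def)
  define C where "C = max 1 (max (P 1 + 1) (Max S))"
  show ?thesis
  proof (intro exI[of _ C] conjI allI)
    fix r s
    show "p r s \<le> C"
    proof (cases "n0 \<le> r + s")
      case True
      show ?thesis
        using n0[OF True] drift_profile_bounds(2)[OF assms composition_bounds[of r s]]
        by (simp add: C_def)
    next
      case False
      then have "p r s \<in> S" by (force simp: S_def)
      then show ?thesis using Max_ge[OF fin] by (auto simp: C_def le_max_iff_disj)
    qed
  qed (simp add: C_def)
qed

section \<open>Dissipation controls weighted fluxes\<close>

text \<open>For x \<ge> y the inequality ln(x/y) \<ge> 1 - y/x makes the gap at least (x - y)^2 / (x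
  + y). The product form is the one that the Cauchy-Schwarz inequality needs: |x - y| is at most the
  product of two square roots. Finiteness matters because \<open>enn2real\<close> maps infinity to
  0.\<close>

lemma log_gap_bound:
  assumes "0 \<le> x" "0 \<le> y" "log_gap x y < \<infinity>"
  shows "(x - y)\<^sup>2 \<le> (x + y) * enn2real (log_gap x y)"
proof (cases "x = 0 \<or> y = 0")
  case True
  with assms show ?thesis by (auto simp: log_gap_def split: if_splits)
next
  case False
  with assms have pos: "0 < x" "0 < y" by auto
  have *: "(x - y)\<^sup>2 \<le> (x + y) * ((x - y) * ln (x / y))" if "y \<le> x" "0 < y" for x y :: real
  proof -
    have "ln (y / x) \<le> y / x - 1" using that by (intro ln_le_minus_one) auto
    then have "1 - y / x \<le> ln (x / y)" using that by (simp add: ln_div)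
    then have "(x + y) * (1 - y / x) \<le> (x + y) * ln (x / y)"
      using that by (intro mult_left_mono) auto
    moreover have "x - y \<le> (x + y) * (1 - y / x)"
      using that by (simp add: field_simps mult_mono)
    ultimately have "x - y \<le> (x + y) * ln (x / y)" by (rule order_trans[rotated])
    then have "(x - y) * (x - y) \<le> (x - y) * ((x + y) * ln (x / y))"
      using that by (intro mult_left_mono) auto
    then show ?thesis by (simp add: power2_eq_square mult_ac)
  qed
  have key: "(x - y)\<^sup>2 \<le> (x + y) * ((x - y) * ln (x / y))"
  proof (cases "y \<le> x")
    case True then show ?thesis using *[of y x] pos by simp
  next
    case False
    have "(x - y) * ln (x / y) = (y - x) * ln (y / x)"
      using pos by (simp add: ln_div algebra_simps)
    then show ?thesis using *[of x y] False pos by (simp add: power2_commute add.commute)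
  qed
  moreover have "0 \<le> (x - y) * ln (x / y)"
  proof -
    have "0 \<le> (x + y) * ((x - y) * ln (x / y))" using key by (meson order_trans zero_le_power2)
    then show ?thesis using pos by (simp add: zero_le_mult_iff)
  qed
  ultimately show ?thesis using False by (simp add: log_gap_def)
qed

definition band :: "nat \<Rightarrow> nat \<Rightarrow> (nat \<times> nat) set" where
  "band L N = {(r, s). L \<le> r + s \<and> r + s \<le> N}"

lemma mem_band [simp]: "(r, s) \<in> band L N \<longleftrightarrow> L \<le> r + s \<and> r + s \<le> N"
  by (simp add: band_def)

lemma finite_band [simp, intro]: "finite (band L N)"
  by (rule finite_subset[of _ "{..N} \<times> {..N}"]) (auto simp: band_def)

lemma band_subset_Omega: "1 \<le> L \<Longrightarrow> band L N \<subseteq> Omega"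
  by (auto simp: band_def Omega_def)

lemma band_swap:
  "(\<Sum>(r, s)\<in>band L N. G s r) = (\<Sum>(r, s)\<in>band L N. G r s)"
  by (rule sum.reindex_bij_witness[of _ prod.swap prod.swap]) (auto simp: band_def)

text \<open>The unit step never reaches clusters with r = 0; the hypothesis makes their contribution
  vanish.\<close>

lemma band_shift:
  assumes "\<And>s. G 0 s = (0::real)"
  shows "(\<Sum>(r, s)\<in>band L N. G (r + 1) s) = (\<Sum>(r, s)\<in>band (L + 1) (N + 1). G r s)"
proof -
  have "(\<Sum>(r, s)\<in>band L N. G (r + 1) s)
      = (\<Sum>(r, s)\<in>{(r, s)\<in>band (L + 1) (N + 1). 1 \<le> r}. G r s)"
    by (rule sum.reindex_bij_witness[of _ "\<lambda>(r, s). (r - 1, s)" "\<lambda>(r, s). (r + 1, s)"])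
      (auto simp: band_def)
  also have "\<dots> = (\<Sum>(r, s)\<in>band (L + 1) (N + 1). G r s)"
  proof (rule sum.mono_neutral_left)
    show "\<forall>i\<in>band (L + 1) (N + 1) - {(r, s) \<in> band (L + 1) (N + 1). 1 \<le> r}.
        (case i of (r, s) \<Rightarrow> G r s) = 0"
    proof
      fix i assume "i \<in> band (L + 1) (N + 1) - {(r, s) \<in> band (L + 1) (N + 1). 1 \<le> r}"
      then obtain s where "i = (0, s)" by (cases i) (auto simp: not_le)
      then show "(case i of (r, s) \<Rightarrow> G r s) = 0" using assms by simp
    qed
  qed auto
  finally show ?thesis .
qed

text \<open>With \<open>band_shift\<close> this is summation by parts: shifting a band by one size
  leaves only the shells at its two ends.\<close>

lemma band_step:
  assumes "L \<le> N"
  shows "(\<Sum>(r, s)\<in>band (L + 1) (N + 1). G r s) =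
    (\<Sum>(r, s)\<in>band L N. G r s) - (\<Sum>(r, s)\<in>band L L. G r s)
      + (\<Sum>(r, s)\<in>band (N + 1) (N + 1). G r s :: real)"
proof -
  have "band L (N + 1) = band L L \<union> band (L + 1) (N + 1)" using assms by (auto simp: band_def)
  moreover have "band L L \<inter> band (L + 1) (N + 1) = {}" by (auto simp: band_def)
  ultimately have 1: "(\<Sum>(r, s)\<in>band L (N + 1). G r s)
      = (\<Sum>(r, s)\<in>band L L. G r s) + (\<Sum>(r, s)\<in>band (L + 1) (N + 1). G r s)"
    by (simp add: sum.union_disjoint)
  have "band L (N + 1) = band L N \<union> band (N + 1) (N + 1)" using assms by (auto simp: band_def)
  moreover have "band L N \<inter> band (N + 1) (N + 1) = {}" by (auto simp: band_def)
  ultimately have 2: "(\<Sum>(r, s)\<in>band L (N + 1). G r s)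
      = (\<Sum>(r, s)\<in>band L N. G r s) + (\<Sum>(r, s)\<in>band (N + 1) (N + 1). G r s)"
    by (simp add: sum.union_disjoint)
  from 1 2 show ?thesis by simp
qed

text \<open>Write x = z c(r,s), y = p c(r+1,s), n = r + s, and g for the gap. Since the rate is at
  least \<open>c\<^sub>a\<close> n^\<alpha>, the square of n |x - y| is at most n^(2-\<alpha>) (x +
  y) g / \<open>c\<^sub>a\<close>. Splitting n^(2-\<alpha>) into n^(1-\<alpha>) \<le> N^(1-\<alpha>)
  and n leaves a weight whose sum is controlled by the mass. The factor 2m appears because the
  families c(r,s) and c(r+1,s) each contribute at most m.\<close>

lemma flux_bound:
  fixes a p c :: "nat \<Rightarrow> nat \<Rightarrow> real"
  assumes \<alpha>: "0 \<le> \<alpha>" "\<alpha> \<le> 1" and ca: "0 < c\<^sub>a"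
    and a: "\<And>r s. 1 \<le> r + s \<Longrightarrow> c\<^sub>a * real (r + s) powr \<alpha> \<le> a r s"
    and p: "\<And>r s. 1 \<le> r + s \<Longrightarrow> 0 \<le> p r s \<and> p r s \<le> Z"
    and z: "0 \<le> z" "z \<le> Z"
    and c: "\<And>r s. 1 \<le> r + s \<Longrightarrow> 0 \<le> c r s"
    and mass: "\<And>F. finite F \<Longrightarrow> F \<subseteq> Omega \<Longrightarrow> (\<Sum>(r, s)\<in>F. real (r + s) * c r s) \<le> m"
    and gap: "(\<Sum>(r, s)\<in>band 1 N. log_gap (a r s * z * c r s) (a r s * p r s * c (r + 1) s)) \<le> ennreal d"
    and d: "0 \<le> d"
  shows "(\<Sum>(r, s)\<in>band 1 N. real (r + s) * \<bar>z * c r s - p r s * c (r + 1) s\<bar>)\<^sup>2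
    \<le> (2 * m * Z / c\<^sub>a) * (real N powr (1 - \<alpha>) * d)"
proof -
  define gp where "gp = (\<lambda>(r, s). log_gap (a r s * z * c r s) (a r s * p r s * c (r + 1) s))"
  define g where "g i = enn2real (gp i)" for i
  define W where "W = (\<lambda>(r, s). real N powr (1 - \<alpha>) * (Z / c\<^sub>a) * (real (r + s) * (c r s + c (r + 1) s)))"
  define t where "t = (\<lambda>(r, s). real (r + s) * \<bar>z * c r s - p r s * c (r + 1) s\<bar>)"
  have fin: "gp i < \<infinity>" if "i \<in> band 1 N" for i
  proof -
    have "gp i \<le> sum gp (band 1 N)" using that by (intro member_le_sum) auto
    also have "\<dots> \<le> ennreal d" using gap by (simp add: gp_def case_prod_unfold)
    finally show ?thesis by (simp add: order_le_less_trans)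
  qed
  have g0: "0 \<le> g i" for i by (simp add: g_def)
  have sum_g: "sum g (band 1 N) \<le> d"
  proof -
    have "ennreal (sum g (band 1 N)) = (\<Sum>i\<in>band 1 N. ennreal (g i))"
      using g0 by (simp add: sum_ennreal)
    also have "\<dots> = sum gp (band 1 N)"
      by (rule sum.cong) (use fin in \<open>auto simp: g_def\<close>)
    also have "\<dots> \<le> ennreal d" using gap by (simp add: gp_def case_prod_unfold)
    finally show ?thesis using d by simp
  qed
  have Z: "0 \<le> Z" using z by simp
  have W0: "0 \<le> W i" if "i \<in> band 1 N" for i
    using that c Z ca by (auto simp: W_def band_def intro!: mult_nonneg_nonneg add_nonneg_nonneg)
  have tW: "(t i)\<^sup>2 \<le> W i * g i" if i: "i \<in> band 1 N" for i
  proof -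
    obtain r s where rs: "i = (r, s)" "1 \<le> r + s" "r + s \<le> N" using i by (auto simp: band_def)
    define n where "n = real (r + s)"
    have n: "1 \<le> n" "n \<le> real N" using rs unfolding n_def by linarith+
    define x y where "x = z * c r s" and "y = p r s * c (r + 1) s"
    have c0: "0 \<le> c r s" "0 \<le> c (r + 1) s" using c rs by auto
    have xy: "0 \<le> x" "0 \<le> y" using c0 z p[OF rs(2)] by (auto simp: x_def y_def)
    have npos: "0 < n powr \<alpha>" using n by simp
    have "0 < c\<^sub>a * n powr \<alpha>" using ca npos by simp
    then have apos: "0 < a r s" "c\<^sub>a * n powr \<alpha> \<le> a r s"
      using a[OF rs(2)] unfolding n_def by linarith+
    have gi: "gp i = log_gap (a r s * x) (a r s * y)"
      by (simp add: gp_def rs x_def y_def mult.assoc)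
    have "(a r s * x - a r s * y)\<^sup>2 \<le> (a r s * x + a r s * y) * g i"
      unfolding g_def gi by (rule log_gap_bound) (use fin[OF i] gi apos xy in auto)
    then have "a r s * (a r s * (x - y)\<^sup>2) \<le> a r s * ((x + y) * g i)"
      by (simp add: power2_eq_square algebra_simps)
    then have 1: "a r s * (x - y)\<^sup>2 \<le> (x + y) * g i" using apos by simp
    have "(c\<^sub>a * n powr \<alpha>) * (x - y)\<^sup>2 \<le> a r s * (x - y)\<^sup>2"
      using apos by (intro mult_right_mono) auto
    with 1 have "(c\<^sub>a * n powr \<alpha>) * (x - y)\<^sup>2 \<le> (x + y) * g i" by linarith
    then have 2: "(x - y)\<^sup>2 \<le> (x + y) * g i / (c\<^sub>a * n powr \<alpha>)"
      using ca npos by (simp add: pos_le_divide_eq mult.commute)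
    have "x + y \<le> Z * (c r s + c (r + 1) s)"
      using z p[OF rs(2)] c0 by (simp add: x_def y_def distrib_left mult_right_mono add_mono)
    then have "(x + y) * g i / (c\<^sub>a * n powr \<alpha>) \<le> Z * (c r s + c (r + 1) s) * g i / (c\<^sub>a * n powr \<alpha>)"
      using g0 ca npos by (intro divide_right_mono mult_right_mono) auto
    with 2 have "n\<^sup>2 * (x - y)\<^sup>2 \<le> n\<^sup>2 * (Z * (c r s + c (r + 1) s) * g i / (c\<^sub>a * n powr \<alpha>))"
      by (intro mult_left_mono) auto
    also have "\<dots> = n powr (1 - \<alpha>) * (n * (Z * (c r s + c (r + 1) s) * g i / c\<^sub>a))"
      using n by (simp add: powr_diff power2_eq_square field_simps)
    also have "\<dots> \<le> real N powr (1 - \<alpha>) * (n * (Z * (c r s + c (r + 1) s) * g i / c\<^sub>a))"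
      using n \<alpha> Z c0 g0 ca by (intro mult_right_mono powr_mono2) auto
    also have "\<dots> = W i * g i" by (simp add: W_def rs n_def)
    finally show ?thesis by (simp add: t_def rs n_def x_def y_def power_mult_distrib)
  qed
  have t0: "0 \<le> t i" for i by (auto simp: t_def case_prod_unfold)
  have "sum t (band 1 N) \<le> (\<Sum>i\<in>band 1 N. sqrt (W i) * sqrt (g i))"
  proof (rule sum_mono)
    fix i assume i: "i \<in> band 1 N"
    show "t i \<le> sqrt (W i) * sqrt (g i)"
      using tW[OF i] t0[of i] by (simp add: real_le_rsqrt flip: real_sqrt_mult)
  qed
  then have "(sum t (band 1 N))\<^sup>2 \<le> (\<Sum>i\<in>band 1 N. sqrt (W i) * sqrt (g i))\<^sup>2"
    using t0 by (intro power_mono sum_nonneg) auto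
  also have "\<dots> \<le> (\<Sum>i\<in>band 1 N. (sqrt (W i))\<^sup>2) * (\<Sum>i\<in>band 1 N. (sqrt (g i))\<^sup>2)"
    by (rule Cauchy_Schwarz_ineq_sum)
  also have "\<dots> = sum W (band 1 N) * sum g (band 1 N)"
    using W0 g0 by simp
  also have "\<dots> \<le> (real N powr (1 - \<alpha>) * (Z / c\<^sub>a) * (2 * m)) * d"
  proof (rule mult_mono)
    have "sum W (band 1 N) = real N powr (1 - \<alpha>) * (Z / c\<^sub>a) *
        (\<Sum>(r, s)\<in>band 1 N. real (r + s) * (c r s + c (r + 1) s))"
      by (simp add: W_def case_prod_unfold sum_distrib_left)
    also have "\<dots> \<le> real N powr (1 - \<alpha>) * (Z / c\<^sub>a) * (2 * m)"
    proof (rule mult_left_mono)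
      have "(\<Sum>(r, s)\<in>band 1 N. real (r + s) * c (r + 1) s)
          \<le> (\<Sum>(r, s)\<in>band 1 N. real (r + 1 + s) * c (r + 1) s)"
        by (rule sum_mono) (use c in \<open>auto intro!: mult_right_mono\<close>)
      also have "\<dots> = (\<Sum>(r, s)\<in>(\<lambda>(r, s). (r + 1, s)) ` band 1 N. real (r + s) * c r s)"
        by (subst sum.reindex) (auto simp: inj_on_def case_prod_unfold add_ac)
      also have "\<dots> \<le> m" by (rule mass) (auto simp: Omega_def)
      finally have "(\<Sum>(r, s)\<in>band 1 N. real (r + s) * c (r + 1) s) \<le> m" .
      moreover have "(\<Sum>(r, s)\<in>band 1 N. real (r + s) * c r s) \<le> m"
        by (rule mass) (auto simp: Omega_def)
      ultimately show "(\<Sum>(r, s)\<in>band 1 N. real (r + s) * (c r s + c (r + 1) s)) \<le> 2 * m"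
        by (simp add: distrib_left sum.distrib case_prod_unfold)
    qed (use Z ca in simp)
    finally show "sum W (band 1 N) \<le> real N powr (1 - \<alpha>) * (Z / c\<^sub>a) * (2 * m)" .
    have "0 \<le> m" using mass[of "{}"] by simp
    then show "0 \<le> real N powr (1 - \<alpha>) * (Z / c\<^sub>a) * (2 * m)" using Z ca by simp
  qed (use sum_g g0 in \<open>auto intro: sum_nonneg\<close>)
  finally show ?thesis by (simp add: t_def case_prod_unfold mult_ac)
qed

section \<open>Compactness, mass bounds and tails of sums over \<open>Omega\<close>\<close>

lemma pointwise_convergent_subsequence:
  fixes c :: "nat \<Rightarrow> nat \<Rightarrow> nat \<Rightarrow> real"
  assumes "\<And>k r s. (r, s) \<in> Omega \<Longrightarrow> \<bar>c k r s\<bar> \<le> m"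
  obtains e \<tau> where "strict_mono (\<tau> :: nat \<Rightarrow> nat)"
    "\<And>r s. (r, s) \<in> Omega \<Longrightarrow> (\<lambda>k. c (\<tau> k) r s) \<longlonglongrightarrow> e r s"
proof -
  interpret subseqs "\<lambda>n \<tau>. prod_decode n \<in> Omega \<longrightarrow>
      convergent (\<lambda>k. c (\<tau> k) (fst (prod_decode n)) (snd (prod_decode n)))"
  proof
    fix n and \<tau> :: "nat \<Rightarrow> nat" assume \<tau>: "strict_mono \<tau>"
    obtain r s where rs: "prod_decode n = (r, s)" by fastforce
    show "\<exists>\<tau>'. strict_mono (\<tau>' :: nat \<Rightarrow> nat) \<and> (prod_decode n \<in> Omega \<longrightarrow>
        convergent (\<lambda>k. c ((\<tau> \<circ> \<tau>') k) (fst (prod_decode n)) (snd (prod_decode n))))"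
    proof (cases "(r, s) \<in> Omega")
      case True
      have "\<forall>k. c (\<tau> k) r s \<in> cbox (-m) m"
        using assms[OF True] by (auto simp: abs_le_iff minus_le_iff)
      moreover have "seq_compact (cbox (-m) m)"
        using compact_cbox by (rule compact_imp_seq_compact)
      ultimately obtain l \<tau>' where "strict_mono \<tau>'" "((\<lambda>k. c (\<tau> k) r s) \<circ> \<tau>') \<longlonglongrightarrow> l"
        by (metis seq_compactE)
      then show ?thesis by (auto simp: rs o_def convergent_def)
    next
      case False
      then show ?thesis using rs by (auto intro: strict_mono_id)
    qed
  qed
  \<comment> \<open>The diagonal sequence is a subsequence of the refinement made for this pair only
    from the next index on. This explains the offset, which \<open>LIMSEQ_offset\<close> removes
    later.\<close>
  have conv: "convergent (\<lambda>k. c (diagseq (k + Suc (prod_encode (r, s)))) r s)" if "(r, s) \<in> Omega" for r s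
  proof -
    have "prod_decode (prod_encode (r, s)) \<in> Omega \<longrightarrow>
      convergent (\<lambda>k. c ((diagseq \<circ> (+) (Suc (prod_encode (r, s)))) k)
         (fst (prod_decode (prod_encode (r, s)))) (snd (prod_decode (prod_encode (r, s)))))"
    proof (rule diagseq_holds)
      fix x y :: "nat \<Rightarrow> nat" and n assume x: "strict_mono x"
        and y: "prod_decode n \<in> Omega \<longrightarrow>
          convergent (\<lambda>k. c (y k) (fst (prod_decode n)) (snd (prod_decode n)))"
      show "prod_decode n \<in> Omega \<longrightarrow>
          convergent (\<lambda>k. c ((y \<circ> x) k) (fst (prod_decode n)) (snd (prod_decode n)))"
        using y convergent_subseq_convergent[OF _ x] by (force simp: o_def)
    qed
    then show ?thesis using that by (simp add: add.commute)
  qed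
  show thesis
  proof (rule that[of diagseq "\<lambda>r s. lim (\<lambda>k. c (diagseq k) r s)"])
    show "strict_mono diagseq" by (rule subseq_diagseq)
    fix r s assume "(r, s) \<in> Omega"
    from conv[OF this] obtain l where "(\<lambda>k. c (diagseq (k + Suc (prod_encode (r, s)))) r s) \<longlonglongrightarrow> l"
      by (auto simp: convergent_def)
    then have "(\<lambda>k. c (diagseq k) r s) \<longlonglongrightarrow> l" by (rule LIMSEQ_offset)
    then show "(\<lambda>k. c (diagseq k) r s) \<longlonglongrightarrow> lim (\<lambda>k. c (diagseq k) r s)"
      by (simp add: limI)
  qed
qed

lemma X_plus_massD:
  assumes "c \<in> X_plus_mass \<rho> \<sigma>"
  shows "\<And>r s. (r, s) \<in> Omega \<Longrightarrow> 0 \<le> c r s"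
    and "((\<lambda>(r, s). real r * c r s) has_sum \<rho>) Omega"
    and "((\<lambda>(r, s). real s * c r s) has_sum \<sigma>) Omega"
  using assms
  by (auto simp: X_plus_mass_def X_plus_def finite_mass_def rho_mass_def sigma_mass_def
      intro: has_sum_infsum)

lemma X_plus_mass_total:
  assumes "c \<in> X_plus_mass \<rho> \<sigma>"
  shows "((\<lambda>(r, s). real (r + s) * c r s) has_sum (\<rho> + \<sigma>)) Omega"
  using has_sum_add[OF X_plus_massD(2,3)[OF assms]]
  by (simp add: case_prod_unfold distrib_right)

lemma X_plus_mass_finite_sum:
  assumes "c \<in> X_plus_mass \<rho> \<sigma>" "finite F" "F \<subseteq> Omega"
  shows "(\<Sum>(r, s)\<in>F. real (r + s) * c r s) \<le> \<rho> + \<sigma>"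
  by (rule finite_sum_le_has_sum[OF X_plus_mass_total[OF assms(1)]])
    (use assms X_plus_massD(1)[OF assms(1)] in auto)

lemma X_plus_mass_le:
  assumes "c \<in> X_plus_mass \<rho> \<sigma>" "(r, s) \<in> Omega"
  shows "c r s \<le> \<rho> + \<sigma>"
proof -
  have "1 * c r s \<le> real (r + s) * c r s"
    using assms X_plus_massD(1) by (intro mult_right_mono) (auto simp: Omega_def)
  also have "\<dots> \<le> \<rho> + \<sigma>"
    using X_plus_mass_finite_sum[OF assms(1), of "{(r, s)}"] assms(2) by simp
  finally show ?thesis by simp
qed

lemma X_plus_mass_tail:
  assumes "c \<in> X_plus_mass \<rho> \<sigma>" "finite F" "F \<subseteq> {(r, s). r + s \<ge> Suc n}"
  shows "(\<Sum>(r, s)\<in>F. real (r + s) * c r s)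
    \<le> (\<Sum>\<^sub>\<infinity>(r, s)\<in>{(r, s). r + s \<ge> Suc n}. real (r + s) * c r s)"
proof (rule finite_sum_le_infsum)
  have sub: "{(r, s). r + s \<ge> Suc n} \<subseteq> Omega" by (auto simp: Omega_def)
  show "(\<lambda>(r, s). real (r + s) * c r s) summable_on {(r, s). r + s \<ge> Suc n}"
    using X_plus_mass_total[OF assms(1)] sub summable_on_subset_banach has_sum_imp_summable by blast
  show "0 \<le> (case i of (r, s) \<Rightarrow> real (r + s) * c r s)"
    if "i \<in> {(r, s). r + s \<ge> Suc n} - F" for i
    using that sub X_plus_massD(1)[OF assms(1)] by (force intro!: mult_nonneg_nonneg)
qed (use assms in auto)

lemma nonneg_bounded_sums_summable:
  fixes f :: "'a \<Rightarrow> real"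
  assumes "\<And>i. i \<in> A \<Longrightarrow> 0 \<le> f i" "\<And>F. finite F \<Longrightarrow> F \<subseteq> A \<Longrightarrow> sum f F \<le> m"
  shows "f summable_on A"
  by (rule nonneg_bdd_above_summable_on) (use assms in \<open>auto intro!: bdd_aboveI2[of _ _ m]\<close>)

lemma summable_tail_small:
  fixes f :: "nat \<times> nat \<Rightarrow> real"
  assumes nonneg: "\<And>i. i \<in> Omega \<Longrightarrow> 0 \<le> f i" and sum: "f summable_on Omega" and "0 < \<epsilon>"
  obtains L where "1 \<le> L"
    "\<And>F. finite F \<Longrightarrow> F \<subseteq> {(r, s). L \<le> r + s} \<Longrightarrow> sum f F \<le> \<epsilon>"
proof -
  have "(f has_sum infsum f Omega) Omega" using sum by simp
  then have "\<forall>\<^sub>F F in finite_subsets_at_top Omega. dist (sum f F) (infsum f Omega) < \<epsilon>"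
    using assms(3) unfolding has_sum_def by (rule tendstoD)
  then obtain F0 where F0: "finite F0" "F0 \<subseteq> Omega" "dist (sum f F0) (infsum f Omega) < \<epsilon>"
    unfolding eventually_finite_subsets_at_top by blast
  \<comment> \<open>Larger than the size of every member of \<open>F0\<close>, so a set of clusters
    of size at least \<open>L\<close> is disjoint from \<open>F0\<close>.\<close>
  define L where "L = Suc (\<Sum>(r, s)\<in>F0. r + s)"
  show thesis
  proof (rule that[of L])
    fix F assume F: "finite F" "F \<subseteq> {(r, s). L \<le> r + s}"
    have disj: "F0 \<inter> F = {}"
    proof safe
      fix r s assume rs: "(r, s) \<in> F0" "(r, s) \<in> F"
      have "r + s \<le> (\<Sum>(r, s)\<in>F0. r + s)"
        using member_le_sum[of "(r, s)" F0 "\<lambda>(r, s). r + s"] rs F0 by simp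
      then show "(r, s) \<in> {}" using rs F(2) by (force simp: L_def)
    qed
    have "sum f F0 + sum f F = sum f (F0 \<union> F)"
      using disj F0 F by (simp add: sum.union_disjoint)
    also have "\<dots> \<le> infsum f Omega"
      by (rule finite_sum_le_infsum[OF sum])
        (use F0 F nonneg in \<open>force simp: L_def Omega_def\<close>)+
    finally show "sum f F \<le> \<epsilon>" using F0(3) by (simp add: dist_real_def)
  qed (simp add: L_def)
qed

lemma infsum_near_finite_sum:
  fixes f :: "'a \<Rightarrow> real"
  assumes "f summable_on A" "finite B" "B \<subseteq> A"
    and "\<And>F. finite F \<Longrightarrow> F \<subseteq> A - B \<Longrightarrow> (\<Sum>i\<in>F. \<bar>f i\<bar>) \<le> \<epsilon>"
  shows "\<bar>infsum f A - sum f B\<bar> \<le> \<epsilon>"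
proof -
  have s: "f summable_on (A - B)"
    using assms(1) by (rule summable_on_subset_banach) auto
  have "infsum f A = infsum f (A - B) + sum f B"
  proof -
    have "infsum f (A - B \<union> B) = infsum f (A - B) + infsum f B"
      by (rule infsum_Un_disjoint[OF s]) (use assms(2) in auto)
    then show ?thesis using assms(2,3) by (simp add: Un_absorb2)
  qed
  moreover have "\<bar>infsum f (A - B)\<bar> \<le> \<epsilon>"
  proof (rule abs_leI)
    show "infsum f (A - B) \<le> \<epsilon>"
    proof (rule infsum_le_finite_sums[OF s])
      fix F assume F: "finite F" "F \<subseteq> A - B"
      have "sum f F \<le> (\<Sum>i\<in>F. \<bar>f i\<bar>)" by (rule sum_mono) simp
      then show "sum f F \<le> \<epsilon>" using assms(4)[OF F] by linarith
    qed
    have "infsum (\<lambda>i. - f i) (A - B) \<le> \<epsilon>"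
    proof (rule infsum_le_finite_sums)
      show "(\<lambda>i. - f i) summable_on (A - B)" using s by (simp add: summable_on_uminus)
      fix F assume F: "finite F" "F \<subseteq> A - B"
      have "(\<Sum>i\<in>F. - f i) \<le> (\<Sum>i\<in>F. \<bar>f i\<bar>)" by (rule sum_mono) simp
      then show "(\<Sum>i\<in>F. - f i) \<le> \<epsilon>" using assms(4)[OF F] by linarith
    qed
    then show "- infsum f (A - B) \<le> \<epsilon>" by (simp add: infsum_uminus)
  qed
  ultimately show ?thesis by simp
qed

section \<open>Concentration of mass where one drift vanishes\<close>

text \<open>This prepares a summation by parts: the coefficient of c(r+1,s) in the tested flux is
  replaced by a function of (r + 1, s) itself. The error has three sources, each taking a third of
  \<eta>: replacing p by P, moving the argument of the continuous g = (z - P) P, and replacing the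
  factor n by n + 1. It is proportional to the size, so its sum is controlled by the mass.\<close>

lemma shift_coefficient:
  assumes P: "drift_profile p P" and "0 < \<eta>"
  obtains n0 where "1 \<le> n0" "\<And>r s. n0 \<le> r + s \<Longrightarrow>
    \<bar>real (r + s) * (z - P (real r / real (r + s))) * p r s
      - real (r + 1 + s) * ((z - P (real (r + 1) / real (r + 1 + s))) * P (real (r + 1) / real (r + 1 + s)))\<bar>
    \<le> \<eta> * real (r + 1 + s)"
proof -
  define h where "h \<xi> = z - P \<xi>" for \<xi>
  define g where "g \<xi> = h \<xi> * P \<xi>" for \<xi>
  define H where "H = \<bar>z\<bar> + P 1"
  have P01: "0 \<le> P \<xi>" "P \<xi> \<le> P 1" if "\<xi> \<in> {0..1}" for \<xi>
    using drift_profile_bounds[OF P that] .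
  have P1: "0 \<le> P 1" using P01(1)[of 1] by simp
  have H: "0 \<le> H" "\<bar>h \<xi>\<bar> \<le> H" if "\<xi> \<in> {0..1}" for \<xi>
    using P01[OF that] by (auto simp: H_def h_def)
  have G: "\<bar>g \<xi>\<bar> \<le> H * P 1" if "\<xi> \<in> {0..1}" for \<xi>
    unfolding g_def abs_mult using H[OF that] P01[OF that] by (intro mult_mono) auto
  have H0: "0 \<le> H" using H(1)[of 0] by simp
  have cont_g: "continuous_on {0..1} g"
    unfolding g_def h_def by (intro continuous_intros drift_profileD(1)[OF P])
  define \<eta>1 where "\<eta>1 = \<eta> / (3 * (H + 1))"
  have e1: "0 < \<eta>1" "H * \<eta>1 \<le> \<eta> / 3"
    using assms(2) H0 by (auto simp: \<eta>1_def field_simps)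
  obtain n1 where n1: "1 \<le> n1" "\<And>r s. n1 \<le> r + s \<Longrightarrow> \<bar>p r s - P (real r / real (r + s))\<bar> < \<eta>1"
    using drift_profileD(4)[OF P e1(1)] by blast
  obtain n2 where n2: "\<And>r s. n2 \<le> r + s \<Longrightarrow>
       \<bar>g (real (r + 1) / real (r + s + 1)) - g (real r / real (r + s))\<bar> < \<eta> / 3"
    using uniform_shift[OF cont_g, of "\<eta> / 3"] assms(2) by (metis zero_less_divide_iff zero_less_numeral)
  obtain n3 :: nat where n3: "3 * (H * P 1) / \<eta> < real n3" using reals_Archimedean2 by blast
  show thesis
  proof (rule that[of "max n1 (max n2 n3)"])
    show "1 \<le> max n1 (max n2 n3)" using n1(1) by simp
    fix r s assume rs: "max n1 (max n2 n3) \<le> r + s"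
    define n where "n = real (r + s)"
    define x where "x = real r / real (r + s)"
    define x' where "x' = real (r + 1) / real (r + 1 + s)"
    have xx: "x \<in> {0..1}" "x' \<in> {0..1}"
      unfolding x_def x'_def by (rule composition_bounds)+
    have n0: "0 \<le> n" by (simp add: n_def)
    have "\<bar>h x * (p r s - P x)\<bar> \<le> H * \<eta>1"
      unfolding abs_mult using H[OF xx(1)] n1(2)[of r s] rs by (intro mult_mono) (auto simp: x_def)
    then have 1: "\<bar>h x * (p r s - P x)\<bar> \<le> \<eta> / 3" using e1(2) by linarith
    have 2: "\<bar>g x - g x'\<bar> \<le> \<eta> / 3"
      using n2[of r s] rs by (simp add: x_def x'_def add_ac abs_minus_commute)
    have "\<bar>h x * (p r s - P x) + (g x - g x')\<bar> \<le> \<eta> / 3 + \<eta> / 3"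
      using 1 2 by linarith
    then have "\<bar>n * (h x * (p r s - P x) + (g x - g x'))\<bar> \<le> n * (\<eta> / 3 + \<eta> / 3)"
      unfolding abs_mult using n0 by (simp only: abs_of_nonneg mult_left_mono)
    moreover have "\<bar>g x'\<bar> \<le> (n + 1) * \<eta> / 3"
    proof -
      have "3 * (H * P 1) / \<eta> \<le> n + 1" using n3 rs unfolding n_def by linarith
      then have "H * P 1 \<le> (n + 1) * \<eta> / 3" using assms(2) by (simp add: field_simps)
      then show ?thesis using G[OF xx(2)] by linarith
    qed
    moreover have "n * h x * p r s - (n + 1) * g x' = n * (h x * (p r s - P x) + (g x - g x')) - g x'"
      by (simp add: g_def algebra_simps)
    ultimately have "\<bar>n * h x * p r s - (n + 1) * g x'\<bar> \<le> n * (\<eta> / 3 + \<eta> / 3) + (n + 1) * \<eta> / 3"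
      by linarith
    also have "\<dots> = \<eta> * n + \<eta> / 3" by (simp add: field_simps)
    also have "\<dots> \<le> \<eta> * (n + 1)" using assms(2) by (simp add: distrib_left)
    finally show "\<bar>real (r + s) * (z - P (real r / real (r + s))) * p r s
      - real (r + 1 + s) * ((z - P (real (r + 1) / real (r + 1 + s))) * P (real (r + 1) / real (r + 1 + s)))\<bar>
      \<le> \<eta> * real (r + 1 + s)"
      by (simp add: n_def g_def h_def x_def x'_def add_ac)
  qed
qed

text \<open>Let h = z - P. Testing the flux with n h and shifting the loss term back by one unit
  turns it into n h P c(r,s), up to small errors. What remains is n c h (z - P) = n c h^2, the
  weighted square itself. The summation by parts leaves two shells: the upper one is small by
  hypothesis, and the lower one tends to a shell of the limit \<open>e\<close>, which is small for
  large \<open>L\<close> because \<open>e\<close> has finite mass.\<close>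

lemma concentration:
  fixes c :: "nat \<Rightarrow> nat \<Rightarrow> nat \<Rightarrow> real" and N :: "nat \<Rightarrow> nat"
  assumes P: "drift_profile p P"
    and nonneg: "\<And>k r s. (r, s) \<in> Omega \<Longrightarrow> 0 \<le> c k r s"
    and mass: "\<And>k F. finite F \<Longrightarrow> F \<subseteq> Omega \<Longrightarrow> (\<Sum>(r, s)\<in>F. real (r + s) * c k r s) \<le> m"
    and lim: "\<And>r s. (r, s) \<in> Omega \<Longrightarrow> (\<lambda>k. c k r s) \<longlonglongrightarrow> e r s"
    and z: "\<zeta> \<longlonglongrightarrow> z"
    and N: "filterlim N at_top sequentially"
    and flux: "(\<lambda>k. \<Sum>(r, s)\<in>band 1 (N k).
      real (r + s) * \<bar>\<zeta> k * c k r s - p r s * c k (r + 1) s\<bar>) \<longlonglongrightarrow> 0"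
    and shell: "(\<lambda>k. \<Sum>(r, s)\<in>band (N k + 1) (N k + 1). real (r + s) * c k r s) \<longlonglongrightarrow> 0"
    and "0 < \<epsilon>"
  obtains L where "1 \<le> L" "\<forall>\<^sub>F k in sequentially.
    (\<Sum>(r, s)\<in>band L (N k). real (r + s) * c k r s * (z - P (real r / real (r + s)))\<^sup>2) \<le> \<epsilon>"
proof -
  define x where "x r s = real r / real (r + s)" for r s
  define h where "h \<xi> = z - P \<xi>" for \<xi>
  define g where "g \<xi> = h \<xi> * P \<xi>" for \<xi>
  define H where "H = \<bar>z\<bar> + P 1"
  define G where "G = H * P 1"
  define fl where "fl k = (\<Sum>(r, s)\<in>band 1 (N k).
      real (r + s) * \<bar>\<zeta> k * c k r s - p r s * c k (r + 1) s\<bar>)" for k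
  define sh where "sh k L = (\<Sum>(r, s)\<in>band L L. real (r + s) * c k r s)" for k L
  have x01: "x r s \<in> {0..1}" for r s unfolding x_def by (rule composition_bounds)
  have P01: "0 \<le> P \<xi>" "P \<xi> \<le> P 1" if "\<xi> \<in> {0..1}" for \<xi>
    using drift_profile_bounds[OF P that] .
  have H: "0 \<le> H" "\<bar>h \<xi>\<bar> \<le> H" if "\<xi> \<in> {0..1}" for \<xi>
    using P01[OF that] by (auto simp: H_def h_def)
  have H0: "0 \<le> H" using H(1)[of 0] by simp
  have G: "\<bar>g \<xi>\<bar> \<le> G" if "\<xi> \<in> {0..1}" for \<xi>
    unfolding g_def abs_mult G_def using H[OF that] P01[OF that] by (intro mult_mono) auto
  have m0: "0 \<le> m" using mass[of "{}"] by simp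
  define \<eta> where "\<eta> = \<epsilon> / (2 * (m + 1))"
  have eta: "0 < \<eta>" "\<eta> * m < \<epsilon> / 2"
    using \<open>0 < \<epsilon>\<close> m0 by (auto simp: \<eta>_def field_simps)
  obtain n0 where n0: "1 \<le> n0" "\<And>r s. n0 \<le> r + s \<Longrightarrow>
    \<bar>real (r + s) * h (x r s) * p r s - real (r + 1 + s) * g (x (r + 1) s)\<bar> \<le> \<eta> * real (r + 1 + s)"
    using shift_coefficient[OF P eta(1), of z] unfolding x_def g_def h_def by blast
  have e0: "0 \<le> e r s" if "(r, s) \<in> Omega" for r s
    using lim[OF that] nonneg[OF that] by (simp add: LIMSEQ_le_const)
  have e_mass: "(\<Sum>(r, s)\<in>F. real (r + s) * e r s) \<le> m" if "finite F" "F \<subseteq> Omega" for F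
  proof (rule LIMSEQ_le_const2)
    show "(\<lambda>k. \<Sum>(r, s)\<in>F. real (r + s) * c k r s) \<longlonglongrightarrow> (\<Sum>(r, s)\<in>F. real (r + s) * e r s)"
      unfolding case_prod_unfold
      by (intro tendsto_intros lim) (use that(2) in auto)
    show "\<exists>M. \<forall>k\<ge>M. (\<Sum>(r, s)\<in>F. real (r + s) * c k r s) \<le> m"
      using mass[OF that] by blast
  qed
  have e_sum: "(\<lambda>(r, s). real (r + s) * e r s) summable_on Omega"
    by (rule nonneg_bounded_sums_summable[where m = m]) (use e0 e_mass in auto)
  obtain L0 where L0: "1 \<le> L0" "\<And>F. finite F \<Longrightarrow> F \<subseteq> {(r, s). L0 \<le> r + s} \<Longrightarrow>
      (\<Sum>(r, s)\<in>F. real (r + s) * e r s) \<le> \<epsilon> / (2 * (G + 1))"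
  proof (rule summable_tail_small[OF _ e_sum, of "\<epsilon> / (2 * (G + 1))"])
    show "0 < \<epsilon> / (2 * (G + 1))"
      using \<open>0 < \<epsilon>\<close> H0 P01[of 1] by (simp add: G_def add_nonneg_pos)
  qed (use e0 in auto)
  \<comment> \<open>Fixed before k: \<open>n0\<close> is for the coefficient estimate,
    \<open>L0\<close> for the shell of \<open>e\<close> at size \<open>L\<close>.\<close>
  define L where "L = max n0 L0"
  have L: "1 \<le> L" "n0 \<le> L" "L0 \<le> L" using n0(1) by (auto simp: L_def)
  have G0: "0 \<le> G" using H0 P01[of 1] by (simp add: G_def)
  have sh_e: "G * (\<Sum>(r, s)\<in>band L L. real (r + s) * e r s) < \<epsilon> / 2"
  proof -
    have "(\<Sum>(r, s)\<in>band L L. real (r + s) * e r s) \<le> \<epsilon> / (2 * (G + 1))"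
      by (rule L0(2)) (use L in auto)
    then have "G * (\<Sum>(r, s)\<in>band L L. real (r + s) * e r s) \<le> G * (\<epsilon> / (2 * (G + 1)))"
      using G0 by (rule mult_left_mono)
    also have "\<dots> < \<epsilon> / 2" using G0 \<open>0 < \<epsilon>\<close> by (simp add: field_simps)
    finally show ?thesis .
  qed
  \<comment> \<open>All the errors. The parts with the flux, with z - \<zeta>_k and with the upper
    shell tend to 0; the coefficient error \<open>\<eta> * m\<close> and the lower shell stay, each
    strictly below half of \<epsilon>.\<close>
  define U where "U k = H * fl k + \<bar>z - \<zeta> k\<bar> * (H * m) + \<eta> * m + G * (sh k L + sh k (N k + 1))" for k
  have "U \<longlonglongrightarrow> H * 0 + \<bar>z - z\<bar> * (H * m) + \<eta> * m
      + G * ((\<Sum>(r, s)\<in>band L L. real (r + s) * e r s) + 0)"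
    unfolding U_def fl_def sh_def using shell flux
    unfolding case_prod_unfold
    by (intro tendsto_intros z lim) (use band_subset_Omega[OF L(1)] in auto)
  then have "\<forall>\<^sub>F k in sequentially. U k < \<epsilon>"
    by (rule order_tendstoD(2)) (use eta(2) sh_e in simp)
  moreover have "\<forall>\<^sub>F k in sequentially. L \<le> N k"
    using N by (simp add: filterlim_at_top)
  ultimately have "\<forall>\<^sub>F k in sequentially.
    (\<Sum>(r, s)\<in>band L (N k). real (r + s) * c k r s * (z - P (real r / real (r + s)))\<^sup>2) \<le> \<epsilon>"
  proof eventually_elim
    case (elim k)
    have O: "(r, s) \<in> Omega" if "(r, s) \<in> band L M" for r s M
      using that L(1) by (auto simp: Omega_def)
    have band_mass: "(\<Sum>(r, s)\<in>band L (N k). real (r + s) * c k r s) \<le> m"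
      by (rule mass) (use band_subset_Omega[OF L(1)] in auto)
    \<comment> \<open>An exact identity: flux, replacement of \<zeta>_k by z, replacement of the
      coefficient, and a difference that telescopes.\<close>
    have split: "(\<Sum>(r, s)\<in>band L (N k). real (r + s) * c k r s * (h (x r s))\<^sup>2)
       = (\<Sum>(r, s)\<in>band L (N k). real (r + s) * h (x r s) * (\<zeta> k * c k r s - p r s * c k (r + 1) s))
       + (z - \<zeta> k) * (\<Sum>(r, s)\<in>band L (N k). real (r + s) * h (x r s) * c k r s)
       + (\<Sum>(r, s)\<in>band L (N k). (real (r + s) * h (x r s) * p r s - real (r + 1 + s) * g (x (r + 1) s)) * c k (r + 1) s)
       + ((\<Sum>(r, s)\<in>band L (N k). real (r + 1 + s) * g (x (r + 1) s) * c k (r + 1) s)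
         - (\<Sum>(r, s)\<in>band L (N k). real (r + s) * g (x r s) * c k r s))"
      (is "_ = ?A + (z - \<zeta> k) * ?B + ?C + ?D")
      unfolding sum_distrib_left sum.distrib[symmetric] sum_subtractf[symmetric]
      by (rule sum.cong) (auto simp: g_def h_def algebra_simps power2_eq_square)
    have A: "?A \<le> H * fl k"
    proof -
      have "?A \<le> (\<Sum>(r, s)\<in>band L (N k). H * (real (r + s) * \<bar>\<zeta> k * c k r s - p r s * c k (r + 1) s\<bar>))"
      proof (rule sum_mono, clarify)
        fix r s
        define y where "y = \<zeta> k * c k r s - p r s * c k (r + 1) s"
        have "h (x r s) * y \<le> \<bar>h (x r s)\<bar> * \<bar>y\<bar>" by (metis abs_ge_self abs_mult)
        also have "\<dots> \<le> H * \<bar>y\<bar>" using H(2)[OF x01] by (rule mult_right_mono) simp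
        finally have "real (r + s) * (h (x r s) * y) \<le> real (r + s) * (H * \<bar>y\<bar>)"
          by (rule mult_left_mono) simp
        then show "real (r + s) * h (x r s) * (\<zeta> k * c k r s - p r s * c k (r + 1) s)
           \<le> H * (real (r + s) * \<bar>\<zeta> k * c k r s - p r s * c k (r + 1) s\<bar>)"
          by (simp add: y_def mult_ac)
      qed
      also have "\<dots> = H * (\<Sum>(r, s)\<in>band L (N k). real (r + s) * \<bar>\<zeta> k * c k r s - p r s * c k (r + 1) s\<bar>)"
        by (simp add: sum_distrib_left case_prod_unfold)
      also have "\<dots> \<le> H * fl k"
        unfolding fl_def
        by (intro mult_left_mono[OF _ H0] sum_mono2) (use L in auto)
      finally show ?thesis .
    qed
    have B: "(z - \<zeta> k) * ?B \<le> \<bar>z - \<zeta> k\<bar> * (H * m)"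
    proof -
      have "\<bar>?B\<bar> \<le> (\<Sum>(r, s)\<in>band L (N k). H * (real (r + s) * c k r s))"
      proof (rule order_trans[OF sum_abs], rule sum_mono, clarify)
        fix r s assume "(r, s) \<in> band L (N k)"
        then have "(r, s) \<in> Omega" by (rule O)
        then have c0: "0 \<le> c k r s" by (rule nonneg)
        then have "0 \<le> real (r + s) * c k r s" by simp
        then have "\<bar>h (x r s)\<bar> * (real (r + s) * c k r s) \<le> H * (real (r + s) * c k r s)"
          using H(2)[OF x01] by (rule mult_right_mono[rotated])
        then show "\<bar>real (r + s) * h (x r s) * c k r s\<bar> \<le> H * (real (r + s) * c k r s)"
          using c0 by (simp add: abs_mult mult_ac)
      qed
      also have "\<dots> = H * (\<Sum>(r, s)\<in>band L (N k). real (r + s) * c k r s)"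
        by (simp add: sum_distrib_left case_prod_unfold)
      also have "\<dots> \<le> H * m" using band_mass H0 by (rule mult_left_mono)
      finally have "\<bar>z - \<zeta> k\<bar> * \<bar>?B\<bar> \<le> \<bar>z - \<zeta> k\<bar> * (H * m)" by (rule mult_left_mono) simp
      moreover have "(z - \<zeta> k) * ?B \<le> \<bar>z - \<zeta> k\<bar> * \<bar>?B\<bar>"
        unfolding abs_mult[symmetric] by (rule abs_ge_self)
      ultimately show ?thesis by (rule order_trans[rotated])
    qed
    have C: "?C \<le> \<eta> * m"
    proof -
      have "?C \<le> (\<Sum>(r, s)\<in>band L (N k). \<eta> * (real (r + 1 + s) * c k (r + 1) s))"
      proof (rule sum_mono, clarify)
        fix r s assume "(r, s) \<in> band L (N k)"
        then have "n0 \<le> r + s" using L by (auto simp: band_def)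
        note b = n0(2)[OF this]
        have "0 \<le> c k (r + 1) s" by (rule nonneg) (simp add: Omega_def)
        then have "(real (r + s) * h (x r s) * p r s - real (r + 1 + s) * g (x (r + 1) s)) * c k (r + 1) s
          \<le> (\<eta> * real (r + 1 + s)) * c k (r + 1) s"
          using b by (intro mult_right_mono) linarith+
        then show "(real (r + s) * h (x r s) * p r s - real (r + 1 + s) * g (x (r + 1) s)) * c k (r + 1) s
          \<le> \<eta> * (real (r + 1 + s) * c k (r + 1) s)" by (simp only: mult.assoc)
      qed
      also have "\<dots> = \<eta> * (\<Sum>(r, s)\<in>band L (N k). real (r + 1 + s) * c k (r + 1) s)"
        by (simp add: sum_distrib_left case_prod_unfold)
      also have "(\<Sum>(r, s)\<in>band L (N k). real (r + 1 + s) * c k (r + 1) s)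
          = (\<Sum>(r, s)\<in>(\<lambda>(r, s). (r + 1, s)) ` band L (N k). real (r + s) * c k r s)"
        by (subst sum.reindex) (auto simp: inj_on_def case_prod_unfold add_ac)
      also have "\<eta> * \<dots> \<le> \<eta> * m"
        by (intro mult_left_mono mass) (use eta in \<open>auto simp: Omega_def\<close>)
      finally show ?thesis .
    qed
    have D: "?D \<le> G * (sh k L + sh k (N k + 1))"
    proof -
      \<comment> \<open>The shift produces no boundary term at r = 0: the composition is 0 there,
        and \<open>P 0 = 0\<close> makes g vanish.\<close>
      have "(\<Sum>(r, s)\<in>band L (N k). real (r + 1 + s) * g (x (r + 1) s) * c k (r + 1) s)
        = (\<Sum>(r, s)\<in>band (L + 1) (N k + 1). real (r + s) * g (x r s) * c k r s)"
        by (rule band_shift[where G = "\<lambda>r s. real (r + s) * g (x r s) * c k r s"])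
          (simp add: x_def g_def drift_profileD(2)[OF P])
      then have D_eq: "?D = - (\<Sum>(r, s)\<in>band L L. real (r + s) * g (x r s) * c k r s)
        + (\<Sum>(r, s)\<in>band (N k + 1) (N k + 1). real (r + s) * g (x r s) * c k r s)"
        using band_step[OF elim(2), of "\<lambda>r s. real (r + s) * g (x r s) * c k r s"] by simp
      have shb: "\<bar>\<Sum>(r, s)\<in>band M M. real (r + s) * g (x r s) * c k r s\<bar> \<le> G * sh k M"
        if "1 \<le> M" for M
      proof -
        have "\<bar>\<Sum>(r, s)\<in>band M M. real (r + s) * g (x r s) * c k r s\<bar>
          \<le> (\<Sum>(r, s)\<in>band M M. G * (real (r + s) * c k r s))"
        proof (rule order_trans[OF sum_abs], rule sum_mono, clarify)
          fix r s assume "(r, s) \<in> band M M"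
          then have c0: "0 \<le> c k r s" using that by (intro nonneg) (auto simp: Omega_def)
          then have "0 \<le> real (r + s) * c k r s" by simp
          then have "\<bar>g (x r s)\<bar> * (real (r + s) * c k r s) \<le> G * (real (r + s) * c k r s)"
            using G[OF x01] by (rule mult_right_mono[rotated])
          then show "\<bar>real (r + s) * g (x r s) * c k r s\<bar> \<le> G * (real (r + s) * c k r s)"
            using c0 by (simp add: abs_mult mult_ac)
        qed
        then show ?thesis by (simp add: sh_def sum_distrib_left case_prod_unfold)
      qed
      show ?thesis
        using D_eq shb[of L] shb[of "N k + 1"] L(1) by (simp add: distrib_left)
    qed
    have "(\<Sum>(r, s)\<in>band L (N k). real (r + s) * c k r s * (h (x r s))\<^sup>2) \<le> U k"
      unfolding split U_def using A B C D by linarith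
    then show ?case using elim(1) by (simp add: h_def x_def)
  qed
  with L(1) show thesis by (rule that)
qed

lemma floor_ratio_tendsto:
  assumes "0 \<le> \<xi>"
  shows "(\<lambda>n. real (nat \<lfloor>\<xi> * real n\<rfloor>) / real n) \<longlonglongrightarrow> \<xi>"
proof (rule LIM_zero_cancel, rule Lim_null_comparison)
  show "\<forall>\<^sub>F n in sequentially. norm (real (nat \<lfloor>\<xi> * real n\<rfloor>) / real n - \<xi>) \<le> 1 / real n"
    using eventually_gt_at_top[of 0]
  proof eventually_elim
    case (elim n)
    have "0 \<le> \<xi> * real n" using assms by simp
    then have "real (nat \<lfloor>\<xi> * real n\<rfloor>) = of_int \<lfloor>\<xi> * real n\<rfloor>" by simp
    then have "\<bar>real (nat \<lfloor>\<xi> * real n\<rfloor>) - \<xi> * real n\<bar> \<le> 1" by linarith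
    moreover have "real (nat \<lfloor>\<xi> * real n\<rfloor>) / real n - \<xi> = (real (nat \<lfloor>\<xi> * real n\<rfloor>) - \<xi> * real n) / real n"
      using elim by (simp add: diff_divide_distrib)
    ultimately show ?case using elim by (simp add: divide_right_mono)
  qed
  show "(\<lambda>n. 1 / real n) \<longlonglongrightarrow> 0" by (rule lim_1_over_n)
qed

section \<open>Equilibria\<close>

lemma entropy_fun_nonneg: "0 \<le> x \<Longrightarrow> 0 \<le> entropy_fun x"
proof (cases "x = 0")
  case False
  assume "0 \<le> x"
  with False have x: "0 < x" by simp
  have "ln (1 / x) \<le> 1 / x - 1" using x by (intro ln_le_minus_one) simp
  then have "x * (1 - 1 / x) \<le> x * ln x" using x by (intro mult_left_mono) (auto simp: ln_div)
  moreover have "x * (1 - 1 / x) = x - 1" using x by (simp add: field_simps)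
  ultimately show ?thesis by (simp add: entropy_fun_def)
qed (simp add: entropy_fun_def)

lemma log_difference_nonpos:
  fixes x y :: real
  assumes "0 < x" "0 < y"
  shows "(x - y) * ln (y / x) \<le> 0" "(x - y) * ln (y / x) = 0 \<Longrightarrow> x = y"
proof -
  show "(x - y) * ln (y / x) \<le> 0"
  proof (cases "x \<le> y")
    case True
    then show ?thesis using assms by (intro mult_nonpos_nonneg) auto
  next
    case False
    then show ?thesis using assms by (intro mult_nonneg_nonpos) auto
  qed
  show "x = y" if "(x - y) * ln (y / x) = 0"
    using that assms by (auto simp: ln_eq_zero_iff)
qed

text \<open>
  Adding the variational inequalities of the two pairs gives a nonnegative sum of the nonpositive
  terms \<open>(x - y) ln (y / x)\<close>.
\<close>

lemma equilibrium_pair_unique: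
  fixes z w z1 w1 :: real
  assumes pos: "0 < z" "0 < w" "0 < z1" "0 < w1"
    and pos_Q: "\<And>r s. (r, s) \<in> Omega \<Longrightarrow> 0 < Q r s"
    and fin: "finite_mass (equilibrium Q z w)" "finite_mass (equilibrium Q z1 w1)"
    and 1: "ln (z / z1) * (\<rho> - rho_mass (equilibrium Q z w))
        + ln (w / w1) * (\<sigma> - sigma_mass (equilibrium Q z w)) \<ge> 0"
    and 2: "ln (z1 / z) * (\<rho> - rho_mass (equilibrium Q z1 w1))
        + ln (w1 / w) * (\<sigma> - sigma_mass (equilibrium Q z1 w1)) \<ge> 0"
  shows "z1 = z \<and> w1 = w"
proof -
  define E E1 where "E = equilibrium Q z w" and "E1 = equilibrium Q z1 w1"
  define T where "T = (\<lambda>(r, s). (E1 r s - E r s) * ln (E r s / E1 r s))"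
  have sums: "((\<lambda>(r, s). real r * E r s) has_sum rho_mass E) Omega"
    "((\<lambda>(r, s). real s * E r s) has_sum sigma_mass E) Omega"
    "((\<lambda>(r, s). real r * E1 r s) has_sum rho_mass E1) Omega"
    "((\<lambda>(r, s). real s * E1 r s) has_sum sigma_mass E1) Omega"
    using fin by (simp_all add: E_def E1_def finite_mass_def rho_mass_def sigma_mass_def)
  have ln_z: "ln (z1 / z) = - ln (z / z1)" "ln (w1 / w) = - ln (w / w1)"
    using pos by (simp_all add: ln_div)
  \<comment> \<open>The logarithm of the ratio of two equilibria is linear in (r, s), so the sum of
    \<open>T\<close> is a combination of the four masses.\<close>
  have T_eq: "T (r, s) = ln (z / z1) * (real r * E1 r s) + - ln (z / z1) * (real r * E r s)
      + (ln (w / w1) * (real s * E1 r s) + - ln (w / w1) * (real s * E r s))"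
    if "(r, s) \<in> Omega" for r s
  proof -
    have "ln (E r s / E1 r s) = real r * ln (z / z1) + real s * ln (w / w1)"
      using pos pos_Q[OF that]
      by (simp add: E_def E1_def equilibrium_def ln_div ln_mult ln_realpow algebra_simps)
    then show ?thesis by (simp add: T_def algebra_simps)
  qed
  have "((\<lambda>(r, s). ln (z / z1) * (real r * E1 r s) + - ln (z / z1) * (real r * E r s)
      + (ln (w / w1) * (real s * E1 r s) + - ln (w / w1) * (real s * E r s))) has_sum
      (ln (z / z1) * rho_mass E1 + - ln (z / z1) * rho_mass E
      + (ln (w / w1) * sigma_mass E1 + - ln (w / w1) * sigma_mass E))) Omega"
    using sums unfolding case_prod_unfold
    by (intro has_sum_add has_sum_cmult_right)
  then have "(T has_sum (ln (z / z1) * rho_mass E1 + - ln (z / z1) * rho_mass E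
      + (ln (w / w1) * sigma_mass E1 + - ln (w / w1) * sigma_mass E))) Omega"
    by (subst has_sum_cong[where g = "\<lambda>(r, s). ln (z / z1) * (real r * E1 r s) + - ln (z / z1) * (real r * E r s)
      + (ln (w / w1) * (real s * E1 r s) + - ln (w / w1) * (real s * E r s))"]) (auto simp: T_eq)
  then have T_sum: "((\<lambda>i. - T i) has_sum - (ln (z / z1) * rho_mass E1 + - ln (z / z1) * rho_mass E
      + (ln (w / w1) * sigma_mass E1 + - ln (w / w1) * sigma_mass E))) Omega"
    by (simp add: has_sum_uminus)
  have epos: "0 < E r s" "0 < E1 r s" if "(r, s) \<in> Omega" for r s
    using pos pos_Q[OF that] by (simp_all add: E_def E1_def equilibrium_def)
  have nonneg: "0 \<le> - T i" if "i \<in> Omega" for i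
    using that log_difference_nonpos(1)[OF epos(2,1)] by (cases i) (simp add: T_def)
  \<comment> \<open>In the sum of hypotheses 1 and 2 the terms with \<rho> and \<sigma> cancel, and
    this inequality is left. A sum of nonnegative terms \<open>- T i\<close> that is at most 0 has
    all terms equal to 0.\<close>
  have le0: "- (ln (z / z1) * rho_mass E1 + - ln (z / z1) * rho_mass E
      + (ln (w / w1) * sigma_mass E1 + - ln (w / w1) * sigma_mass E)) \<le> 0"
    using 1 2 by (simp add: ln_z E_def E1_def algebra_simps)
  have eq: "E1 r s = E r s" if "(r, s) \<in> Omega" for r s
  proof -
    have "- T (r, s) = 0"
      by (rule nonneg_has_sum_le_0D[OF T_sum le0 nonneg that])
    then show ?thesis
      using log_difference_nonpos(2)[OF epos(2,1)[OF that]] by (simp add: T_def)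
  qed
  have "(1, 0) \<in> Omega" "(0, 1) \<in> Omega" by (auto simp: Omega_def)
  from eq[OF this(1)] eq[OF this(2)] pos_Q[OF this(1)] pos_Q[OF this(2)] show ?thesis
    by (simp add: E_def E1_def equilibrium_def)
qed

text \<open>The quotients of consecutive values are bounded, so a unit step lowers ln Q by at most a
  constant, and every cluster is reached from a monomer, where ln Q = 0, by r + s - 1 steps.\<close>

lemma Q_lower_bound:
  assumes pos_Q: "\<And>r s. (r, s) \<in> Omega \<Longrightarrow> 0 < Q r s"
    and P: "drift_profile (\<lambda>r s. Q r s / Q (r + 1) s) P"
    and R: "drift_profile (\<lambda>r s. Q s r / Q s (r + 1)) R"
    and unit: "Q 1 0 = 1" "Q 0 1 = 1"
  obtains C where "0 \<le> C" "\<And>r s. (r, s) \<in> Omega \<Longrightarrow> - C * real (r + s) \<le> ln (Q r s)"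
proof -
  obtain C1 where C1: "1 \<le> C1" "\<And>r s. Q r s / Q (r + 1) s \<le> C1"
    using drift_profile_imp_bounded[OF P] by auto
  obtain C2 where C2: "1 \<le> C2" "\<And>s r. Q r s / Q r (s + 1) \<le> C2"
    using drift_profile_imp_bounded[OF R] by auto
  define C where "C = max (ln C1) (ln C2)"
  have C0: "0 \<le> C" using C1(1) by (simp add: C_def le_max_iff_disj)
  have step1: "ln (Q r s) - C \<le> ln (Q (r + 1) s)" if "(r, s) \<in> Omega" for r s
  proof -
    have q: "0 < Q r s" "0 < Q (r + 1) s" using that by (auto simp: Omega_def intro!: pos_Q)
    then have "ln (Q r s / Q (r + 1) s) \<le> ln C1" using C1 by (subst ln_le_cancel_iff) auto
    then show ?thesis using q by (simp add: ln_div C_def)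
  qed
  have step2: "ln (Q r s) - C \<le> ln (Q r (s + 1))" if "(r, s) \<in> Omega" for r s
  proof -
    have q: "0 < Q r s" "0 < Q r (s + 1)" using that by (auto simp: Omega_def intro!: pos_Q)
    then have "ln (Q r s / Q r (s + 1)) \<le> ln C2" using C2 by (subst ln_le_cancel_iff) auto
    then show ?thesis using q by (simp add: ln_div C_def)
  qed
  have main: "- C * real n \<le> ln (Q r s)" if "1 \<le> n" "r + s = n" for n r s
    using that
  proof (induction n arbitrary: r s rule: nat_induct_at_least)
    case base
    then have "(r = 1 \<and> s = 0) \<or> (r = 0 \<and> s = 1)" by auto
    then show ?case using unit C0 by auto
  next
    case (Suc n)
    show ?case
    proof (cases r)
      case 0
      then obtain s' where s': "s = s' + 1" using Suc.prems by (cases s) auto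
      have "(r, s') \<in> Omega" using Suc s' by (auto simp: Omega_def)
      from step2[OF this] Suc.IH[of r s'] Suc.prems s' show ?thesis by (simp add: algebra_simps)
    next
      case (Suc r')
      have "(r', s) \<in> Omega" using Suc.prems Suc.hyps Suc by (auto simp: Omega_def)
      from step1[OF this] Suc.IH[of r' s] Suc.prems Suc show ?thesis by (simp add: algebra_simps)
    qed
  qed
  show thesis by (rule that[OF C0], rule main[OF _ refl]) (simp add: Omega_def)
qed

text \<open>
  At the composition \<open>\<xi>0\<close> with \<open>z = P \<xi>0\<close> and \<open>w = R (1 - \<xi>0)\<close> neither kind of step changes
  \<open>z\<^sup>r w\<^sup>s Q\<^bsub>r,s\<^esub>\<close> much, and a cluster near \<open>\<xi>0\<close> is reached from smaller ones without leaving a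
  neighbourhood of \<open>\<xi>0\<close>: remove a unit of the component in excess.
\<close>

lemma Q_lower_bound_near:
  assumes pos_Q: "\<And>r s. (r, s) \<in> Omega \<Longrightarrow> 0 < Q r s"
    and P: "drift_profile (\<lambda>r s. Q r s / Q (r + 1) s) P"
    and R: "drift_profile (\<lambda>r s. Q s r / Q s (r + 1)) R"
    and \<xi>0: "0 < \<xi>0" "\<xi>0 < 1"
    and "0 < \<epsilon>"
  obtains \<eta> C where "0 < \<eta>" "\<And>r s. (r, s) \<in> Omega \<Longrightarrow> \<bar>real r / real (r + s) - \<xi>0\<bar> \<le> \<eta> \<Longrightarrow>
    - \<epsilon> * real (r + s) - C \<le> ln (Q r s) + real r * ln (P \<xi>0) + real s * ln (R (1 - \<xi>0))"
proof -
  define z w where "z = P \<xi>0" and "w = R (1 - \<xi>0)"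
  have zw: "0 < z" "0 < w"
    using strict_mono_onD[OF drift_profileD(3)[OF P], of 0 \<xi>0] drift_profileD(2)[OF P] \<xi>0
      strict_mono_onD[OF drift_profileD(3)[OF R], of 0 "1 - \<xi>0"] drift_profileD(2)[OF R]
    by (auto simp: z_def w_def)
  define V where "V r s = ln (Q r s) + real r * ln z + real s * ln w" for r s
  \<comment> \<open>The profile error and the continuity error are each below \<open>d\<close>. So
    the quotients are at most z + 2d \<le> z exp \<epsilon> and w + 2d \<le> w exp \<epsilon>, and a
    step near \<xi>0 lowers \<open>V\<close> by at most \<epsilon>.\<close>
  define d where "d = min z w * (exp \<epsilon> - 1) / 2"
  have d: "0 < d" "z + 2 * d \<le> z * exp \<epsilon>" "w + 2 * d \<le> w * exp \<epsilon>"
  proof -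
    show "0 < d" using zw \<open>0 < \<epsilon>\<close> by (simp add: d_def)
    have "min z w * (exp \<epsilon> - 1) \<le> z * (exp \<epsilon> - 1)" "min z w * (exp \<epsilon> - 1) \<le> w * (exp \<epsilon> - 1)"
      using \<open>0 < \<epsilon>\<close> by (intro mult_right_mono; simp)+
    moreover have "2 * d = min z w * (exp \<epsilon> - 1)" by (simp add: d_def)
    ultimately show "z + 2 * d \<le> z * exp \<epsilon>" "w + 2 * d \<le> w * exp \<epsilon>"
      by (simp_all add: right_diff_distrib)
  qed
  obtain \<eta>1 where \<eta>1: "0 < \<eta>1" "\<And>\<xi>. \<xi> \<in> {0..1} \<Longrightarrow> \<bar>\<xi> - \<xi>0\<bar> < \<eta>1 \<Longrightarrow> \<bar>P \<xi> - z\<bar> < d"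
    using drift_profileD(1)[OF P] d(1) \<xi>0 unfolding continuous_on_iff dist_real_def z_def
    by (metis atLeastAtMost_iff less_imp_le)
  obtain \<eta>2 where \<eta>2: "0 < \<eta>2" "\<And>\<xi>. \<xi> \<in> {0..1} \<Longrightarrow> \<bar>\<xi> - (1 - \<xi>0)\<bar> < \<eta>2 \<Longrightarrow> \<bar>R \<xi> - w\<bar> < d"
  proof -
    have "1 - \<xi>0 \<in> {0..1}" using \<xi>0 by auto
    then show ?thesis
      using drift_profileD(1)[OF R] d(1) that unfolding continuous_on_iff dist_real_def w_def
      by metis
  qed
  define \<eta> where "\<eta> = min \<eta>1 \<eta>2 / 2"
  have eta: "0 < \<eta>" "\<eta> < \<eta>1" "\<eta> < \<eta>2" using \<eta>1(1) \<eta>2(1) by (auto simp: \<eta>_def)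
  obtain n1 where n1: "1 \<le> n1" "\<And>r s. n1 \<le> r + s \<Longrightarrow>
      \<bar>Q r s / Q (r + 1) s - P (real r / real (r + s))\<bar> < d"
    using drift_profileD(4)[OF P d(1)] by blast
  obtain n2 where n2: "\<And>r s. n2 \<le> r + s \<Longrightarrow>
      \<bar>Q s r / Q s (r + 1) - R (real r / real (r + s))\<bar> < d"
    using drift_profileD(4)[OF R d(1)] by blast
  \<comment> \<open>Ensures that a unit step, which moves the composition by at most 1/n, moves it
    by no more than \<eta>.\<close>
  obtain n3 :: nat where n3: "1 / \<eta> < real n3" using reals_Archimedean2 by blast
  define n0 where "n0 = max n1 (max n2 n3)"
  have n0: "1 \<le> n0" using n1 by (simp add: n0_def)
  have inv: "1 / real n \<le> \<eta>" if "n0 \<le> n" for n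
  proof -
    have "1 / \<eta> < real n" "0 < real n" using n3 that n0 by (auto simp: n0_def)
    then show ?thesis using eta(1) by (simp add: field_simps)
  qed
  have stepP: "V r s - \<epsilon> \<le> V (r + 1) s"
    if "n0 \<le> r + s" "\<bar>real r / real (r + s) - \<xi>0\<bar> \<le> \<eta>" for r s
  proof -
    have q: "0 < Q r s" "0 < Q (r + 1) s" using that n0 by (auto simp: Omega_def intro!: pos_Q)
    have "\<bar>P (real r / real (r + s)) - z\<bar> < d"
      using \<eta>1(2)[OF composition_bounds[of r s]] that(2) eta by simp
    moreover have "\<bar>Q r s / Q (r + 1) s - P (real r / real (r + s))\<bar> < d"
      using n1(2) that(1) by (simp add: n0_def)
    ultimately have "Q r s / Q (r + 1) s \<le> z * exp \<epsilon>" using d by linarith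
    then have "ln (Q r s / Q (r + 1) s) \<le> ln (z * exp \<epsilon>)"
      using q zw by (subst ln_le_cancel_iff) auto
    then show ?thesis using q zw by (simp add: V_def ln_div ln_mult algebra_simps)
  qed
  have stepR: "V r s - \<epsilon> \<le> V r (s + 1)"
    if "n0 \<le> r + s" "\<bar>real r / real (r + s) - \<xi>0\<bar> \<le> \<eta>" for r s
  proof -
    have q: "0 < Q r s" "0 < Q r (s + 1)" using that n0 by (auto simp: Omega_def intro!: pos_Q)
    have "real s / real (s + r) - (1 - \<xi>0) = - (real r / real (r + s) - \<xi>0)"
      using that(1) n0 by (simp add: field_simps)
    then have "\<bar>R (real s / real (s + r)) - w\<bar> < d"
      using \<eta>2(2)[OF composition_bounds[of s r]] that(2) eta by simp
    moreover have "\<bar>Q r s / Q r (s + 1) - R (real s / real (s + r))\<bar> < d"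
      using n2[of s r] that(1) by (simp add: n0_def)
    ultimately have "Q r s / Q r (s + 1) \<le> w * exp \<epsilon>" using d by linarith
    then have "ln (Q r s / Q r (s + 1)) \<le> ln (w * exp \<epsilon>)"
      using q zw by (subst ln_le_cancel_iff) auto
    then show ?thesis using q zw by (simp add: V_def ln_div ln_mult algebra_simps)
  qed
  define C where "C = Max ((\<lambda>(r, s). \<bar>V r s\<bar>) ` band 1 n0)"
  have base: "- C \<le> V r s" if "(r, s) \<in> band 1 n0" for r s
  proof -
    have "\<bar>V r s\<bar> \<le> C" unfolding C_def by (rule Max_ge) (use that in \<open>auto simp del: mem_band\<close>)
    then show ?thesis by linarith
  qed
  have main: "- \<epsilon> * real n - C \<le> V r s"
    if "n0 \<le> n" "r + s = n" "\<bar>real r / real n - \<xi>0\<bar> \<le> \<eta>" for n r s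
    using that
  proof (induction n arbitrary: r s rule: nat_induct_at_least)
    case base
    have "0 \<le> \<epsilon> * real n0" using \<open>0 < \<epsilon>\<close> by simp
    then show ?case using \<open>\<And>r s. (r, s) \<in> band 1 n0 \<Longrightarrow> - C \<le> V r s\<close>[of r s] base n0 by simp
  next
    case (Suc n)
    have n: "0 < real n" "1 / real n \<le> \<eta>" using Suc.hyps n0 inv by auto
    show ?case
    \<comment> \<open>At or above \<xi>0, removing a unit of the first component lowers the
      composition by at most \<eta>, so it stays within distance \<eta> of \<xi>0. Below \<xi>0,
      removing a unit of the second component raises it by at most \<eta>, with the same
      effect.\<close>
    proof (cases "\<xi>0 \<le> real r / real (Suc n)")
      case True
      then have "0 < r" using \<xi>0 by (cases r) auto
      then obtain r' where r': "r = r' + 1" by (metis Suc_eq_plus1 gr0_implies_Suc)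
      have rn: "r' + s = n" using Suc.prems r' by simp
      have shift: "\<bar>real (r' + 1) / real (r' + s + 1) - real r' / real (r' + s)\<bar> \<le> 1 / real (r' + s)"
        by (rule composition_shift) (use rn Suc.hyps n0 in simp)
      have "real r' / real n \<le> real r / real (Suc n)"
        using rn n r' by (simp add: field_simps)
      then have near: "\<bar>real r' / real n - \<xi>0\<bar> \<le> \<eta>"
        using True shift Suc.prems(2) n(2) rn r' unfolding abs_le_iff by auto
      have "V r' s - \<epsilon> \<le> V r s" unfolding r' by (rule stepP) (use rn Suc.hyps near in auto)
      moreover have "- \<epsilon> * real n - C \<le> V r' s" by (rule Suc.IH[OF rn near])
      ultimately show ?thesis by (simp add: algebra_simps)
    next
      case False
      then have "0 < s" using \<xi>0 Suc.prems(1) by (cases s) auto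
      then obtain s' where s': "s = s' + 1" by (metis Suc_eq_plus1 gr0_implies_Suc)
      have rn: "r + s' = n" using Suc.prems s' by simp
      have le: "real r / real (Suc n) \<le> real r / real n"
        using n by (intro divide_left_mono) auto
      have "real r / real n - real r / real (Suc n) \<le> 1 / real n"
      proof -
        have "real r / real n - real r / real (Suc n) = (real r / real (Suc n)) / real n"
          using n by (simp add: field_simps)
        also have "\<dots> \<le> 1 / real n" using n rn by (intro divide_right_mono) auto
        finally show ?thesis .
      qed
      with le have near: "\<bar>real r / real n - \<xi>0\<bar> \<le> \<eta>"
        using False Suc.prems(2) n(2) unfolding abs_le_iff by auto
      have "V r s' - \<epsilon> \<le> V r s" unfolding s' by (rule stepR) (use rn Suc.hyps near in auto)
      moreover have "- \<epsilon> * real n - C \<le> V r s'" by (rule Suc.IH[OF rn near])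
      ultimately show ?thesis by (simp add: algebra_simps)
    qed
  qed
  show thesis
  proof (rule that[of \<eta> C])
    show "0 < \<eta>" by (rule eta)
    fix r s assume rs: "(r, s) \<in> Omega" "\<bar>real r / real (r + s) - \<xi>0\<bar> \<le> \<eta>"
    show "- \<epsilon> * real (r + s) - C \<le> ln (Q r s) + real r * ln (P \<xi>0) + real s * ln (R (1 - \<xi>0))"
    proof (cases "n0 \<le> r + s")
      case True
      then show ?thesis using main[OF True refl] rs by (simp add: V_def z_def w_def)
    next
      case False
      then have "- C \<le> V r s" using rs(1) by (intro base) (auto simp: Omega_def)
      moreover have "0 \<le> \<epsilon> * real (r + s)" using \<open>0 < \<epsilon>\<close> by simp
      ultimately show ?thesis unfolding V_def z_def w_def by linarith
    qed
  qed
qed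

lemma rho_mass_swap: "rho_mass (equilibrium (\<lambda>r s. Q s r) w z) = sigma_mass (equilibrium Q z w)"
proof -
  have "bij_betw prod.swap Omega Omega"
    by (rule bij_betwI[of _ _ _ prod.swap]) (auto simp: Omega_def)
  from infsum_reindex_bij_betw[OF this, of "\<lambda>(r, s). real s * equilibrium Q z w r s"]
  show ?thesis
    by (simp add: rho_mass_def sigma_mass_def equilibrium_def case_prod_unfold mult_ac)
qed

section \<open>Sequences with vanishing fluxes\<close>

text \<open>What a sequence of counterexamples provides along a subsequence, stated so that
  exchanging the components gives another instance: \<open>R\<close> is the profile of the exchanged
  weights, and the tail depends on the total size only.\<close>

locale flat_sequence =
  fixes Q :: "nat \<Rightarrow> nat \<Rightarrow> real" and P R :: "real \<Rightarrow> real"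
    and c :: "nat \<Rightarrow> nat \<Rightarrow> nat \<Rightarrow> real" and N :: "nat \<Rightarrow> nat"
    and e :: "nat \<Rightarrow> nat \<Rightarrow> real" and \<rho> \<sigma> :: real
  assumes pos_Q: "\<And>r s. (r, s) \<in> Omega \<Longrightarrow> 0 < Q r s"
    and Q_unit: "Q 1 0 = 1" "Q 0 1 = 1"
    and P: "drift_profile (\<lambda>r s. Q r s / Q (r + 1) s) P"
    and R: "drift_profile (\<lambda>r s. Q s r / Q s (r + 1)) R"
    and c: "\<And>k. c k \<in> X_plus_mass \<rho> \<sigma>"
    and masses_pos: "0 < \<rho>" "0 < \<sigma>"
    and N: "filterlim N at_top sequentially"
    and tail: "(\<lambda>k. \<Sum>\<^sub>\<infinity>(r, s)\<in>{(r, s). r + s \<ge> Suc (N k)}. real (r + s) * c k r s) \<longlonglongrightarrow> 0"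
    and flux_r: "(\<lambda>k. \<Sum>(r, s)\<in>band 1 (N k).
      real (r + s) * \<bar>c k 1 0 * c k r s - Q r s / Q (r + 1) s * c k (r + 1) s\<bar>) \<longlonglongrightarrow> 0"
    and flux_s: "(\<lambda>k. \<Sum>(r, s)\<in>band 1 (N k).
      real (r + s) * \<bar>c k 0 1 * c k r s - Q r s / Q r (s + 1) * c k r (s + 1)\<bar>) \<longlonglongrightarrow> 0"
    and lim: "\<And>r s. (r, s) \<in> Omega \<Longrightarrow> (\<lambda>k. c k r s) \<longlonglongrightarrow> e r s"

text \<open>The symmetry makes one-sided arguments sufficient: a fact about the first component also
  holds for the second, under the prefix \<open>swapped\<close> once the context is
  reopened.\<close>

sublocale flat_sequence \<subseteq> swapped: flat_sequence "\<lambda>r s. Q s r" R P "\<lambda>k r s. c k s r" N "\<lambda>r s. e s r" \<sigma> \<rho>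
proof
  have Omega_swap: "(r, s) \<in> Omega \<longleftrightarrow> (s, r) \<in> Omega" for r s by (auto simp: Omega_def)
  have bij: "bij_betw prod.swap Omega Omega"
    by (rule bij_betwI[of _ _ _ prod.swap]) (auto simp: Omega_def)
  show "0 < Q s r" if "(r, s) \<in> Omega" for r s using that pos_Q Omega_swap by blast
  show "(\<lambda>k. c k s r) \<longlonglongrightarrow> e s r" if "(r, s) \<in> Omega" for r s using that lim Omega_swap by blast
  show "(\<lambda>r s. c k s r) \<in> X_plus_mass \<sigma> \<rho>" for k
  proof -
    note C = X_plus_massD[OF c[of k]]
    have 1: "((\<lambda>(r, s). real r * c k s r) has_sum \<sigma>) Omega"
      using C(3) has_sum_reindex_bij_betw[OF bij, of "\<lambda>(r, s). real s * c k r s"]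
      by (simp add: case_prod_unfold)
    have 2: "((\<lambda>(r, s). real s * c k s r) has_sum \<rho>) Omega"
      using C(2) has_sum_reindex_bij_betw[OF bij, of "\<lambda>(r, s). real r * c k r s"]
      by (simp add: case_prod_unfold)
    show ?thesis
      using C(1) Omega_swap has_sum_imp_summable[OF 1] has_sum_imp_summable[OF 2] infsumI[OF 1] infsumI[OF 2]
      by (auto simp: X_plus_mass_def X_plus_def finite_mass_def rho_mass_def sigma_mass_def)
  qed
  show "(\<lambda>k. \<Sum>\<^sub>\<infinity>(r, s)\<in>{(r, s). r + s \<ge> Suc (N k)}. real (r + s) * c k s r) \<longlonglongrightarrow> 0"
  proof -
    have "(\<Sum>\<^sub>\<infinity>(r, s)\<in>{(r, s). r + s \<ge> Suc (N k)}. real (r + s) * c k s r)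
      = (\<Sum>\<^sub>\<infinity>(r, s)\<in>{(r, s). r + s \<ge> Suc (N k)}. real (r + s) * c k r s)" for k
    proof -
      have "bij_betw prod.swap {(r, s). r + s \<ge> Suc (N k)} {(r, s). r + s \<ge> Suc (N k)}"
        by (rule bij_betwI[of _ _ _ prod.swap]) auto
      from infsum_reindex_bij_betw[OF this, of "\<lambda>(r, s). real (r + s) * c k r s"]
      show ?thesis by (simp add: case_prod_unfold add.commute)
    qed
    then show ?thesis using tail by simp
  qed
  show "(\<lambda>k. \<Sum>(r, s)\<in>band 1 (N k).
      real (r + s) * \<bar>c k 0 1 * c k s r - Q s r / Q s (r + 1) * c k s (r + 1)\<bar>) \<longlonglongrightarrow> 0"
    using flux_s
    by (subst (asm) band_swap[symmetric]) (simp add: add.commute)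
  show "(\<lambda>k. \<Sum>(r, s)\<in>band 1 (N k).
      real (r + s) * \<bar>c k 1 0 * c k s r - Q s r / Q (s + 1) r * c k (s + 1) r\<bar>) \<longlonglongrightarrow> 0"
    using flux_r
    by (subst (asm) band_swap[symmetric]) (simp add: add.commute)
qed (use Q_unit P R masses_pos N in auto)

context flat_sequence
begin

abbreviation "z \<equiv> e 1 0"
abbreviation "w \<equiv> e 0 1"
abbreviation "m \<equiv> \<rho> + \<sigma>"

lemma unit_in_Omega: "(1, 0) \<in> Omega" "(0, 1) \<in> Omega"
  by (auto simp: Omega_def)

lemmas c_nonneg = X_plus_massD(1)[OF c]
lemmas c_sum = X_plus_mass_finite_sum[OF c]

lemma e_nonneg: "(r, s) \<in> Omega \<Longrightarrow> 0 \<le> e r s"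
  using lim c_nonneg by (blast intro: LIMSEQ_le_const)

lemma e_sum:
  assumes "finite F" "F \<subseteq> Omega"
  shows "(\<Sum>(r, s)\<in>F. real (r + s) * e r s) \<le> m"
proof (rule LIMSEQ_le_const2)
  show "(\<lambda>k. \<Sum>(r, s)\<in>F. real (r + s) * c k r s) \<longlonglongrightarrow> (\<Sum>(r, s)\<in>F. real (r + s) * e r s)"
    unfolding case_prod_unfold by (intro tendsto_intros lim) (use assms(2) in auto)
  show "\<exists>M. \<forall>k\<ge>M. (\<Sum>(r, s)\<in>F. real (r + s) * c k r s) \<le> m"
    using c_sum[OF assms] by blast
qed

lemma e_summable: "(\<lambda>(r, s). real (r + s) * e r s) summable_on Omega"
  by (rule nonneg_bounded_sums_summable[where m = m]) (use e_nonneg e_sum in auto)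

text \<open>Detailed balance for the limit: a single flux has weight r + s \<ge> 1 and is dominated
  by the vanishing sum of all fluxes.\<close>

lemma e_step_r:
  assumes "(r, s) \<in> Omega"
  shows "z * e r s = Q r s / Q (r + 1) s * e (r + 1) s"
proof -
  define y where "y k = c k 1 0 * c k r s - Q r s / Q (r + 1) s * c k (r + 1) s" for k
  have "(r + 1, s) \<in> Omega" by (simp add: Omega_def)
  then have "y \<longlonglongrightarrow> z * e r s - Q r s / Q (r + 1) s * e (r + 1) s"
    unfolding y_def by (intro tendsto_intros lim assms unit_in_Omega)
  moreover have "y \<longlonglongrightarrow> 0"
  proof (rule Lim_null_comparison[OF _ flux_r])
    have "\<forall>\<^sub>F k in sequentially. r + s \<le> N k" using N by (simp add: filterlim_at_top)
    then show "\<forall>\<^sub>F k in sequentially. norm (y k) \<le> (\<Sum>(r, s)\<in>band 1 (N k).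
        real (r + s) * \<bar>c k 1 0 * c k r s - Q r s / Q (r + 1) s * c k (r + 1) s\<bar>)"
    proof eventually_elim
      case (elim k)
      have "norm (y k) \<le> real (r + s) * \<bar>y k\<bar>"
        using assms mult_right_mono[of 1 "real (r + s)" "\<bar>y k\<bar>"] by (simp add: Omega_def)
      also have "\<dots> = (\<Sum>(r, s)\<in>{(r, s)}.
        real (r + s) * \<bar>c k 1 0 * c k r s - Q r s / Q (r + 1) s * c k (r + 1) s\<bar>)"
        by (simp add: y_def)
      also have "\<dots> \<le> (\<Sum>(r, s)\<in>band 1 (N k).
        real (r + s) * \<bar>c k 1 0 * c k r s - Q r s / Q (r + 1) s * c k (r + 1) s\<bar>)"
        by (rule sum_mono2) (use assms elim in \<open>auto simp: Omega_def\<close>)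
      finally show ?case .
    qed
  qed
  ultimately show ?thesis using LIMSEQ_unique by fastforce
qed

lemma concentration_r:
  assumes "0 < \<epsilon>"
  shows "\<exists>L\<ge>1. \<forall>\<^sub>F k in sequentially.
    (\<Sum>(r, s)\<in>band L (N k). real (r + s) * c k r s * (z - P (real r / real (r + s)))\<^sup>2) \<le> \<epsilon>"
proof -
  have shell: "(\<lambda>k. \<Sum>(r, s)\<in>band (N k + 1) (N k + 1). real (r + s) * c k r s) \<longlonglongrightarrow> 0"
  proof (rule tendsto_sandwich[OF _ _ tendsto_const tail])
    show "\<forall>\<^sub>F k in sequentially. 0 \<le> (\<Sum>(r, s)\<in>band (N k + 1) (N k + 1). real (r + s) * c k r s)"
      by (intro always_eventually allI sum_nonneg) (auto simp: Omega_def intro!: mult_nonneg_nonneg c_nonneg)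
    show "\<forall>\<^sub>F k in sequentially. (\<Sum>(r, s)\<in>band (N k + 1) (N k + 1). real (r + s) * c k r s)
      \<le> (\<Sum>\<^sub>\<infinity>(r, s)\<in>{(r, s). r + s \<ge> Suc (N k)}. real (r + s) * c k r s)"
      by (intro always_eventually allI X_plus_mass_tail[OF c]) auto
  qed
  show ?thesis
    using concentration[OF P c_nonneg c_sum lim lim[OF unit_in_Omega(1)] N flux_r shell assms]
    by blast
qed

end

section \<open>The limit state and the mass that it loses\<close>

context flat_sequence
begin

text \<open>Detailed balance determines a value from that at the next smaller size. A cluster with r
  > 0 is reached by a unit of the first component; for r = 0 the exchanged balance is used.\<close>

lemma e_equilibrium:
  assumes "(r, s) \<in> Omega"
  shows "e r s = equilibrium Q z w r s"
proof -
  have "e r s = equilibrium Q z w r s" if "1 \<le> n" "r + s = n" for n r s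
    using that
  proof (induction n arbitrary: r s rule: nat_induct_at_least)
    case base
    then have "(r = 1 \<and> s = 0) \<or> (r = 0 \<and> s = 1)" by auto
    then show ?case using Q_unit by (auto simp: equilibrium_def)
  next
    case (Suc n)
    show ?case
    proof (cases r)
      case 0
      then obtain s' where s': "s = s' + 1" using Suc.prems by (cases s) auto
      have O: "(r, s') \<in> Omega" "(r, s) \<in> Omega" "(s', r) \<in> Omega" using Suc s' by (auto simp: Omega_def)
      have "e r s' = equilibrium Q z w r s'" using Suc s' by auto
      then show ?thesis
        using swapped.e_step_r[OF O(3)] pos_Q[OF O(1)] pos_Q[OF O(2)]
        by (simp add: s' equilibrium_def field_simps)
    next
      case (Suc r')
      have O: "(r', s) \<in> Omega" "(r, s) \<in> Omega"
        using Suc.prems Suc.hyps Suc by (auto simp: Omega_def)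
      have "e r' s = equilibrium Q z w r' s" using Suc.IH Suc.prems Suc by auto
      then show ?thesis
        using e_step_r[OF O(1)] pos_Q[OF O(1)] pos_Q[OF O(2)]
        by (simp add: Suc equilibrium_def field_simps)
    qed
  qed
  then show ?thesis using assms by (auto simp: Omega_def)
qed

text \<open>Large clusters carry mass only at compositions with zero drift in both directions.\<close>

lemma vanishing:
  assumes u: "continuous_on {0..1} u"
    and zero: "\<And>\<xi>. \<xi> \<in> {0..1} \<Longrightarrow> z = P \<xi> \<Longrightarrow> w = R (1 - \<xi>) \<Longrightarrow> u \<xi> = 0"
    and "0 < \<epsilon>"
  shows "\<exists>L\<ge>1. \<forall>\<^sub>F k in sequentially. \<forall>F. finite F \<longrightarrow> F \<subseteq> {(r, s). L \<le> r + s} \<longrightarrow>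
    (\<Sum>(r, s)\<in>F. real (r + s) * c k r s * \<bar>u (real r / real (r + s))\<bar>) \<le> \<epsilon>"
proof -
  \<comment> \<open>Vanishes exactly at the compositions where both drifts vanish; its two terms are
    the weights that the two concentration estimates control.\<close>
  define B where "B \<xi> = (z - P \<xi>)\<^sup>2 + (w - R (1 - \<xi>))\<^sup>2" for \<xi>
  have m: "0 < m" using masses_pos by simp
  obtain U where U: "0 \<le> U" "\<And>\<xi>. \<xi> \<in> {0..1} \<Longrightarrow> \<bar>u \<xi>\<bar> \<le> U"
    using continuous_bounded[OF u] by blast
  have B0: "0 \<le> B \<xi>" for \<xi> by (simp add: B_def)
  have contB: "continuous_on {0..1} B"
    unfolding B_def
    by (intro continuous_intros drift_profileD(1)[OF P] continuous_on_compose2[OF drift_profileD(1)[OF R]]) auto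
  define \<eta> where "\<eta> = \<epsilon> / (4 * m)"
  have eta: "0 < \<eta>" using m \<open>0 < \<epsilon>\<close> by (simp add: \<eta>_def)
  \<comment> \<open>Compactness: where |u| \<ge> \<eta> the function \<open>B\<close> has no zero,
    since u vanishes at the zeros of \<open>B\<close>. It therefore has a positive minimum there,
    and a large multiple of it dominates the bound of u.\<close>
  have "\<exists>C\<ge>0. \<forall>\<xi>\<in>{0..1}. \<bar>u \<xi>\<bar> \<le> \<eta> + C * B \<xi>"
  proof -
    define K where "K = {\<xi> \<in> {0..1}. \<eta> \<le> \<bar>u \<xi>\<bar>}"
    show ?thesis
    proof (cases "K = {}")
      case True
      have "\<bar>u \<xi>\<bar> \<le> \<eta>" if "\<xi> \<in> {0..1}" for \<xi>
        using True that unfolding K_def by (metis (mono_tags, lifting) empty_iff linear mem_Collect_eq)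
      then show ?thesis by (intro exI[of _ 0]) simp
    next
      case False
      have "closed ({0..1} \<inter> (\<lambda>\<xi>. \<bar>u \<xi>\<bar>) -` {\<eta>..})"
        by (intro continuous_closed_preimage continuous_intros u)
      then have "closed K" by (simp add: K_def vimage_def Int_def)
      moreover have "bounded K" by (rule bounded_subset[of "{0..1}"]) (auto simp: K_def)
      ultimately have "compact K" by (simp add: compact_eq_bounded_closed)
      moreover have "continuous_on K B" by (rule continuous_on_subset[OF contB]) (auto simp: K_def)
      ultimately obtain \<xi>1 where \<xi>1: "\<xi>1 \<in> K" "\<And>\<xi>. \<xi> \<in> K \<Longrightarrow> B \<xi>1 \<le> B \<xi>"
        using continuous_attains_inf[of K B] False by blast
      have "B \<xi>1 \<noteq> 0"
      proof
        assume "B \<xi>1 = 0"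
        then have "z = P \<xi>1" "w = R (1 - \<xi>1)"
          by (simp_all add: B_def sum_power2_eq_zero_iff)
        then have "u \<xi>1 = 0" using zero \<xi>1(1) by (simp add: K_def)
        then show False using \<xi>1(1) eta by (simp add: K_def)
      qed
      then have pos: "0 < B \<xi>1" using B0[of \<xi>1] by simp
      show ?thesis
      proof (intro exI[of _ "U / B \<xi>1"] conjI ballI)
        show "0 \<le> U / B \<xi>1" using pos U by simp
        fix \<xi> :: real assume \<xi>: "\<xi> \<in> {0..1}"
        show "\<bar>u \<xi>\<bar> \<le> \<eta> + U / B \<xi>1 * B \<xi>"
        proof (cases "\<xi> \<in> K")
          case True
          have "U / B \<xi>1 * B \<xi>1 \<le> U / B \<xi>1 * B \<xi>"
            by (rule mult_left_mono[OF \<xi>1(2)[OF True]]) (use pos U in simp)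
          then show ?thesis using U(2)[OF \<xi>] pos eta by simp
        next
          case False
          have "0 \<le> U / B \<xi>1 * B \<xi>" using B0 pos U by simp
          then show ?thesis using False \<xi> by (simp add: K_def)
        qed
      qed
    qed
  qed
  then obtain C where C: "0 \<le> C" "\<And>\<xi>. \<xi> \<in> {0..1} \<Longrightarrow> \<bar>u \<xi>\<bar> \<le> \<eta> + C * B \<xi>" by blast
  define \<epsilon>1 where "\<epsilon>1 = \<epsilon> / (8 * (C + 1))"
  have e1: "0 < \<epsilon>1" "2 * (C * \<epsilon>1) \<le> \<epsilon> / 4"
    using C(1) \<open>0 < \<epsilon>\<close> by (auto simp: \<epsilon>1_def field_simps)
  obtain L1 where L1: "1 \<le> L1" "\<forall>\<^sub>F k in sequentially.
      (\<Sum>(r, s)\<in>band L1 (N k). real (r + s) * c k r s * (z - P (real r / real (r + s)))\<^sup>2) \<le> \<epsilon>1"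
    using concentration_r[OF e1(1)] by blast
  obtain L2 where L2: "1 \<le> L2" "\<forall>\<^sub>F k in sequentially.
      (\<Sum>(r, s)\<in>band L2 (N k). real (r + s) * c k s r * (w - R (real r / real (r + s)))\<^sup>2) \<le> \<epsilon>1"
    using swapped.concentration_r[OF e1(1)] by blast
  define L where "L = max L1 L2"
  have L: "1 \<le> L" "L1 \<le> L" "L2 \<le> L" using L1(1) by (auto simp: L_def)
  define tl where "tl k = (\<Sum>\<^sub>\<infinity>(r, s)\<in>{(r, s). r + s \<ge> Suc (N k)}. real (r + s) * c k r s)" for k
  have "(\<lambda>k. U * tl k) \<longlonglongrightarrow> U * 0"
    unfolding tl_def by (intro tendsto_intros tail)
  then have "\<forall>\<^sub>F k in sequentially. U * tl k < \<epsilon> / 4"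
    by (rule order_tendstoD(2)) (use \<open>0 < \<epsilon>\<close> in simp)
  with L1(2) L2(2) have "\<forall>\<^sub>F k in sequentially. \<forall>F. finite F \<longrightarrow> F \<subseteq> {(r, s). L \<le> r + s} \<longrightarrow>
    (\<Sum>(r, s)\<in>F. real (r + s) * c k r s * \<bar>u (real r / real (r + s))\<bar>) \<le> \<epsilon>"
  proof eventually_elim
    case (elim k)
    show ?case
    proof (intro allI impI)
      fix F assume F: "finite F" "F \<subseteq> {(r, s). L \<le> r + s}"
      define D where "D = (\<lambda>(r, s). real (r + s) * c k r s)"
      define x where "x = (\<lambda>(r, s). real r / real (r + s))"
      have F_Omega: "F \<subseteq> Omega" using F(2) L(1) by (auto simp: Omega_def)
      have D0: "0 \<le> D i" if "i \<in> Omega" for i using that c_nonneg by (cases i) (auto simp: D_def)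
      have Db: "0 \<le> D i" if "i \<in> band M (N k)" "1 \<le> M" for i M
        using that(1) band_subset_Omega[OF that(2)] by (blast intro: D0)
      have x01: "x i \<in> {0..1}" for i unfolding x_def by (cases i) (simp only: case_prod_conv composition_bounds)
      \<comment> \<open>Concentration is known only up to size \<open>N k\<close>. Beyond it, u is
        replaced by its bound, and the assumed smallness of the tail is used.\<close>
      define F1 F2 where "F1 = F \<inter> band L (N k)" and "F2 = F - band L (N k)"
      have bandO: "band L (N k) \<subseteq> Omega" by (rule band_subset_Omega[OF L(1)])
      have "(\<Sum>i\<in>F1. D i * \<bar>u (x i)\<bar>) \<le> (\<Sum>i\<in>band L (N k). D i * \<bar>u (x i)\<bar>)"
        by (rule sum_mono2) (use bandO D0 in \<open>auto simp: F1_def\<close>)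
      also have "\<dots> \<le> (\<Sum>i\<in>band L (N k). D i * (\<eta> + C * B (x i)))"
        by (intro sum_mono mult_left_mono C(2)[OF x01] D0) (use bandO in auto)
      also have "\<dots> = \<eta> * sum D (band L (N k))
          + C * ((\<Sum>i\<in>band L (N k). D i * (z - P (x i))\<^sup>2) + (\<Sum>i\<in>band L (N k). D i * (w - R (1 - x i))\<^sup>2))"
        unfolding sum_distrib_left sum.distrib[symmetric]
        by (rule sum.cong) (auto simp: B_def algebra_simps)
      also have "\<dots> \<le> \<eta> * m + C * (\<epsilon>1 + \<epsilon>1)"
      proof (intro add_mono mult_left_mono)
        show "sum D (band L (N k)) \<le> m"
          using c_sum[of "band L (N k)" k] bandO by (simp add: D_def case_prod_unfold)
        have "(\<Sum>i\<in>band L (N k). D i * (z - P (x i))\<^sup>2) \<le> (\<Sum>i\<in>band L1 (N k). D i * (z - P (x i))\<^sup>2)"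
          by (intro sum_mono2 finite_band mult_nonneg_nonneg zero_le_power2 Db[OF _ L1(1)]) (use L in auto)
        then show "(\<Sum>i\<in>band L (N k). D i * (z - P (x i))\<^sup>2) \<le> \<epsilon>1"
          using elim(1) by (simp add: D_def x_def case_prod_unfold)
        have "(\<Sum>i\<in>band L (N k). D i * (w - R (1 - x i))\<^sup>2) \<le> (\<Sum>i\<in>band L2 (N k). D i * (w - R (1 - x i))\<^sup>2)"
          by (intro sum_mono2 finite_band mult_nonneg_nonneg zero_le_power2 Db[OF _ L2(1)]) (use L in auto)
        also have "\<dots> = (\<Sum>(r, s)\<in>band L2 (N k). real (r + s) * c k r s * (w - R (real s / real (s + r)))\<^sup>2)"
        proof (rule sum.cong, rule refl, clarify)
          fix r s assume "(r, s) \<in> band L2 (N k)"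
          then have "1 - real r / real (r + s) = real s / real (s + r)"
            using L2(1) by (simp add: field_simps)
          then show "D (r, s) * (w - R (1 - x (r, s)))\<^sup>2 = real (r + s) * c k r s * (w - R (real s / real (s + r)))\<^sup>2"
            by (simp add: D_def x_def)
        qed
        also have "\<dots> = (\<Sum>(r, s)\<in>band L2 (N k). real (r + s) * c k s r * (w - R (real r / real (r + s)))\<^sup>2)"
          by (subst band_swap[symmetric]) (simp add: add.commute)
        finally show "(\<Sum>i\<in>band L (N k). D i * (w - R (1 - x i))\<^sup>2) \<le> \<epsilon>1" using elim(2) by linarith
      qed (use eta C in auto)
      finally have bulk: "(\<Sum>i\<in>F1. D i * \<bar>u (x i)\<bar>) \<le> \<eta> * m + C * (\<epsilon>1 + \<epsilon>1)" .
      have 1: "(\<Sum>i\<in>F1. D i * \<bar>u (x i)\<bar>) \<le> 3 / 4 * \<epsilon>"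
      proof -
        have "\<epsilon> / (4 * t) * t = \<epsilon> / 4" if "0 < t" for t using that by simp
        from this[OF m] have "\<eta> * m = \<epsilon> / 4" by (simp only: \<eta>_def)
        then show ?thesis using bulk e1(2) \<open>0 < \<epsilon>\<close> distrib_left[of C \<epsilon>1 \<epsilon>1] by linarith
      qed
      have F2_Omega: "F2 \<subseteq> Omega" using F_Omega by (auto simp: F2_def)
      have "(\<Sum>i\<in>F2. D i * \<bar>u (x i)\<bar>) \<le> (\<Sum>i\<in>F2. D i * U)"
        by (intro sum_mono mult_left_mono U(2)[OF x01] D0) (use F2_Omega in auto)
      also have "\<dots> = U * sum D F2" by (simp add: sum_distrib_left mult.commute)
      also have "\<dots> \<le> U * tl k"
      proof (rule mult_left_mono[OF _ U(1)])
        show "sum D F2 \<le> tl k"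
          unfolding D_def tl_def
          by (rule X_plus_mass_tail[OF c]) (use F in \<open>auto simp: F2_def\<close>)
      qed
      finally have 2: "(\<Sum>i\<in>F2. D i * \<bar>u (x i)\<bar>) \<le> \<epsilon> / 4" using elim(3) by linarith
      have "(\<Sum>i\<in>F. D i * \<bar>u (x i)\<bar>) = (\<Sum>i\<in>F1. D i * \<bar>u (x i)\<bar>) + (\<Sum>i\<in>F2. D i * \<bar>u (x i)\<bar>)"
        unfolding F1_def F2_def using F(1) by (rule sum.Int_Diff)
      then have "(\<Sum>i\<in>F. D i * \<bar>u (x i)\<bar>) \<le> \<epsilon>" using 1 2 \<open>0 < \<epsilon>\<close> by linarith
      then show "(\<Sum>(r, s)\<in>F. real (r + s) * c k r s * \<bar>u (real r / real (r + s))\<bar>) \<le> \<epsilon>"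
        by (simp add: D_def x_def case_prod_unfold)
    qed
  qed
  with L(1) show ?thesis by blast
qed

text \<open>By \<open>vanishing\<close>, the tails of these sums are small uniformly in k, so the
  limit may be taken inside the sum. The intended S is a combination of \<rho> and \<sigma>, the
  same for all k; a suitable u thus yields a conservation law that survives the escape of
  mass.\<close>

lemma mass_limit:
  assumes u: "continuous_on {0..1} u"
    and zero: "\<And>\<xi>. \<xi> \<in> {0..1} \<Longrightarrow> z = P \<xi> \<Longrightarrow> w = R (1 - \<xi>) \<Longrightarrow> u \<xi> = 0"
    and S: "\<And>k. ((\<lambda>(r, s). real (r + s) * c k r s * u (real r / real (r + s))) has_sum S) Omega"
  shows "((\<lambda>(r, s). real (r + s) * e r s * u (real r / real (r + s))) has_sum S) Omega"
proof -
  define f where "f = (\<lambda>(r, s). real (r + s) * e r s * u (real r / real (r + s)))"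
  define fk where "fk k = (\<lambda>(r, s). real (r + s) * c k r s * u (real r / real (r + s)))" for k
  have fk_abs: "\<bar>fk k (r, s)\<bar> = real (r + s) * c k r s * \<bar>u (real r / real (r + s))\<bar>"
    if "(r, s) \<in> Omega" for k r s
    using c_nonneg[OF that] by (simp add: fk_def abs_mult)
  have f_lim: "(\<lambda>k. fk k i) \<longlonglongrightarrow> f i" if "i \<in> Omega" for i
    using that lim unfolding fk_def f_def by (cases i) (auto intro!: tendsto_intros)
  obtain U where U: "0 \<le> U" "\<And>\<xi>. \<xi> \<in> {0..1} \<Longrightarrow> \<bar>u \<xi>\<bar> \<le> U"
    using continuous_bounded[OF u] by blast
  have "(\<lambda>i. norm (f i)) summable_on Omega"
  proof (rule nonneg_bounded_sums_summable[where m = "U * m"])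
    fix F assume F: "finite F" "F \<subseteq> Omega"
    have "(\<Sum>i\<in>F. norm (f i)) \<le> (\<Sum>(r, s)\<in>F. U * (real (r + s) * e r s))"
    proof (rule sum_mono, clarify)
      fix r s assume "(r, s) \<in> F"
      then have e: "0 \<le> e r s" using F(2) e_nonneg by auto
      have "(real (r + s) * e r s) * \<bar>u (real r / real (r + s))\<bar> \<le> (real (r + s) * e r s) * U"
        by (rule mult_left_mono[OF U(2)[OF composition_bounds]]) (use e in simp)
      then show "norm (f (r, s)) \<le> U * (real (r + s) * e r s)"
        using e by (simp add: f_def abs_mult mult_ac)
    qed
    also have "\<dots> = U * (\<Sum>(r, s)\<in>F. real (r + s) * e r s)"
      by (simp add: sum_distrib_left case_prod_unfold)
    also have "\<dots> \<le> U * m" using e_sum[OF F] U(1) by (rule mult_left_mono)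
    finally show "(\<Sum>i\<in>F. norm (f i)) \<le> U * m" .
  qed simp
  then have f_sum: "f summable_on Omega" by (rule abs_summable_summable)
  have "\<bar>infsum f Omega - S\<bar> \<le> \<epsilon>" if "0 < \<epsilon>" for \<epsilon>
  proof -
    have e3: "0 < \<epsilon> / 3" using that by simp
    obtain L where L: "1 \<le> L" and ev: "\<forall>\<^sub>F k in sequentially. \<forall>F. finite F \<longrightarrow> F \<subseteq> {(r, s). L \<le> r + s} \<longrightarrow>
      (\<Sum>(r, s)\<in>F. real (r + s) * c k r s * \<bar>u (real r / real (r + s))\<bar>) \<le> \<epsilon> / 3"
      using vanishing[OF u zero e3] by blast
    \<comment> \<open>In \<open>Omega\<close>, the complement of \<open>band 1 (L - 1)\<close>
      consists of the sizes at least \<open>L\<close>; for \<open>L = 1\<close> the band is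
      empty.\<close>
    have ev': "\<forall>\<^sub>F k in sequentially. \<forall>F. finite F \<longrightarrow> F \<subseteq> Omega - band 1 (L - 1) \<longrightarrow>
      (\<Sum>i\<in>F. \<bar>fk k i\<bar>) \<le> \<epsilon> / 3"
      using ev
    proof eventually_elim
      case (elim k)
      show ?case
      proof (intro allI impI)
        fix F assume F: "finite F" "F \<subseteq> Omega - band 1 (L - 1)"
        have "F \<subseteq> {(r, s). L \<le> r + s}" using F(2) by (fastforce simp: Omega_def)
        with elim F(1) have "(\<Sum>(r, s)\<in>F. real (r + s) * c k r s * \<bar>u (real r / real (r + s))\<bar>) \<le> \<epsilon> / 3"
          by blast
        moreover have "(\<Sum>i\<in>F. \<bar>fk k i\<bar>) = (\<Sum>(r, s)\<in>F. real (r + s) * c k r s * \<bar>u (real r / real (r + s))\<bar>)"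
          by (rule sum.cong) (use F(2) fk_abs in auto)
        ultimately show "(\<Sum>i\<in>F. \<bar>fk k i\<bar>) \<le> \<epsilon> / 3" by simp
      qed
    qed
    have bandO: "band 1 (L - 1) \<subseteq> Omega" by (rule band_subset_Omega) simp
    have 1: "\<bar>infsum f Omega - sum f (band 1 (L - 1))\<bar> \<le> \<epsilon> / 3"
    proof (rule infsum_near_finite_sum[OF f_sum _ bandO])
      fix F assume F: "finite F" "F \<subseteq> Omega - band 1 (L - 1)"
      have "(\<lambda>k. \<Sum>i\<in>F. \<bar>fk k i\<bar>) \<longlonglongrightarrow> (\<Sum>i\<in>F. \<bar>f i\<bar>)"
        by (intro tendsto_intros f_lim) (use F in auto)
      then show "(\<Sum>i\<in>F. \<bar>f i\<bar>) \<le> \<epsilon> / 3"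
        by (rule tendsto_upperbound) (use ev' F in \<open>auto elim: eventually_mono\<close>)
    qed simp
    have "(\<lambda>k. sum (fk k) (band 1 (L - 1))) \<longlonglongrightarrow> sum f (band 1 (L - 1))"
      by (intro tendsto_intros f_lim) (use bandO in auto)
    then have "\<forall>\<^sub>F k in sequentially. dist (sum (fk k) (band 1 (L - 1))) (sum f (band 1 (L - 1))) < \<epsilon> / 3"
      using e3 by (rule tendstoD)
    with ev' have "\<forall>\<^sub>F k in sequentially. \<bar>infsum f Omega - S\<bar> \<le> \<epsilon>"
    proof eventually_elim
      case (elim k)
      have "\<bar>infsum (fk k) Omega - sum (fk k) (band 1 (L - 1))\<bar> \<le> \<epsilon> / 3"
      proof (rule infsum_near_finite_sum[OF _ _ bandO])
        show "fk k summable_on Omega" using S has_sum_imp_summable unfolding fk_def by blast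
      qed (use elim in auto)
      moreover have "infsum (fk k) Omega = S" using S[of k] infsumI unfolding fk_def by blast
      ultimately show ?case using 1 elim(2) unfolding dist_real_def by linarith
    qed
    then show ?thesis by simp
  qed
  then have "\<bar>infsum f Omega - S\<bar> \<le> 0" by (rule field_le_epsilon) simp
  then have "infsum f Omega = S" by simp
  with f_sum show ?thesis unfolding f_def[symmetric] by (simp add: has_sum_iff)
qed

lemma e_finite_mass: "finite_mass (equilibrium Q z w)"
proof -
  have "(\<lambda>(r, s). real r * e r s) summable_on Omega" "(\<lambda>(r, s). real s * e r s) summable_on Omega"
    by (rule summable_on_comparison_test[OF e_summable]; use e_nonneg in \<open>auto intro!: mult_right_mono\<close>)+
  moreover have "(\<lambda>(r, s). real r * e r s) summable_on Omega \<longleftrightarrow>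
      (\<lambda>(r, s). real r * equilibrium Q z w r s) summable_on Omega"
    "(\<lambda>(r, s). real s * e r s) summable_on Omega \<longleftrightarrow>
      (\<lambda>(r, s). real s * equilibrium Q z w r s) summable_on Omega"
    by (rule summable_on_cong; use e_equilibrium in auto)+
  ultimately show ?thesis by (simp add: finite_mass_def)
qed

lemma e_masses:
  "((\<lambda>(r, s). real r * e r s) has_sum rho_mass (equilibrium Q z w)) Omega"
  "((\<lambda>(r, s). real s * e r s) has_sum sigma_mass (equilibrium Q z w)) Omega"
proof -
  have "((\<lambda>(r, s). real r * equilibrium Q z w r s) has_sum rho_mass (equilibrium Q z w)) Omega"
    "((\<lambda>(r, s). real s * equilibrium Q z w r s) has_sum sigma_mass (equilibrium Q z w)) Omega"
    using e_finite_mass by (simp_all add: finite_mass_def rho_mass_def sigma_mass_def)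
  moreover have "((\<lambda>(r, s). real r * e r s) has_sum x) Omega \<longleftrightarrow>
      ((\<lambda>(r, s). real r * equilibrium Q z w r s) has_sum x) Omega"
    "((\<lambda>(r, s). real s * e r s) has_sum x) Omega \<longleftrightarrow>
      ((\<lambda>(r, s). real s * equilibrium Q z w r s) has_sum x) Omega" for x
    by (rule has_sum_cong; use e_equilibrium in auto)+
  ultimately show
    "((\<lambda>(r, s). real r * e r s) has_sum rho_mass (equilibrium Q z w)) Omega"
    "((\<lambda>(r, s). real s * e r s) has_sum sigma_mass (equilibrium Q z w)) Omega"
    by simp_all
qed

lemma escaping_composition:
  assumes "\<xi>0 \<in> {0..1}" "z = P \<xi>0" "w = R (1 - \<xi>0)" "\<xi> \<in> {0..1}" "z = P \<xi>"
  shows "\<xi> = \<xi>0"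
  using assms strict_mono_on_imp_inj_on[OF drift_profileD(3)[OF P]] by (auto simp: inj_on_def)

text \<open>The weight (r + s) (\<xi> - \<xi>0) equals (1 - \<xi>0) r - \<xi>0 s and vanishes at the
  only composition where mass can escape, so this combination of the masses is preserved in the
  limit. The missing masses are therefore in the proportion \<xi>0 to 1 - \<xi>0.\<close>

lemma mass_balance:
  assumes "\<xi>0 \<in> {0..1}" "z = P \<xi>0" "w = R (1 - \<xi>0)"
  shows "(1 - \<xi>0) * (\<rho> - rho_mass (equilibrium Q z w)) = \<xi>0 * (\<sigma> - sigma_mass (equilibrium Q z w))"
proof -
  have w: "real (r + s) * y * (real r / real (r + s) - \<xi>0) = (1 - \<xi>0) * (real r * y) + - \<xi>0 * (real s * y)"
    if "(r, s) \<in> Omega" for r s y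
  proof -
    have "real (r + s) \<noteq> 0" using that by (simp add: Omega_def)
    then have "real (r + s) * (real r / real (r + s) - \<xi>0) = real r - \<xi>0 * real (r + s)"
      by (simp add: right_diff_distrib)
    then have "real (r + s) * y * (real r / real (r + s) - \<xi>0) = y * (real r - \<xi>0 * real (r + s))"
      by (metis mult.assoc mult.commute)
    then show ?thesis by (simp add: algebra_simps)
  qed
  have *: "((\<lambda>(r, s). real (r + s) * y r s * (real r / real (r + s) - \<xi>0)) has_sum
      ((1 - \<xi>0) * a + - \<xi>0 * b)) Omega"
    if "((\<lambda>(r, s). real r * y r s) has_sum a) Omega" "((\<lambda>(r, s). real s * y r s) has_sum b) Omega"
    for y a b
  proof -
    have "((\<lambda>(r, s). (1 - \<xi>0) * (real r * y r s) + - \<xi>0 * (real s * y r s)) has_sum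
        ((1 - \<xi>0) * a + - \<xi>0 * b)) Omega"
      using that unfolding case_prod_unfold by (intro has_sum_add has_sum_cmult_right)
    moreover have "((\<lambda>(r, s). real (r + s) * y r s * (real r / real (r + s) - \<xi>0)) has_sum x) Omega \<longleftrightarrow>
       ((\<lambda>(r, s). (1 - \<xi>0) * (real r * y r s) + - \<xi>0 * (real s * y r s)) has_sum x) Omega" for x
      by (rule has_sum_cong) (use w in auto)
    ultimately show ?thesis by simp
  qed
  have "((\<lambda>(r, s). real (r + s) * e r s * (real r / real (r + s) - \<xi>0)) has_sum
      ((1 - \<xi>0) * \<rho> + - \<xi>0 * \<sigma>)) Omega"
  proof (rule mass_limit[where u = "\<lambda>\<xi>. \<xi> - \<xi>0"])
    show "continuous_on {0..1} (\<lambda>\<xi>. \<xi> - \<xi>0)" by (intro continuous_intros)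
    show "\<xi> - \<xi>0 = 0" if "\<xi> \<in> {0..1}" "z = P \<xi>" for \<xi>
      using escaping_composition[OF assms that] by simp
    show "((\<lambda>(r, s). real (r + s) * c k r s * (real r / real (r + s) - \<xi>0)) has_sum
      ((1 - \<xi>0) * \<rho> + - \<xi>0 * \<sigma>)) Omega" for k
      by (rule *[OF X_plus_massD(2,3)[OF c]])
  qed
  from has_sum_unique[OF this *[OF e_masses]] show ?thesis by (simp add: algebra_simps)
qed

text \<open>Without a composition of zero drift, \<open>mass_limit\<close> puts no constraint on u,
  and u(\<xi>) = \<xi> weights a cluster with r.\<close>

lemma no_escape:
  assumes "\<And>\<xi>. \<xi> \<in> {0..1} \<Longrightarrow> z = P \<xi> \<Longrightarrow> w = R (1 - \<xi>) \<Longrightarrow> False"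
  shows "rho_mass (equilibrium Q z w) = \<rho>"
proof -
  have w: "real (r + s) * y * (real r / real (r + s)) = real r * y" if "(r, s) \<in> Omega" for r s y
    using that by (simp add: Omega_def)
  have *: "((\<lambda>(r, s). real (r + s) * y r s * (real r / real (r + s))) has_sum x) Omega \<longleftrightarrow>
       ((\<lambda>(r, s). real r * y r s) has_sum x) Omega" for x y
    by (rule has_sum_cong) (use w in auto)
  have "((\<lambda>(r, s). real (r + s) * e r s * (real r / real (r + s))) has_sum \<rho>) Omega"
    by (rule mass_limit[where u = "\<lambda>\<xi>. \<xi>"])
      (use assms X_plus_massD(2)[OF c] * in \<open>auto intro: continuous_on_id\<close>)
  then show ?thesis using * e_masses(1) has_sum_unique by blast
qed

lemma e_rho_le: "rho_mass (equilibrium Q z w) \<le> \<rho>"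
proof (rule has_sum_le_finite_sums[OF e_masses(1)])
  fix F assume F: "finite F" "F \<subseteq> Omega"
  show "(\<Sum>(r, s)\<in>F. real r * e r s) \<le> \<rho>"
  proof (rule LIMSEQ_le_const2)
    show "(\<lambda>k. \<Sum>(r, s)\<in>F. real r * c k r s) \<longlonglongrightarrow> (\<Sum>(r, s)\<in>F. real r * e r s)"
      unfolding case_prod_unfold by (intro tendsto_intros lim) (use F(2) in auto)
    have "(\<Sum>(r, s)\<in>F. real r * c k r s) \<le> \<rho>" for k
      by (rule finite_sum_le_has_sum[OF X_plus_massD(2)[OF c]]) (use F c_nonneg in auto)
    then show "\<exists>M. \<forall>k\<ge>M. (\<Sum>(r, s)\<in>F. real r * c k r s) \<le> \<rho>" by blast
  qed
qed

lemma z_nonneg: "0 \<le> z"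
  by (rule e_nonneg[OF unit_in_Omega(1)])

lemma rho_mass_zero:
  assumes "z = 0"
  shows "rho_mass (equilibrium Q z w) = 0"
proof -
  have "((\<lambda>(r, s). real r * e r s) has_sum 0) Omega"
    by (rule has_sum_0) (use assms e_equilibrium in \<open>auto simp: equilibrium_def\<close>)
  then show ?thesis using e_masses(1) has_sum_unique by blast
qed

text \<open>If z = 0, the limit contains nothing of the first component, so all of \<rho> would have
  to escape. The only composition with P(\<xi>) = 0 is \<xi> = 0, and mass escaping there carries
  none of the first component.\<close>

lemma z_pos: "0 < z"
proof (rule ccontr)
  assume "\<not> 0 < z"
  then have z: "z = 0" using z_nonneg by simp
  note zero = rho_mass_zero[OF z]
  show False
  proof (cases "\<exists>\<xi>. \<xi> \<in> {0..1} \<and> z = P \<xi> \<and> w = R (1 - \<xi>)")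
    case True
    then obtain \<xi> where \<xi>: "\<xi> \<in> {0..1}" "z = P \<xi>" "w = R (1 - \<xi>)" by blast
    have "\<xi> = 0"
      using \<xi>(1,2) z drift_profileD(2)[OF P] strict_mono_on_imp_inj_on[OF drift_profileD(3)[OF P]]
      by (auto simp: inj_on_def)
    then show False using mass_balance[OF \<xi>] zero masses_pos by simp
  next
    case False
    then have "rho_mass (equilibrium Q z w) = \<rho>" by (intro no_escape) auto
    then show False using zero masses_pos by simp
  qed
qed

end

section \<open>Identification of the limit and decay of the relative entropy\<close>

context flat_sequence
begin

lemma w_pos: "0 < w"
  by (rule swapped.z_pos)

lemma e_sigma_le: "sigma_mass (equilibrium Q z w) \<le> \<sigma>"
  using swapped.e_rho_le by (simp add: rho_mass_swap)

lemma no_escape_sigma: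
  assumes "\<And>\<xi>. \<xi> \<in> {0..1} \<Longrightarrow> z = P \<xi> \<Longrightarrow> w = R (1 - \<xi>) \<Longrightarrow> False"
  shows "sigma_mass (equilibrium Q z w) = \<sigma>"
proof -
  have "rho_mass (equilibrium (\<lambda>r s. Q s r) w z) = \<sigma>"
    by (rule swapped.no_escape) (use assms[of "1 - \<xi>" for \<xi>] in auto)
  then show ?thesis by (simp add: rho_mass_swap)
qed

lemma escaping_composition_interior:
  assumes "\<xi>0 \<in> {0..1}" "z = P \<xi>0" "w = R (1 - \<xi>0)"
  shows "0 < \<xi>0" "\<xi>0 < 1"
proof -
  have "\<xi>0 \<noteq> 0" using assms(2) z_pos drift_profileD(2)[OF P] by auto
  moreover have "\<xi>0 \<noteq> 1" using assms(3) w_pos drift_profileD(2)[OF R] by auto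
  ultimately show "0 < \<xi>0" "\<xi>0 < 1" using assms(1) by auto
qed

text \<open>Finite mass at (u, v) bounds u^r v^s Q(r,s), whereas z^r w^s Q(r,s) decays at most like
  exp(-\<epsilon> n) near \<xi>0. Comparing logarithms along clusters of size n with composition
  tending to \<xi>0, dividing by n and letting \<epsilon> tend to 0 gives the claim.\<close>

lemma escaping_optimal:
  assumes \<xi>0: "\<xi>0 \<in> {0..1}" "z = P \<xi>0" "w = R (1 - \<xi>0)"
    and uv: "0 < u" "0 < v" "finite_mass (equilibrium Q u v)"
  shows "0 \<le> \<xi>0 * ln (z / u) + (1 - \<xi>0) * ln (w / v)"
proof -
  note int = escaping_composition_interior[OF \<xi>0]
  define E where "E = equilibrium Q u v"
  define b where "b = rho_mass E + sigma_mass E"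
  have Epos: "0 < E r s" if "(r, s) \<in> Omega" for r s
    using uv pos_Q[OF that] by (simp add: E_def equilibrium_def)
  have E_mass: "E \<in> X_plus_mass (rho_mass E) (sigma_mass E)"
    using uv(3) Epos by (auto simp: X_plus_mass_def X_plus_def E_def intro: less_imp_le)
  have lnE: "ln (Q r s) + real r * ln u + real s * ln v \<le> b" if "(r, s) \<in> Omega" for r s
  proof -
    have "ln (E r s) \<le> E r s - 1" using Epos[OF that] by (rule ln_le_minus_one)
    also have "\<dots> \<le> b" using X_plus_mass_le[OF E_mass that] by (simp add: b_def)
    also have "ln (E r s) = ln (Q r s) + real r * ln u + real s * ln v"
      using uv pos_Q[OF that] by (simp add: E_def equilibrium_def ln_mult ln_realpow)
    finally show ?thesis .
  qed
  \<comment> \<open>Rounding down \<xi>0 n gives a cluster of size n whose composition tends to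
    \<xi>0.\<close>
  define x where "x n = real (nat \<lfloor>\<xi>0 * real n\<rfloor>) / real n" for n
  have x_lim: "x \<longlonglongrightarrow> \<xi>0" unfolding x_def using int by (intro floor_ratio_tendsto) simp
  show ?thesis
  proof (rule field_le_epsilon)
    fix \<epsilon> :: real assume e: "0 < \<epsilon>"
    obtain \<eta> C where \<eta>: "0 < \<eta>" "\<And>r s. (r, s) \<in> Omega \<Longrightarrow> \<bar>real r / real (r + s) - \<xi>0\<bar> \<le> \<eta> \<Longrightarrow>
      - \<epsilon> * real (r + s) - C \<le> ln (Q r s) + real r * ln z + real s * ln w"
      using Q_lower_bound_near[OF pos_Q P R int e] \<xi>0 by metis
    have "\<forall>\<^sub>F n in sequentially. - \<epsilon> - (C + b) / real n \<le> x n * ln (z / u) + (1 - x n) * ln (w / v)"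
      using eventually_gt_at_top[of 0] tendstoD[OF x_lim \<eta>(1)]
    proof eventually_elim
      case (elim n)
      define r where "r = nat \<lfloor>\<xi>0 * real n\<rfloor>"
      define s where "s = n - r"
      have "\<xi>0 * real n \<le> real n" using int by (simp add: mult_left_le_one_le)
      then have "r \<le> n" unfolding r_def by linarith
      then have rs: "r + s = n" "(r, s) \<in> Omega" using elim by (auto simp: s_def Omega_def)
      have xn: "x n = real r / real n" by (simp add: x_def r_def)
      have "\<bar>real r / real (r + s) - \<xi>0\<bar> \<le> \<eta>"
        using elim(2) xn rs(1) by (simp add: dist_real_def)
      from \<eta>(2)[OF rs(2) this] lnE[OF rs(2)]
      have "- \<epsilon> * real n - (C + b) \<le> real r * ln (z / u) + real s * ln (w / v)"
        using z_pos w_pos uv by (simp add: ln_div rs(1) algebra_simps)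
      then have "(- \<epsilon> * real n - (C + b)) / real n \<le> (real r * ln (z / u) + real s * ln (w / v)) / real n"
        by (rule divide_right_mono) simp
      moreover have "(real r * ln (z / u) + real s * ln (w / v)) / real n
          = x n * ln (z / u) + (1 - x n) * ln (w / v)"
      proof -
        have "1 - x n = real s / real n" using elim(1) rs(1) by (auto simp: xn field_simps)
        then show ?thesis by (simp add: xn add_divide_distrib)
      qed
      moreover have "(- \<epsilon> * real n - (C + b)) / real n = - \<epsilon> - (C + b) / real n"
        using elim(1) by (simp add: diff_divide_distrib)
      ultimately show ?case by simp
    qed
    moreover have "(\<lambda>n. - \<epsilon> - (C + b) / real n) \<longlonglongrightarrow> - \<epsilon> - 0"
      by (intro tendsto_intros lim_const_over_n)
    moreover have "(\<lambda>n. x n * ln (z / u) + (1 - x n) * ln (w / v))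
        \<longlonglongrightarrow> \<xi>0 * ln (z / u) + (1 - \<xi>0) * ln (w / v)"
      by (intro tendsto_intros x_lim)
    ultimately have "- \<epsilon> - 0 \<le> \<xi>0 * ln (z / u) + (1 - \<xi>0) * ln (w / v)"
      by (intro tendsto_le[OF sequentially_bot])
    then show "0 \<le> \<xi>0 * ln (z / u) + (1 - \<xi>0) * ln (w / v) + \<epsilon>" by simp
  qed
qed

text \<open>By \<open>mass_balance\<close> the missing masses are \<xi> (a + b) and (1 - \<xi>) (a +
  b) with a + b \<ge> 0, so \<open>escaping_optimal\<close> at (u, v) is the variational inequality
  of (z, w) tested at (u, v). The inequality of (u, v) tested at (z, w) is part of its definition,
  and these two inequalities suffice for uniqueness. If no composition has zero drift, no mass is
  missing.\<close>

lemma limit_pair: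
  assumes "determined_pair Q \<rho> \<sigma> u v"
  shows "z = u \<and> w = v"
proof -
  have uv: "0 < u" "0 < v" "finite_mass (equilibrium Q u v)"
    using assms by (auto simp: determined_pair_def equilibrium_set_def)
  have zw_set: "(z, w) \<in> equilibrium_set Q"
    using z_pos w_pos e_finite_mass by (simp add: equilibrium_set_def less_imp_le)
  define a b where "a = \<rho> - rho_mass (equilibrium Q z w)" and "b = \<sigma> - sigma_mass (equilibrium Q z w)"
  have "0 \<le> ln (z / u) * a + ln (w / v) * b"
  proof (cases "\<exists>\<xi>. \<xi> \<in> {0..1} \<and> z = P \<xi> \<and> w = R (1 - \<xi>)")
    case True
    then obtain \<xi> where \<xi>: "\<xi> \<in> {0..1}" "z = P \<xi>" "w = R (1 - \<xi>)" by blast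
    have "(1 - \<xi>) * a = \<xi> * b" using mass_balance[OF \<xi>] by (simp add: a_def b_def)
    then have a: "a = \<xi> * (a + b)" and b: "b = (1 - \<xi>) * (a + b)" by (simp_all add: algebra_simps)
    have "0 \<le> a + b" using e_rho_le e_sigma_le by (simp add: a_def b_def)
    then have "0 \<le> (a + b) * (\<xi> * ln (z / u) + (1 - \<xi>) * ln (w / v))"
      using escaping_optimal[OF \<xi> uv] by simp
    also have "\<dots> = ln (z / u) * (\<xi> * (a + b)) + ln (w / v) * ((1 - \<xi>) * (a + b))"
      by (simp add: algebra_simps)
    also have "\<dots> = ln (z / u) * a + ln (w / v) * b" using a b by simp
    finally show ?thesis .
  next
    case False
    then have "a = 0" "b = 0"
      using no_escape no_escape_sigma by (auto simp: a_def b_def)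
    then show ?thesis by simp
  qed
  then show ?thesis
    using assms zw_set z_pos w_pos uv e_finite_mass pos_Q
    by (intro equilibrium_pair_unique[where Q = Q and \<rho> = \<rho> and \<sigma> = \<sigma>])
      (auto simp: determined_pair_def a_def b_def)
qed

lemma equilibrium_log_bound:
  obtains C where "0 \<le> C"
    "\<And>r s. (r, s) \<in> Omega \<Longrightarrow> - ln (equilibrium Q z w r s) \<le> C * real (r + s)"
proof -
  obtain C where C: "0 \<le> C" "\<And>r s. (r, s) \<in> Omega \<Longrightarrow> - C * real (r + s) \<le> ln (Q r s)"
    using Q_lower_bound[OF pos_Q P R Q_unit] by blast
  show thesis
  proof (rule that[of "C + \<bar>ln z\<bar> + \<bar>ln w\<bar>"])
    fix r s assume rs: "(r, s) \<in> Omega"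
    have "- ln (equilibrium Q z w r s) = - ln (Q r s) + real r * - ln z + real s * - ln w"
      using z_pos w_pos pos_Q[OF rs] by (simp add: equilibrium_def ln_mult ln_realpow)
    also have "\<dots> \<le> C * real (r + s) + real (r + s) * \<bar>ln z\<bar> + real (r + s) * \<bar>ln w\<bar>"
    proof -
      have "real j * - x \<le> real (r + s) * \<bar>x\<bar>" if "j \<le> r + s" for j x
      proof -
        have "real j * - x \<le> real j * \<bar>x\<bar>" by (rule mult_left_mono) auto
        also have "\<dots> \<le> real (r + s) * \<bar>x\<bar>" using that by (intro mult_right_mono) auto
        finally show ?thesis .
      qed
      from this[of r "ln z"] this[of s "ln w"] show ?thesis using C(2)[OF rs] by simp
    qed
    finally show "- ln (equilibrium Q z w r s) \<le> (C + \<bar>ln z\<bar> + \<bar>ln w\<bar>) * real (r + s)"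
      by (simp add: algebra_simps)
  qed (use C in simp)
qed

text \<open>This puts -ln of the equilibrium into a form to which \<open>vanishing\<close> applies.
  Close to a composition \<xi>0 of zero drift, the sharp bound costs \<epsilon>/2 per unit of size
  plus a constant, which sizes above L absorb. At distance more than \<eta> the crude linear bound C
  suffices, since C/\<eta> times the distance exceeds C. Without such a composition, u may be the
  constant C.\<close>

lemma equilibrium_log_weight:
  assumes "0 < \<epsilon>"
  obtains u L where "continuous_on {0..1} u" "\<And>\<xi>. 0 \<le> u \<xi>"
    "\<And>\<xi>. \<xi> \<in> {0..1} \<Longrightarrow> z = P \<xi> \<Longrightarrow> w = R (1 - \<xi>) \<Longrightarrow> u \<xi> = 0"
    "\<And>r s. (r, s) \<in> Omega \<Longrightarrow> L \<le> r + s \<Longrightarrow>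
       - ln (equilibrium Q z w r s) \<le> real (r + s) * (\<epsilon> + u (real r / real (r + s)))"
proof -
  obtain C where C: "0 \<le> C"
    "\<And>r s. (r, s) \<in> Omega \<Longrightarrow> - ln (equilibrium Q z w r s) \<le> C * real (r + s)"
    by (rule equilibrium_log_bound) (rule that)
  show thesis
  proof (cases "\<exists>\<xi>. \<xi> \<in> {0..1} \<and> z = P \<xi> \<and> w = R (1 - \<xi>)")
    case False
    show thesis
    proof (rule that[of "\<lambda>_. C" 0])
      fix r s assume "(r, s) \<in> Omega"
      from C(2)[OF this] show "- ln (equilibrium Q z w r s) \<le> real (r + s) * (\<epsilon> + C)"
        using assms mult_nonneg_nonneg[of "real (r + s)" \<epsilon>]
        by (simp only: distrib_left mult.commute[of C]) linarith
    qed (use False C in auto)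
  next
    case True
    then obtain \<xi>0 where \<xi>0: "\<xi>0 \<in> {0..1}" "z = P \<xi>0" "w = R (1 - \<xi>0)" by blast
    obtain \<eta> C' where \<eta>: "0 < \<eta>" "\<And>r s. (r, s) \<in> Omega \<Longrightarrow> \<bar>real r / real (r + s) - \<xi>0\<bar> \<le> \<eta> \<Longrightarrow>
      - (\<epsilon> / 2) * real (r + s) - C' \<le> ln (Q r s) + real r * ln z + real s * ln w"
      using Q_lower_bound_near[OF pos_Q P R escaping_composition_interior[OF \<xi>0], of "\<epsilon> / 2"] assms \<xi>0
      by (metis half_gt_zero)
    obtain L :: nat where L: "C' / (\<epsilon> / 2) < real L" using reals_Archimedean2 by blast
    show thesis
    proof (rule that[of "\<lambda>\<xi>. C / \<eta> * \<bar>\<xi> - \<xi>0\<bar>" L])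
      show "continuous_on {0..1} (\<lambda>\<xi>. C / \<eta> * \<bar>\<xi> - \<xi>0\<bar>)" by (intro continuous_intros)
      show "0 \<le> C / \<eta> * \<bar>\<xi> - \<xi>0\<bar>" for \<xi> using C(1) \<eta>(1) by simp
      show "C / \<eta> * \<bar>\<xi> - \<xi>0\<bar> = 0" if "\<xi> \<in> {0..1}" "z = P \<xi>" for \<xi>
        using escaping_composition[OF \<xi>0 that] by simp
      fix r s assume rs: "(r, s) \<in> Omega" "L \<le> r + s"
      define x where "x = real r / real (r + s)"
      show "- ln (equilibrium Q z w r s) \<le> real (r + s) * (\<epsilon> + C / \<eta> * \<bar>real r / real (r + s) - \<xi>0\<bar>)"
      proof (cases "\<bar>x - \<xi>0\<bar> \<le> \<eta>")
        case True
        have "ln (equilibrium Q z w r s) = ln (Q r s) + real r * ln z + real s * ln w"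
          using z_pos w_pos pos_Q[OF rs(1)] by (simp add: equilibrium_def ln_mult ln_realpow)
        then have "- ln (equilibrium Q z w r s) \<le> (\<epsilon> / 2) * real (r + s) + C'"
          using \<eta>(2)[OF rs(1)] True by (simp add: x_def)
        moreover have "C' \<le> (\<epsilon> / 2) * real (r + s)"
        proof -
          have "C' / (\<epsilon> / 2) \<le> real (r + s)" using L rs(2) by linarith
          then show ?thesis using assms by (simp add: field_simps)
        qed
        ultimately have "- ln (equilibrium Q z w r s) \<le> real (r + s) * \<epsilon>" by (simp add: mult.commute)
        also have "\<dots> \<le> real (r + s) * (\<epsilon> + C / \<eta> * \<bar>x - \<xi>0\<bar>)"
          using C(1) \<eta>(1) by (intro mult_left_mono) auto
        finally show ?thesis by (simp add: x_def)
      next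
        case False
        have "C / \<eta> * \<eta> \<le> C / \<eta> * \<bar>x - \<xi>0\<bar>"
          using False C(1) \<eta>(1) by (intro mult_left_mono) auto
        then have "C \<le> \<epsilon> + C / \<eta> * \<bar>x - \<xi>0\<bar>" using \<eta>(1) assms by simp
        then have "real (r + s) * C \<le> real (r + s) * (\<epsilon> + C / \<eta> * \<bar>x - \<xi>0\<bar>)"
          by (rule mult_left_mono) simp
        then show ?thesis using C(2)[OF rs(1)] by (simp add: x_def mult.commute)
      qed
    qed
  qed
qed

text \<open>On small clusters pointwise convergence suffices. On large ones a term is y ln y - y ln
  E + E - y with y = c(r,s). The first part is at most ln(1 + m) y, small relative to the mass
  density; the second is covered by \<epsilon> times the mass and by \<open>vanishing\<close>; the
  third has a small tail because the limit has finite mass. Each of these four parts and the small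
  clusters get a fifth of \<delta>.\<close>

lemma rel_entropy_small:
  assumes "0 < \<delta>"
  shows "\<forall>\<^sub>F k in sequentially. rel_entropy (c k) (equilibrium Q z w) \<le> ennreal \<delta>"
proof -
  define E where "E = equilibrium Q z w"
  define T where "T k = (\<lambda>(r, s). E r s * entropy_fun (c k r s / E r s))" for k
  have m: "0 < m" using masses_pos by simp
  have Epos: "0 < E r s" if "(r, s) \<in> Omega" for r s
    using z_pos w_pos pos_Q[OF that] by (simp add: E_def equilibrium_def)
  have eE: "e r s = E r s" if "(r, s) \<in> Omega" for r s
    using e_equilibrium[OF that] by (simp add: E_def)
  have T0: "0 \<le> T k i" if "i \<in> Omega" for k i
    using that Epos c_nonneg
    by (cases i) (auto simp: T_def less_imp_le intro!: mult_nonneg_nonneg entropy_fun_nonneg divide_nonneg_pos)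
  define \<epsilon> where "\<epsilon> = \<delta> / (5 * (m + 1))"
  have eps: "0 < \<epsilon>" "\<epsilon> * m \<le> \<delta> / 5" using m assms by (auto simp: \<epsilon>_def field_simps)
  obtain u L1 where u: "continuous_on {0..1} u" "\<And>\<xi>. 0 \<le> u \<xi>"
    "\<And>\<xi>. \<xi> \<in> {0..1} \<Longrightarrow> z = P \<xi> \<Longrightarrow> w = R (1 - \<xi>) \<Longrightarrow> u \<xi> = 0"
    "\<And>r s. (r, s) \<in> Omega \<Longrightarrow> L1 \<le> r + s \<Longrightarrow>
       - ln (E r s) \<le> real (r + s) * (\<epsilon> + u (real r / real (r + s)))"
  proof (rule equilibrium_log_weight[OF eps(1)])
    fix u L
    assume "continuous_on {0..1} u" "\<And>\<xi>. 0 \<le> u \<xi>"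
      "\<And>\<xi>. \<xi> \<in> {0..1} \<Longrightarrow> z = P \<xi> \<Longrightarrow> w = R (1 - \<xi>) \<Longrightarrow> u \<xi> = 0"
      "\<And>r s. (r, s) \<in> Omega \<Longrightarrow> L \<le> r + s \<Longrightarrow>
         - ln (equilibrium Q z w r s) \<le> real (r + s) * (\<epsilon> + u (real r / real (r + s)))"
    then show thesis by (intro that[of u L, unfolded E_def])
  qed
  have d5: "0 < \<delta> / 5" using assms by simp
  obtain L2 where L2: "1 \<le> L2" "\<forall>\<^sub>F k in sequentially. \<forall>F. finite F \<longrightarrow> F \<subseteq> {(r, s). L2 \<le> r + s} \<longrightarrow>
    (\<Sum>(r, s)\<in>F. real (r + s) * c k r s * \<bar>u (real r / real (r + s))\<bar>) \<le> \<delta> / 5"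
    using vanishing[OF u(1,3) d5] by blast
  obtain L3 where L3: "1 \<le> L3" "\<And>F. finite F \<Longrightarrow> F \<subseteq> {(r, s). L3 \<le> r + s} \<Longrightarrow>
      (\<Sum>(r, s)\<in>F. real (r + s) * e r s) \<le> \<delta> / 5"
    by (rule summable_tail_small[OF _ e_summable d5]) (use e_nonneg in auto)
  obtain L4 :: nat where L4: "m * ln (1 + m) / (\<delta> / 5) < real L4" using reals_Archimedean2 by blast
  define L where "L = Max {L1, L2, L3, L4}"
  have L: "L1 \<le> L" "L2 \<le> L" "L3 \<le> L" "L4 \<le> L" "1 \<le> L" using L2(1) by (auto simp: L_def)
  have bandO: "band 1 (L - 1) \<subseteq> Omega" by (rule band_subset_Omega) simp
  have "(\<lambda>k. sum (T k) (band 1 (L - 1))) \<longlonglongrightarrow> (\<Sum>i\<in>band 1 (L - 1). 0)"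
  proof (intro tendsto_sum)
    fix i assume "i \<in> band 1 (L - 1)"
    then have "i \<in> Omega" using bandO by blast
    then obtain r s where i: "i = (r, s)" "(r, s) \<in> Omega" by (cases i) auto
    have "(\<lambda>k. c k r s / E r s) \<longlonglongrightarrow> E r s / E r s"
      using lim[OF i(2)] Epos[OF i(2)] unfolding eE[OF i(2)] by (intro tendsto_intros) auto
    then have q: "(\<lambda>k. c k r s / E r s) \<longlonglongrightarrow> 1" using Epos[OF i(2)] by simp
    have "(\<lambda>k. E r s * (c k r s / E r s * ln (c k r s / E r s) + 1 - c k r s / E r s)) \<longlonglongrightarrow>
        E r s * (1 * ln 1 + 1 - 1)"
      by (intro tendsto_intros q) simp
    then show "(\<lambda>k. T k i) \<longlonglongrightarrow> 0" by (simp add: i T_def entropy_fun_def)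
  qed
  then have "\<forall>\<^sub>F k in sequentially. sum (T k) (band 1 (L - 1)) < \<delta> / 5"
    by (rule order_tendstoD(2)) (use assms in simp)
  with L2(2) show ?thesis
  proof eventually_elim
    case (elim k)
    define D where "D = (\<lambda>(r, s). real (r + s) * c k r s)"
    define x where "x = (\<lambda>(r, s). real r / real (r + s))"
    \<comment> \<open>Using 1 + m as the bound on y keeps the logarithm nonnegative. The factor 1/L
      comes from L y \<le> (r + s) y.\<close>
    have tail_term: "T k (r, s) \<le> (ln (1 + m) / real L) * D (r, s) + \<epsilon> * D (r, s)
        + D (r, s) * \<bar>u (x (r, s))\<bar> + real (r + s) * e r s"
      if rs: "L \<le> r + s" for r s
    proof -
      have O: "(r, s) \<in> Omega" using rs L(5) by (auto simp: Omega_def)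
      define y where "y = c k r s"
      have y: "0 \<le> y" "y \<le> m" using c_nonneg[OF O] X_plus_mass_le[OF c O] by (auto simp: y_def)
      have E: "0 < E r s" by (rule Epos[OF O])
      have "T k (r, s) = y * ln (y / E r s) + E r s - y"
        using E by (simp add: T_def entropy_fun_def y_def algebra_simps)
      also have "y * ln (y / E r s) \<le> y * ln (1 + m) + y * - ln (E r s)"
      proof (cases "y = 0")
        case False
        with y have "0 < y" by simp
        then have "ln (y / E r s) \<le> ln (1 + m) + - ln (E r s)" using y E by (simp add: ln_div)
        then have "y * ln (y / E r s) \<le> y * (ln (1 + m) + - ln (E r s))"
          using y(1) by (rule mult_left_mono)
        then show ?thesis by (simp only: distrib_left)
      qed simp
      also have "y * ln (1 + m) \<le> (ln (1 + m) / real L) * D (r, s)"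
      proof -
        have "real L * y \<le> D (r, s)" using rs y by (simp add: D_def y_def mult_right_mono)
        then have "(ln (1 + m) / real L) * (real L * y) \<le> (ln (1 + m) / real L) * D (r, s)"
          using m by (intro mult_left_mono) auto
        then show ?thesis using L(5) by (simp add: mult.commute)
      qed
      also have "y * - ln (E r s) \<le> y * (real (r + s) * (\<epsilon> + u (x (r, s))))"
        using u(4)[OF O] rs L(1) y by (intro mult_left_mono) (auto simp: x_def)
      also have "\<dots> = \<epsilon> * D (r, s) + D (r, s) * \<bar>u (x (r, s))\<bar>"
        using u(2) by (simp add: D_def y_def algebra_simps)
      also have "E r s \<le> real (r + s) * e r s"
        using O E mult_right_mono[of 1 "real (r + s)" "E r s"] by (simp add: eE Omega_def)
      finally show ?thesis using y by linarith
    qed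
    show "rel_entropy (c k) (equilibrium Q z w) \<le> ennreal \<delta>"
      unfolding rel_entropy_def E_def[symmetric]
    proof (rule infsum_le_finite_sums)
      fix F :: "(nat \<times> nat) set" assume F: "finite F" "F \<subseteq> Omega"
      define F1 F2 where "F1 = F \<inter> band 1 (L - 1)" and "F2 = F - band 1 (L - 1)"
      have F2: "finite F2" "F2 \<subseteq> Omega" "F2 \<subseteq> {(r, s). L \<le> r + s}"
        using F by (fastforce simp: F2_def Omega_def)+
      have "sum (T k) F1 \<le> sum (T k) (band 1 (L - 1))"
        by (rule sum_mono2) (use bandO T0 in \<open>auto simp: F1_def\<close>)
      then have 1: "sum (T k) F1 \<le> \<delta> / 5" using elim(2) by linarith
      have D_sum: "sum D F2 \<le> m" unfolding D_def by (rule c_sum[OF F2(1,2)])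
      have "sum (T k) F2 \<le> (\<Sum>(r, s)\<in>F2. (ln (1 + m) / real L) * D (r, s) + \<epsilon> * D (r, s)
        + D (r, s) * \<bar>u (x (r, s))\<bar> + real (r + s) * e r s)"
        by (rule sum_mono) (use tail_term F2(3) in auto)
      also have "\<dots> = (ln (1 + m) / real L) * sum D F2 + \<epsilon> * sum D F2
        + (\<Sum>i\<in>F2. D i * \<bar>u (x i)\<bar>) + (\<Sum>(r, s)\<in>F2. real (r + s) * e r s)"
        by (simp add: case_prod_unfold sum.distrib sum_distrib_left)
      also have "\<dots> \<le> (ln (1 + m) / real L) * m + \<epsilon> * m + \<delta> / 5 + \<delta> / 5"
      proof (intro add_mono mult_left_mono D_sum)
        show "(\<Sum>i\<in>F2. D i * \<bar>u (x i)\<bar>) \<le> \<delta> / 5"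
        proof -
          have "F2 \<subseteq> {(r, s). L2 \<le> r + s}" using F2(3) L(2) by auto
          then show ?thesis using elim(1) F2(1) by (simp add: D_def x_def case_prod_unfold)
        qed
        show "(\<Sum>(r, s)\<in>F2. real (r + s) * e r s) \<le> \<delta> / 5"
          by (rule L3(2)[OF F2(1)]) (use F2(3) L(3) in auto)
      qed (use m eps in auto)
      also have "(ln (1 + m) / real L) * m \<le> \<delta> / 5"
      proof -
        have "m * ln (1 + m) / (\<delta> / 5) \<le> real L" using L4 L(4) by linarith
        then show ?thesis using assms L(5) by (simp add: field_simps)
      qed
      finally have 2: "sum (T k) F2 \<le> \<delta> / 5 + \<epsilon> * m + \<delta> / 5 + \<delta> / 5" by simp
      have "sum (T k) F = sum (T k) F1 + sum (T k) F2"
        unfolding F1_def F2_def using F(1) by (rule sum.Int_Diff)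
      then have "sum (T k) F \<le> \<delta>" using 1 2 eps(2) by linarith
      moreover have "(\<Sum>(r, s)\<in>F. ennreal (E r s * entropy_fun (c k r s / E r s))) = ennreal (sum (T k) F)"
      proof -
        have "(\<Sum>(r, s)\<in>F. ennreal (E r s * entropy_fun (c k r s / E r s))) = (\<Sum>i\<in>F. ennreal (T k i))"
          by (rule sum.cong) (auto simp: T_def)
        also have "\<dots> = ennreal (sum (T k) F)" by (rule sum_ennreal) (use F T0 in auto)
        finally show ?thesis .
      qed
      ultimately show "(\<Sum>(r, s)\<in>F. ennreal (E r s * entropy_fun (c k r s / E r s))) \<le> ennreal \<delta>"
        by (simp add: ennreal_leI)
    qed (rule nonneg_summable_on_complete, simp)
  qed
qed

end

section \<open>The dissipation estimate\<close>

theorem theorem1p10: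
  fixes a adot b bdot Q f g :: "nat \<Rightarrow> nat \<Rightarrow> real"
    and \<alpha> c\<^sub>\<alpha> C\<^sub>\<alpha> \<gamma> \<rho> \<sigma> \<delta> z w :: real
    and \<Phi> \<Phi>' \<Phi>'' \<phi> \<psi> :: "real \<Rightarrow> real"
  assumes pos_a: "\<forall>(r, s)\<in>Omega. 0 < a r s \<and> 0 < adot r s"
    and pos_b: "\<forall>(r, s)\<in>Omega. 0 < b (r + 1) s \<and> 0 < bdot r (s + 1)"
    and pos_Q: "\<forall>(r, s)\<in>Omega. 0 < Q r s"
    and Q_unit: "Q 1 0 = 1" "Q 0 1 = 1"
    and i_const: "0 \<le> \<alpha>" "\<alpha> \<le> 1" "0 < c\<^sub>\<alpha>" "0 < C\<^sub>\<alpha>"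
    and i_a: "\<forall>(r, s)\<in>Omega. c\<^sub>\<alpha> * real (r + s) powr \<alpha> \<le> a r s \<and> a r s \<le> C\<^sub>\<alpha> * real (r + s) powr \<alpha>"
    and i_adot: "\<forall>(r, s)\<in>Omega. c\<^sub>\<alpha> * real (r + s) powr \<alpha> \<le> adot r s \<and> adot r s \<le> C\<^sub>\<alpha> * real (r + s) powr \<alpha>"
    and ii_b: "\<forall>(r, s)\<in>Omega. b (r + 1) s = a r s * (Q r s / Q (r + 1) s)"
    and ii_bdot: "\<forall>(r, s)\<in>Omega. bdot r (s + 1) = adot r s * (Q r s / Q r (s + 1))"
    and iii_C0: "continuous_on {0..1} \<Phi>"
    and iii_deriv1: "\<forall>\<xi>\<in>{0<..<1}. (\<Phi> has_real_derivative \<Phi>' \<xi>) (at \<xi>)"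
    and iii_deriv2: "\<forall>\<xi>\<in>{0<..<1}. (\<Phi>' has_real_derivative \<Phi>'' \<xi>) (at \<xi>)"
    and iii_C2: "continuous_on {0<..<1} \<Phi>''"
    and iii_lim1: "\<exists>L. ((\<lambda>\<xi>. (1 - \<xi>) * \<Phi>' \<xi>) \<longlongrightarrow> L) (at_left 1)"
    and iii_lim0: "\<exists>L. ((\<lambda>\<xi>. \<xi> * \<Phi>' \<xi>) \<longlongrightarrow> L) (at_right 0)"
    and iii_phi: "\<forall>\<xi>\<in>{0<..<1}. \<phi> \<xi> = exp (\<Phi> \<xi> + (1 - \<xi>) * \<Phi>' \<xi>)" "continuous_on {0<..1} \<phi>"
    and iii_psi: "\<forall>\<xi>\<in>{0<..<1}. \<psi> \<xi> = exp (\<Phi> \<xi> - \<xi> * \<Phi>' \<xi>)" "continuous_on {0..<1} \<psi>"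
    and iii_f: "\<forall>(r, s)\<in>Omega. Q (r + 1) s / Q r s = \<phi> (real (r + 1) / real (r + s + 1)) * f r s"
    and iii_g: "\<forall>(r, s)\<in>Omega. Q r (s + 1) / Q r s = \<psi> (real r / real (r + s + 1)) * g r s"
    and iii_fg: "\<forall>\<epsilon>>0. \<exists>N0. \<forall>(r, s)\<in>Omega. r + s \<ge> N0 \<longrightarrow> \<bar>1 - f r s\<bar> < \<epsilon> \<and> \<bar>1 - g r s\<bar> < \<epsilon>"
    and iv_gamma: "0 < \<gamma>"
    and iv: "\<forall>\<xi>\<in>{0<..<1}. (1 - \<xi>) * \<Phi>'' \<xi> \<le> - \<gamma> \<and> \<xi> * \<Phi>'' \<xi> \<le> - \<gamma>"
    and v_phi: "\<exists>L. ((\<lambda>\<xi>. \<xi> * \<phi> \<xi>) \<longlongrightarrow> L) (at_right 0)"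
    and v_psi: "\<exists>L. ((\<lambda>\<xi>. (1 - \<xi>) * \<psi> \<xi>) \<longlongrightarrow> L) (at_left 1)"
    and vi_f: "limsup (\<lambda>n. ereal (MAX r\<in>{0<..n}. (f r (n - r) / f (r - 1) (n - r + 1)) ^ (n + 1))) \<le> 1"
    and vi_g: "liminf (\<lambda>n. ereal (MIN r\<in>{0..<n}. (g (r + 1) (n - r - 1) / g r (n - r)) ^ (n + 1))) \<ge> 1"
    and "0 < \<rho>" "0 < \<sigma>" "0 < \<delta>"
    and zw: "determined_pair Q \<rho> \<sigma> z w"
  shows "\<exists>K \<delta>\<^sub>2 M :: real. 0 < K \<and> 0 < \<delta>\<^sub>2 \<and>
           (\<forall>c\<in>X_plus_mass \<rho> \<sigma>. \<forall>N :: nat. real N \<ge> M \<longrightarrow>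
              (\<Sum>\<^sub>\<infinity>(r, s)\<in>{(r, s). r + s \<ge> N + 1}. real (r + s) * c r s) \<le> \<delta>\<^sub>2 \<longrightarrow>
              rel_entropy c (equilibrium Q z w) > ennreal \<delta> \<longrightarrow>
              dissipation a adot b bdot c \<ge> ennreal (real N powr (\<alpha> - 1) / K))"
proof -
  have Qpos: "0 < Q r s" if "(r, s) \<in> Omega" for r s using pos_Q that by auto
  obtain l1 where l1: "((\<lambda>\<xi>. (1 - \<xi>) * \<Phi>' \<xi>) \<longlongrightarrow> l1) (at_left 1)" using iii_lim1 by blast
  obtain l0 where l0: "((\<lambda>\<xi>. \<xi> * \<Phi>' \<xi>) \<longlongrightarrow> l0) (at_right 0)" using iii_lim0 by blast
  obtain P where P: "continuous_on {0..1} P" "P 0 = 0" "strict_mono_on {0..1} P"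
    "\<And>\<xi>. \<xi> \<in> {0<..1} \<Longrightarrow> P \<xi> = 1 / \<phi> \<xi>"
    by (rule profile_inverse[OF iii_C0 _ _ l1 _ iii_phi(2) iv_gamma])
      (use iii_deriv1 iii_deriv2 iii_phi(1) iv in auto)
  have prof_P: "drift_profile (\<lambda>r s. Q r s / Q (r + 1) s) P"
  proof (rule drift_profile_ratio[OF P(1-4)])
    show "Q (r + 1) s / Q r s = \<phi> (real (r + 1) / real (r + s + 1)) * f r s" if "1 \<le> r + s" for r s
      using iii_f that by (simp add: Omega_def)
    show "\<exists>n0. \<forall>r s. 1 \<le> r + s \<longrightarrow> n0 \<le> r + s \<longrightarrow> \<bar>1 - f r s\<bar> < \<epsilon>" if "0 < \<epsilon>" for \<epsilon>
      using iii_fg that by (fastforce simp: Omega_def)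
  qed
  \<comment> \<open>The reflection \<xi> -> 1 - \<xi> changes the sign of \<Phi>' and exchanges the
    two halves of the concavity condition, and the limit at 0 becomes one at 1 with value
    -l0.\<close>
  obtain R where R: "continuous_on {0..1} R" "R 0 = 0" "strict_mono_on {0..1} R"
    "\<And>\<xi>. \<xi> \<in> {0<..1} \<Longrightarrow> R \<xi> = 1 / \<psi> (1 - \<xi>)"
  proof (rule profile_inverse[where \<Phi> = "\<lambda>\<xi>. \<Phi> (1 - \<xi>)" and \<Phi>' = "\<lambda>\<xi>. - \<Phi>' (1 - \<xi>)"
        and \<Phi>'' = "\<lambda>\<xi>. \<Phi>'' (1 - \<xi>)" and \<phi> = "\<lambda>\<xi>. \<psi> (1 - \<xi>)" and l = "- l0" and \<gamma> = \<gamma>])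
    show "continuous_on {0..1} (\<lambda>\<xi>. \<Phi> (1 - \<xi>))"
      by (rule continuous_on_compose2[OF iii_C0]) (auto intro!: continuous_intros)
    show "continuous_on {0<..1} (\<lambda>\<xi>. \<psi> (1 - \<xi>))"
      by (rule continuous_on_compose2[OF iii_psi(2)]) (auto intro!: continuous_intros)
    have refl1: "((\<lambda>x. 1 - x) has_real_derivative -1) (at \<xi>)" for \<xi> :: real
      by (auto intro!: derivative_eq_intros)
    show "((\<lambda>\<xi>. \<Phi> (1 - \<xi>)) has_real_derivative - \<Phi>' (1 - \<xi>)) (at \<xi>)" if "\<xi> \<in> {0<..<1}" for \<xi>
      using DERIV_chain2[OF _ refl1, of \<Phi> "\<Phi>' (1 - \<xi>)" \<xi>] iii_deriv1 that by auto
    show "((\<lambda>\<xi>. - \<Phi>' (1 - \<xi>)) has_real_derivative \<Phi>'' (1 - \<xi>)) (at \<xi>)" if "\<xi> \<in> {0<..<1}" for \<xi>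
      using DERIV_minus[OF DERIV_chain2[OF _ refl1, of \<Phi>' "\<Phi>'' (1 - \<xi>)" \<xi>]] iii_deriv2 that by auto
    show "((\<lambda>\<xi>. (1 - \<xi>) * - \<Phi>' (1 - \<xi>)) \<longlongrightarrow> - l0) (at_left 1)"
    proof -
      have "filterlim (\<lambda>\<xi>. 1 - \<xi>) (at_right (0::real)) (at_left 1)"
      proof (rule filterlim_at[THEN iffD2], intro conjI)
        show "\<forall>\<^sub>F \<xi> in at_left (1::real). 1 - \<xi> \<in> {0<..} \<and> 1 - \<xi> \<noteq> 0"
          by (simp add: eventually_at_filter)
        have "((\<lambda>\<xi>. 1 - \<xi>) \<longlongrightarrow> 1 - (1::real)) (at_left 1)" by (intro tendsto_intros)
        then show "((\<lambda>\<xi>. 1 - \<xi>) \<longlongrightarrow> (0::real)) (at_left 1)" by simp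
      qed
      from tendsto_minus[OF filterlim_compose[OF l0 this]] show ?thesis by simp
    qed
    show "(1 - \<xi>) * \<Phi>'' (1 - \<xi>) \<le> - \<gamma>" "\<xi> * \<Phi>'' (1 - \<xi>) \<le> - \<gamma>" if "\<xi> \<in> {0<..<1}" for \<xi>
      using bspec[OF iv, of "1 - \<xi>"] that by auto
  qed (use iii_psi(1) iv_gamma in auto)
  have prof_R: "drift_profile (\<lambda>r s. Q s r / Q s (r + 1)) R"
  proof (rule drift_profile_ratio[OF R(1-4), where f = "\<lambda>r s. g s r"])
    show "Q s (r + 1) / Q s r = \<psi> (1 - real (r + 1) / real (r + s + 1)) * g s r" if "1 \<le> r + s" for r s
    proof -
      have "1 - real (r + 1) / real (r + s + 1) = real s / real (s + r + 1)" by (simp add: field_simps)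
      then show ?thesis using iii_g that by (simp add: Omega_def add.commute)
    qed
    show "\<exists>n0. \<forall>r s. 1 \<le> r + s \<longrightarrow> n0 \<le> r + s \<longrightarrow> \<bar>1 - g s r\<bar> < \<epsilon>" if "0 < \<epsilon>" for \<epsilon>
    proof -
      obtain N0 where "\<forall>(r, s)\<in>Omega. r + s \<ge> N0 \<longrightarrow> \<bar>1 - f r s\<bar> < \<epsilon> \<and> \<bar>1 - g r s\<bar> < \<epsilon>"
        using iii_fg \<open>0 < \<epsilon>\<close> by blast
      then show ?thesis by (intro exI[of _ N0]) (auto simp: Omega_def add.commute)
    qed
  qed
  define m where "m = \<rho> + \<sigma>"
  have m: "0 < m" using \<open>0 < \<rho>\<close> \<open>0 < \<sigma>\<close> by (simp add: m_def)
  obtain C1 where C1: "1 \<le> C1" "\<And>r s. Q r s / Q (r + 1) s \<le> C1"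
    using drift_profile_imp_bounded[OF prof_P] by auto
  obtain C2 where C2: "1 \<le> C2" "\<And>s r. Q r s / Q r (s + 1) \<le> C2"
    using drift_profile_imp_bounded[OF prof_R] by auto
  \<comment> \<open>One bound for the monomer densities and for both kinds of quotients, as
    \<open>flux_bound\<close> requires.\<close>
  define Z where "Z = max m (max C1 C2)"
  define B where "B = 2 * m * Z / c\<^sub>\<alpha>"
  have Z: "m \<le> Z" "C1 \<le> Z" "C2 \<le> Z" by (auto simp: Z_def)
  have B0: "0 \<le> B" using m Z(1) i_const(3) by (simp add: B_def)
  have flux: "(\<Sum>(r, s)\<in>band 1 N. real (r + s) * \<bar>y 1 0 * y r s - Q r s / Q (r + 1) s * y (r + 1) s\<bar>)\<^sup>2
        \<le> B * (real N powr (1 - \<alpha>) * d)"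
      "(\<Sum>(r, s)\<in>band 1 N. real (r + s) * \<bar>y 0 1 * y r s - Q r s / Q r (s + 1) * y r (s + 1)\<bar>)\<^sup>2
        \<le> B * (real N powr (1 - \<alpha>) * d)"
    if y: "y \<in> X_plus_mass \<rho> \<sigma>" and D: "dissipation a adot b bdot y \<le> ennreal d" and d: "0 \<le> d" for y N d
  proof -
    note y0 = X_plus_massD(1)[OF y]
    have yZ: "0 \<le> y 1 0" "y 1 0 \<le> Z" "0 \<le> y 0 1" "y 0 1 \<le> Z"
      using y0 X_plus_mass_le[OF y, of 1 0] X_plus_mass_le[OF y, of 0 1] Z(1)
      by (auto simp: Omega_def m_def)
    have y_swap: "(\<Sum>(r, s)\<in>F. real (r + s) * y s r) \<le> m" if "finite F" "F \<subseteq> Omega" for F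
    proof -
      have "(\<Sum>(r, s)\<in>F. real (r + s) * y s r) = (\<Sum>(r, s)\<in>prod.swap ` F. real (r + s) * y r s)"
        by (subst sum.reindex) (auto simp: case_prod_unfold add.commute)
      also have "\<dots> \<le> m"
        unfolding m_def by (rule X_plus_mass_finite_sum[OF y]) (use that in \<open>auto simp: Omega_def\<close>)
      finally show ?thesis .
    qed
    define T1 where "T1 = (\<lambda>(r, s). log_gap (a r s * y 1 0 * y r s) (b (r + 1) s * y (r + 1) s))"
    define T2 where "T2 = (\<lambda>(r, s). log_gap (adot r s * y 0 1 * y r s) (bdot r (s + 1) * y r (s + 1)))"
    have "(\<Sum>i\<in>band 1 N. T1 i + T2 i) = (\<Sum>\<^sub>\<infinity>i\<in>band 1 N. T1 i + T2 i)" by simp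
    also have "\<dots> \<le> (\<Sum>\<^sub>\<infinity>i\<in>Omega. T1 i + T2 i)"
      by (intro infsum_mono_neutral nonneg_summable_on_complete) (auto simp: Omega_def)
    also have "\<dots> \<le> ennreal d" using D by (simp add: dissipation_def T1_def T2_def case_prod_unfold)
    finally have "sum T1 (band 1 N) + sum T2 (band 1 N) \<le> ennreal d" by (simp add: sum.distrib)
    then have T: "sum T1 (band 1 N) \<le> ennreal d" "sum T2 (band 1 N) \<le> ennreal d"
      by (auto intro: order_trans[rotated])
    have Q01: "0 \<le> Q r s / Q (r + 1) s" "0 \<le> Q r s / Q r (s + 1)" if "1 \<le> r + s" for r s
      using Qpos[of r s] Qpos[of "r + 1" s] Qpos[of r "s + 1"] that by (auto simp: Omega_def)
    show "(\<Sum>(r, s)\<in>band 1 N. real (r + s) * \<bar>y 1 0 * y r s - Q r s / Q (r + 1) s * y (r + 1) s\<bar>)\<^sup>2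
        \<le> B * (real N powr (1 - \<alpha>) * d)"
      unfolding B_def
    proof (rule flux_bound[where a = a])
      have "(\<Sum>(r, s)\<in>band 1 N. log_gap (a r s * y 1 0 * y r s) (a r s * (Q r s / Q (r + 1) s) * y (r + 1) s))
        = sum T1 (band 1 N)"
        by (rule sum.cong) (use ii_b in \<open>auto simp: T1_def Omega_def\<close>)
      then show "(\<Sum>(r, s)\<in>band 1 N. log_gap (a r s * y 1 0 * y r s) (a r s * (Q r s / Q (r + 1) s) * y (r + 1) s))
        \<le> ennreal d" using T by simp
      show "(\<Sum>(r, s)\<in>F. real (r + s) * y r s) \<le> m" if "finite F" "F \<subseteq> Omega" for F
        unfolding m_def by (rule X_plus_mass_finite_sum[OF y that])
      show "0 \<le> Q r s / Q (r + 1) s \<and> Q r s / Q (r + 1) s \<le> Z" if "1 \<le> r + s" for r s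
        using Q01[OF that] C1(2)[of r s] Z by linarith
    qed (use i_const i_a y0 yZ d in \<open>auto simp: Omega_def\<close>)
    \<comment> \<open>\<open>flux_bound\<close> treats steps in the first index, so the second flux
      is estimated with exchanged indices and the sum is swapped back.\<close>
    have "(\<Sum>(r, s)\<in>band 1 N. real (r + s) * \<bar>y 0 1 * y s r - Q s r / Q s (r + 1) * y s (r + 1)\<bar>)\<^sup>2
        \<le> B * (real N powr (1 - \<alpha>) * d)"
      unfolding B_def
    proof (rule flux_bound[where a = "\<lambda>r s. adot s r" and c = "\<lambda>r s. y s r" and p = "\<lambda>r s. Q s r / Q s (r + 1)"])
      have "(\<Sum>(r, s)\<in>band 1 N. log_gap (adot s r * y 0 1 * y s r) (adot s r * (Q s r / Q s (r + 1)) * y s (r + 1)))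
        = (\<Sum>(r, s)\<in>band 1 N. log_gap (adot r s * y 0 1 * y r s) (adot r s * (Q r s / Q r (s + 1)) * y r (s + 1)))"
        by (rule sum.reindex_bij_witness[of _ prod.swap prod.swap]) (auto simp: band_def)
      also have "\<dots> = sum T2 (band 1 N)"
        by (rule sum.cong) (use ii_bdot in \<open>auto simp: T2_def Omega_def\<close>)
      finally show "(\<Sum>(r, s)\<in>band 1 N. log_gap (adot s r * y 0 1 * y s r) (adot s r * (Q s r / Q s (r + 1)) * y s (r + 1)))
        \<le> ennreal d" using T by simp
      show "c\<^sub>\<alpha> * real (r + s) powr \<alpha> \<le> adot s r" if "1 \<le> r + s" for r s
        using bspec[OF i_adot, of "(s, r)"] that by (simp add: Omega_def add.commute)
      show "0 \<le> Q s r / Q s (r + 1) \<and> Q s r / Q s (r + 1) \<le> Z" if "1 \<le> r + s" for r s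
        using Q01(2)[of s r] that C2(2)[of s r] Z by linarith
    qed (use i_const y0 yZ d y_swap in \<open>auto simp: Omega_def\<close>)
    then show "(\<Sum>(r, s)\<in>band 1 N. real (r + s) * \<bar>y 0 1 * y r s - Q r s / Q r (s + 1) * y r (s + 1)\<bar>)\<^sup>2
        \<le> B * (real N powr (1 - \<alpha>) * d)"
      by (subst (asm) band_swap[where G = "\<lambda>r s. real (s + r) * \<bar>y 0 1 * y r s - Q r s / Q r (s + 1) * y r (s + 1)\<bar>"])
        (simp add: add.commute)
  qed
  show ?thesis
  proof (rule ccontr)
    assume neg: "\<not> ?thesis"
    \<comment> \<open>A failure for the constants K = M = k + 1 and 1/(k + 1) for the tail.\<close>
    define bad where "bad k y M \<longleftrightarrow> y \<in> X_plus_mass \<rho> \<sigma> \<and> Suc k \<le> M \<and>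
        (\<Sum>\<^sub>\<infinity>(r, s)\<in>{(r, s). r + s \<ge> M + 1}. real (r + s) * y r s) \<le> inverse (real (Suc k)) \<and>
        ennreal \<delta> < rel_entropy y (equilibrium Q z w) \<and>
        dissipation a adot b bdot y < ennreal (real M powr (\<alpha> - 1) / real (Suc k))" for k y M
    have "\<exists>y M. bad k y M" for k
    proof (rule ccontr)
      assume no_bad: "\<not> ?thesis"
      have "\<forall>y\<in>X_plus_mass \<rho> \<sigma>. \<forall>M :: nat. real M \<ge> real (Suc k) \<longrightarrow>
              (\<Sum>\<^sub>\<infinity>(r, s)\<in>{(r, s). r + s \<ge> M + 1}. real (r + s) * y r s) \<le> inverse (real (Suc k)) \<longrightarrow>
              rel_entropy y (equilibrium Q z w) > ennreal \<delta> \<longrightarrow>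
              dissipation a adot b bdot y \<ge> ennreal (real M powr (\<alpha> - 1) / real (Suc k))"
      proof (intro ballI allI impI leI notI)
        fix y and M :: nat
        assume "y \<in> X_plus_mass \<rho> \<sigma>" "real (Suc k) \<le> real M"
          "(\<Sum>\<^sub>\<infinity>(r, s)\<in>{(r, s). r + s \<ge> M + 1}. real (r + s) * y r s) \<le> inverse (real (Suc k))"
          "ennreal \<delta> < rel_entropy y (equilibrium Q z w)"
          "dissipation a adot b bdot y < ennreal (real M powr (\<alpha> - 1) / real (Suc k))"
        then have "bad k y M" unfolding bad_def of_nat_le_iff by (intro conjI)
        then show False using no_bad by blast
      qed
      moreover have "0 < real (Suc k)" "0 < inverse (real (Suc k))" by auto
      ultimately show False using neg by blast
    qed
    then obtain c N where bad: "\<And>k. bad k (c k) (N k)" by metis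
    note c = bad[unfolded bad_def, THEN conjunct1]
    note N = bad[unfolded bad_def, THEN conjunct2, THEN conjunct1]
    note tail = bad[unfolded bad_def, THEN conjunct2, THEN conjunct2, THEN conjunct1]
    note H = bad[unfolded bad_def, THEN conjunct2, THEN conjunct2, THEN conjunct2, THEN conjunct1]
    note D = bad[unfolded bad_def, THEN conjunct2, THEN conjunct2, THEN conjunct2, THEN conjunct2]
    have c_le: "\<bar>c k r s\<bar> \<le> m" if "(r, s) \<in> Omega" for k r s
      using X_plus_massD(1)[OF c that] X_plus_mass_le[OF c that] by (simp add: m_def)
    obtain e \<tau> where \<tau>: "strict_mono (\<tau> :: nat \<Rightarrow> nat)"
      and lim: "\<And>r s. (r, s) \<in> Omega \<Longrightarrow> (\<lambda>k. c (\<tau> k) r s) \<longlonglongrightarrow> e r s"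
    proof (rule pointwise_convergent_subsequence[where c = c and m = m, OF c_le])
      fix e \<tau> assume "strict_mono (\<tau> :: nat \<Rightarrow> nat)"
        "\<And>r s. (r, s) \<in> Omega \<Longrightarrow> (\<lambda>k. c (\<tau> k) r s) \<longlonglongrightarrow> e r s"
      then show thesis by (rule that)
    qed
    have \<tau>k: "Suc k \<le> Suc (\<tau> k)" for k using seq_suble[OF \<tau>] by simp
    have inv_lim: "(\<lambda>k. inverse (real (Suc k))) \<longlonglongrightarrow> 0" by (rule LIMSEQ_inverse_real_of_nat)
    have inv: "inverse (real (Suc (\<tau> k))) \<le> inverse (real (Suc k))" for k
      using \<tau>k[of k] by (intro le_imp_inverse_le) auto
    have sq: "(\<lambda>k. sqrt (B * inverse (real (Suc k)))) \<longlonglongrightarrow> sqrt (B * 0)"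
      by (intro tendsto_intros inv_lim)
    \<comment> \<open>The powers of N cancel, as N > 0, so the squared weighted flux is at most B/(k
      + 1). This cancellation is what fixes the exponent \<alpha> - 1.\<close>
    have bound: "x \<le> sqrt (B * inverse (real (Suc k)))"
      if "x\<^sup>2 \<le> B * (real (N (\<tau> k)) powr (1 - \<alpha>) * (real (N (\<tau> k)) powr (\<alpha> - 1) / real (Suc (\<tau> k))))" for x k
    proof -
      have "0 < real (N (\<tau> k))" using N[of "\<tau> k"] by linarith
      then have "real (N (\<tau> k)) powr (1 - \<alpha>) * real (N (\<tau> k)) powr (\<alpha> - 1) = 1"
        by (simp flip: powr_add)
      then have "x\<^sup>2 \<le> B * inverse (real (Suc (\<tau> k)))"
        using that by (simp add: divide_inverse flip: mult.assoc)
      also have "\<dots> \<le> B * inverse (real (Suc k))" using inv B0 by (rule mult_left_mono)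
      finally show ?thesis by (rule real_le_rsqrt)
    qed
    interpret flat_sequence Q P R "\<lambda>k. c (\<tau> k)" "\<lambda>k. N (\<tau> k)" e \<rho> \<sigma>
    proof
      show "c (\<tau> k) \<in> X_plus_mass \<rho> \<sigma>" for k by (rule c)
      show "filterlim (\<lambda>k. N (\<tau> k)) at_top sequentially"
      proof (rule filterlim_at_top_mono[OF filterlim_Suc])
        show "\<forall>\<^sub>F k in sequentially. Suc k \<le> N (\<tau> k)"
          using order_trans[OF \<tau>k N] by (intro always_eventually allI)
      qed
      show "(\<lambda>k. \<Sum>\<^sub>\<infinity>(r, s)\<in>{(r, s). r + s \<ge> Suc (N (\<tau> k))}. real (r + s) * c (\<tau> k) r s) \<longlonglongrightarrow> 0"
      proof (rule tendsto_sandwich[OF _ _ tendsto_const inv_lim])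
        show "\<forall>\<^sub>F k in sequentially. 0 \<le> (\<Sum>\<^sub>\<infinity>(r, s)\<in>{(r, s). r + s \<ge> Suc (N (\<tau> k))}. real (r + s) * c (\<tau> k) r s)"
          by (intro always_eventually allI infsum_nonneg)
            (auto simp: Omega_def intro!: mult_nonneg_nonneg X_plus_massD(1)[OF c])
        show "\<forall>\<^sub>F k in sequentially. (\<Sum>\<^sub>\<infinity>(r, s)\<in>{(r, s). r + s \<ge> Suc (N (\<tau> k))}. real (r + s) * c (\<tau> k) r s)
            \<le> inverse (real (Suc k))"
          using order_trans[OF tail inv] by (intro always_eventually allI) simp
      qed
      show "(\<lambda>k. \<Sum>(r, s)\<in>band 1 (N (\<tau> k)). real (r + s) *
          \<bar>c (\<tau> k) 1 0 * c (\<tau> k) r s - Q r s / Q (r + 1) s * c (\<tau> k) (r + 1) s\<bar>) \<longlonglongrightarrow> 0"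
      proof (rule tendsto_sandwich[OF _ _ tendsto_const sq[unfolded mult_zero_right real_sqrt_zero]])
        show "\<forall>\<^sub>F k in sequentially. (\<Sum>(r, s)\<in>band 1 (N (\<tau> k)). real (r + s) *
          \<bar>c (\<tau> k) 1 0 * c (\<tau> k) r s - Q r s / Q (r + 1) s * c (\<tau> k) (r + 1) s\<bar>)
          \<le> sqrt (B * inverse (real (Suc k)))"
          by (intro always_eventually allI bound flux(1) c less_imp_le[OF D]) simp
      qed (auto intro!: always_eventually sum_nonneg)
      show "(\<lambda>k. \<Sum>(r, s)\<in>band 1 (N (\<tau> k)). real (r + s) *
          \<bar>c (\<tau> k) 0 1 * c (\<tau> k) r s - Q r s / Q r (s + 1) * c (\<tau> k) r (s + 1)\<bar>) \<longlonglongrightarrow> 0"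
      proof (rule tendsto_sandwich[OF _ _ tendsto_const sq[unfolded mult_zero_right real_sqrt_zero]])
        show "\<forall>\<^sub>F k in sequentially. (\<Sum>(r, s)\<in>band 1 (N (\<tau> k)). real (r + s) *
          \<bar>c (\<tau> k) 0 1 * c (\<tau> k) r s - Q r s / Q r (s + 1) * c (\<tau> k) r (s + 1)\<bar>)
          \<le> sqrt (B * inverse (real (Suc k)))"
          by (intro always_eventually allI bound flux(2) c less_imp_le[OF D]) simp
      qed (auto intro!: always_eventually sum_nonneg)
    qed (use Qpos Q_unit prof_P prof_R \<open>0 < \<rho>\<close> \<open>0 < \<sigma>\<close> lim in auto)
    \<comment> \<open>Here \<open>z\<close> and \<open>w\<close> are the given pair;
      \<open>limit_pair\<close> identifies them with the parameters \<open>e 1 0\<close> and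
      \<open>e 0 1\<close> of the limit.\<close>
    have "\<forall>\<^sub>F k in sequentially. rel_entropy (c (\<tau> k)) (equilibrium Q z w) \<le> ennreal \<delta>"
      using rel_entropy_small[OF \<open>0 < \<delta>\<close>] limit_pair[OF zw] by simp
    then obtain k where "rel_entropy (c (\<tau> k)) (equilibrium Q z w) \<le> ennreal \<delta>"
      by (meson eventually_sequentially order_refl)
    with H[of "\<tau> k"] show False by simp
  qed
qed

end
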